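(* The functor $\mathsf{Q}\colon\mathsf{P}(\mathsf{coc}\text{-}\mathsf{HBr})\to\mathsf{P}(\mathsf{rRB}^{\star})$, defined by $\mathsf{Q}((\mathbb{H},\mathbb{D},x,y))=(\mathsf{F}(\mathbb{H}),\mathsf{F}(\mathbb{D}),x,x,y,y)$ and $\mathsf{Q}((z,t))=(z,t,z,t)$, is left adjoint to the functor $\mathsf{R}\colon\mathsf{P}(\mathsf{rRB}^{\star})\to\mathsf{P}(\mathsf{coc}\text{-}\mathsf{HBr})$, defined by $\mathsf{R}\big((T\colon H\to B,\varphi_H),(L\colon A\to D,\varphi_A),f,h,g,l\big)=\big(\mathsf{G}(T\colon H\to B,\varphi_H),\mathsf{G}(L\colon A\to D,\varphi_A),f,g\big)$ and $\mathsf{R}((x,y,z,t))=(x,y)$.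
   Context: $\mathsf{C}$ is a strict braided monoidal category with tensor product $\otimes$, unit object $K$ and braiding $c$. For an object $P$ and a morphism $f$, write $P\otimes f$ for $id_P\otimes f$ and $f\otimes P$ for $f\otimes id_P$. (Co)algebras, Hopf algebras and modules are taken in $\mathsf{C}$. A Hopf algebra is written $X=(X,\eta_X,\mu_X,\varepsilon_X,\delta_X,\lambda_X)$; it is cocommutative if $c_{X,X}\circ\delta_X=\delta_X$. Hopf algebra morphisms are algebra-coalgebra morphisms. Tensor products of algebras and coalgebras carry $\mu_{A\otimes B}=(\mu_A\otimes\mu_B)\circ(A\otimes c_{B,A}\otimes B)$ and $\delta_{D\otimes E}=(D\otimes c_{D,E}\otimes E)\circ(\delta_D\otimes\delta_E)$. For a Hopf algebra $X$ and an algebra-coalgebra $A$, $(A,\varphi_A)$ is a left $X$-module algebra-coalgebra if $(A,\varphi_A)$ is a left $X$-module, $\varphi_A\circ(X\otimes\eta_A)=\varepsilon_X\otimes\eta_A$, $\varphi_A\circ(X\otimes\mu_A)=\mu_A\circ(\varphi_A\otimes\varphi_A)\circ(X\otimes c_{X,A}\otimes A)\circ(\delta_X\otimes A\otimes A)$, and $\varphi_A\colon X\otimes A\to A$ is a coalgebra morphism. Relative Rota-Baxter operator $(T\colon H\to B,\varphi_H)$: $H$, $B$ are Hopf algebras, $(H,\varphi_H)$ is a left $B$-module algebra-coalgebra and $T\colon H\to B$ is a coalgebra morphism with $\mu_B\circ(T\otimes T)=T\circ\mu_H\circ(H\otimes(\varphi_H\circ(T\otimes H)))\circ(\delta_H\otimes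 H)$. A morphism $(T\colon H\to B,\varphi_H)\to(L\colon A\to D,\varphi_A)$ is a pair $(f,h)$ of Hopf algebra morphisms $f\colon H\to A$, $h\colon B\to D$ with $L\circ f=h\circ T$ and $f\circ\varphi_H=\varphi_A\circ(h\otimes f)$. This is the category $\mathsf{rRB}$; $\mathsf{rRB}^{\star}$ is the full subcategory where $H$ is cocommutative. Hopf brace $\mathbb{H}=(H_1,H_2)$: Hopf algebras $H_1=(H,\eta_H,\mu_H^1,\varepsilon_H,\delta_H,\lambda_H^1)$, $H_2=(H,\eta_H,\mu_H^2,\varepsilon_H,\delta_H,\lambda_H^2)$ on the same coalgebra with $\mu_H^2\circ(H\otimes\mu_H^1)=\mu_H^1\circ(\mu_H^2\otimes\Gamma_{H_1})\circ(H\otimes c_{H,H}\otimes H)\circ(\delta_H\otimes H\otimes H)$, where $\Gamma_{H_1}=\mu_H^1\circ(\lambda_H^1\otimes\mu_H^2)\circ(\delta_H\otimes H)$. Morphisms of Hopf braces are morphisms in $\mathsf{C}$ that are Hopf algebra morphisms for both structures. $\mathsf{coc}\text{-}\mathsf{HBr}$ is the category of Hopf braces with cocommutative $\delta_H$. Functors: $\mathsf{F}\colon\mathsf{coc}\text{-}\mathsf{HBr}\to\mathsf{rRB}^{\star}$, $\mathsf{F}(\mathbb{H})=(id_H\colon H_1\to H_2,\Gamma_{H_1})$, $\mathsf{F}(x)=(x,x)$; $\mathsf{G}\colon\mathsf{rRB}^{\star}\to\mathsf{coc}\text{-}\mathsf{HBr}$, $\mathsf{G}(T\colon H\to B,\varphi_H)=\overline{\mathbb{H}}=(H,\overline{H})$,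 $\mathsf{G}(f,h)=f$, where $\overline{H}=(H,\eta_H,\overline{\mu}_H,\varepsilon_H,\delta_H,\overline{\lambda}_H)$ with $\overline{\mu}_H=\mu_H\circ(H\otimes(\varphi_H\circ(T\otimes H)))\circ(\delta_H\otimes H)$, $\overline{\lambda}_H=\varphi_H\circ((\lambda_B\circ T)\otimes\lambda_H)\circ\delta_H$. Projections. A projection of Hopf algebras is $(X,Y,f,g)$ with $f\colon X\to Y$, $g\colon Y\to X$ Hopf algebra morphisms and $g\circ f=id_X$; a morphism to $(X',Y',f',g')$ is a pair of Hopf algebra morphisms $x\colon X\to X'$, $y\colon Y\to Y'$ with $y\circ f=f'\circ x$, $x\circ g=g'\circ y$. A projection of relative Rota-Baxter operators is a 6-tuple $((T\colon H\to B,\varphi_H),(L\colon A\to D,\varphi_A),f,h,g,l)$ such that $(H,A,f,g)$ and $(B,D,h,l)$ are projections of Hopf algebras, and $(f,h)\colon(T,\varphi_H)\to(L,\varphi_A)$ and $(g,l)\colon(L,\varphi_A)\to(T,\varphi_H)$ are morphisms in $\mathsf{rRB}$. A morphism to another such (primed) object is a 4-tuple $(x,y,z,t)$ with $(x,y)\colon(H,A,f,g)\to(H',A',f',g')$ and $(z,t)\colon(B,D,h,l)\to(B',D',h',l')$ morphisms of projections of Hopf algebras, and $(x,z)\colon(T,\varphi_H)\to(T',\varphi_{H'})$, $(y,t)\colon(L,\varphi_A)\to(L',\varphi_{A'})$ morphisms in $\mathsf{rRB}$. $\mathsf{P}(\mathsf{rRB}^{\star})$ is the category of such projections whose two relative Rota-Baxter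 operators lie in $\mathsf{rRB}^{\star}$. $\mathsf{P}(\mathsf{coc}\text{-}\mathsf{HBr})$: objects are $(\mathbb{H},\mathbb{D},x,y)$ with $\mathbb{H},\mathbb{D}$ cocommutative Hopf braces and $x\colon\mathbb{H}\to\mathbb{D}$, $y\colon\mathbb{D}\to\mathbb{H}$ Hopf brace morphisms with $y\circ x=id_{\mathbb{H}}$; morphisms $(z,t)\colon(\mathbb{H},\mathbb{D},x,y)\to(\mathbb{H}',\mathbb{D}',x',y')$ are pairs of Hopf brace morphisms $z\colon\mathbb{H}\to\mathbb{H}'$, $t\colon\mathbb{D}\to\mathbb{D}'$ with $x'\circ z=t\circ x$ and $y'\circ t=z\circ y$. *)

theory Defs
  imports Main
begin

section \<open>Categories, functors, adjunctions\<close>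

text \<open>
  Categories are given by hom-sets \<open>Hom C A B\<close>. Hom-sets of different pairs of objects are not
  required to be disjoint, so that a morphism of a category of structured objects is just the
  underlying (tuple of) morphism(s); composition does not depend on the objects.
  \<open>g \<bullet> f\<close> is ``g after f''.
\<close>

record ('o, 'm) cat =
  Ob :: "'o set"
  Hom :: "'o \<Rightarrow> 'o \<Rightarrow> 'm set"
  Idm :: "'o \<Rightarrow> 'm"
  Comp :: "'m \<Rightarrow> 'm \<Rightarrow> 'm" (infixr "\<bullet>\<index>" 55)

locale category =
  fixes C :: "('o, 'm, 'z) cat_scheme" (structure)
  assumes id_hom: "A \<in> Ob C \<Longrightarrow> Idm C A \<in> Hom C A A"
    and comp_hom: "\<lbrakk>A \<in> Ob C; B \<in> Ob C; D \<in> Ob C; f \<in> Hom C A B; g \<in> Hom C B D\<rbrakk>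
        \<Longrightarrow> g \<bullet> f \<in> Hom C A D"
    and comp_id_right: "\<lbrakk>A \<in> Ob C; B \<in> Ob C; f \<in> Hom C A B\<rbrakk> \<Longrightarrow> f \<bullet> Idm C A = f"
    and comp_id_left: "\<lbrakk>A \<in> Ob C; B \<in> Ob C; f \<in> Hom C A B\<rbrakk> \<Longrightarrow> Idm C B \<bullet> f = f"
    and comp_assoc: "\<lbrakk>A \<in> Ob C; B \<in> Ob C; D \<in> Ob C; E \<in> Ob C;
        f \<in> Hom C A B; g \<in> Hom C B D; h \<in> Hom C D E\<rbrakk>
        \<Longrightarrow> (h \<bullet> g) \<bullet> f = h \<bullet> (g \<bullet> f)"

record ('o, 'm, 'p, 'n) cfunctor =
  fobj :: "'o \<Rightarrow> 'p"
  fmor :: "'m \<Rightarrow> 'n"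

definition is_functor ::
  "('o, 'm, 'y) cat_scheme \<Rightarrow> ('p, 'n, 'z) cat_scheme \<Rightarrow> ('o, 'm, 'p, 'n) cfunctor \<Rightarrow> bool" where
  "is_functor C D F \<longleftrightarrow> category C \<and> category D
    \<and> (\<forall>A\<in>Ob C. fobj F A \<in> Ob D)
    \<and> (\<forall>A\<in>Ob C. \<forall>B\<in>Ob C. \<forall>f\<in>Hom C A B. fmor F f \<in> Hom D (fobj F A) (fobj F B))
    \<and> (\<forall>A\<in>Ob C. fmor F (Idm C A) = Idm D (fobj F A))
    \<and> (\<forall>A\<in>Ob C. \<forall>B\<in>Ob C. \<forall>E\<in>Ob C. \<forall>f\<in>Hom C A B. \<forall>g\<in>Hom C B E.
          fmor F (g \<bullet>\<^bsub>C\<^esub> f) = fmor F g \<bullet>\<^bsub>D\<^esub> fmor F f)"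

definition id_functor :: "('o, 'm, 'o, 'm) cfunctor" where
  "id_functor = \<lparr>fobj = (\<lambda>A. A), fmor = (\<lambda>f. f)\<rparr>"

definition comp_functor ::
  "('p, 'n, 'q, 'l) cfunctor \<Rightarrow> ('o, 'm, 'p, 'n) cfunctor \<Rightarrow> ('o, 'm, 'q, 'l) cfunctor" where
  "comp_functor G F = \<lparr>fobj = (\<lambda>A. fobj G (fobj F A)), fmor = (\<lambda>f. fmor G (fmor F f))\<rparr>"

definition is_nat_trans ::
  "('o, 'm, 'y) cat_scheme \<Rightarrow> ('p, 'n, 'z) cat_scheme
    \<Rightarrow> ('o, 'm, 'p, 'n) cfunctor \<Rightarrow> ('o, 'm, 'p, 'n) cfunctor \<Rightarrow> ('o \<Rightarrow> 'n) \<Rightarrow> bool" where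
  "is_nat_trans C D F G \<alpha> \<longleftrightarrow> is_functor C D F \<and> is_functor C D G
    \<and> (\<forall>A\<in>Ob C. \<alpha> A \<in> Hom D (fobj F A) (fobj G A))
    \<and> (\<forall>A\<in>Ob C. \<forall>B\<in>Ob C. \<forall>f\<in>Hom C A B.
          fmor G f \<bullet>\<^bsub>D\<^esub> \<alpha> A = \<alpha> B \<bullet>\<^bsub>D\<^esub> fmor F f)"

definition left_adjoint ::
  "('o, 'm, 'y) cat_scheme \<Rightarrow> ('p, 'n, 'z) cat_scheme
    \<Rightarrow> ('o, 'm, 'p, 'n) cfunctor \<Rightarrow> ('p, 'n, 'o, 'm) cfunctor \<Rightarrow> bool" where
  "left_adjoint C D F G \<longleftrightarrow> is_functor C D F \<and> is_functor D C G
    \<and> (\<exists>\<alpha> \<beta>. is_nat_trans C C id_functor (comp_functor G F) \<alpha>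
          \<and> is_nat_trans D D (comp_functor F G) id_functor \<beta>
          \<and> (\<forall>A\<in>Ob C. \<beta> (fobj F A) \<bullet>\<^bsub>D\<^esub> fmor F (\<alpha> A) = Idm D (fobj F A))
          \<and> (\<forall>B\<in>Ob D. fmor G (\<beta> B) \<bullet>\<^bsub>C\<^esub> \<alpha> (fobj G B) = Idm C (fobj G B)))"

section \<open>Strict braided monoidal categories\<close>

record ('o, 'm) braided_cat = "('o, 'm) cat" +
  tensO :: "'o \<Rightarrow> 'o \<Rightarrow> 'o" (infixr "\<boxtimes>\<index>" 70)
  tensM :: "'m \<Rightarrow> 'm \<Rightarrow> 'm" (infixr "\<otimes>\<index>" 70)
  unitO :: 'o ("\<K>\<index>")
  braid :: "'o \<Rightarrow> 'o \<Rightarrow> 'm" ("\<c>\<index>")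

locale strict_monoidal_category = category C
  for C :: "('o, 'm, 'z) braided_cat_scheme" (structure) +
  assumes unit_ob: "\<K> \<in> Ob C"
    and tens_ob: "\<lbrakk>A \<in> Ob C; B \<in> Ob C\<rbrakk> \<Longrightarrow> A \<boxtimes> B \<in> Ob C"
    and tens_hom: "\<lbrakk>A \<in> Ob C; B \<in> Ob C; D \<in> Ob C; E \<in> Ob C; f \<in> Hom C A B; g \<in> Hom C D E\<rbrakk>
        \<Longrightarrow> f \<otimes> g \<in> Hom C (A \<boxtimes> D) (B \<boxtimes> E)"
    and tens_id: "\<lbrakk>A \<in> Ob C; B \<in> Ob C\<rbrakk> \<Longrightarrow> Idm C A \<otimes> Idm C B = Idm C (A \<boxtimes> B)"
    and tens_comp: "\<lbrakk>A \<in> Ob C; B \<in> Ob C; D \<in> Ob C; A' \<in> Ob C; B' \<in> Ob C; D' \<in> Ob C;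
        f \<in> Hom C A B; g \<in> Hom C B D; f' \<in> Hom C A' B'; g' \<in> Hom C B' D'\<rbrakk>
        \<Longrightarrow> (g \<bullet> f) \<otimes> (g' \<bullet> f') = (g \<otimes> g') \<bullet> (f \<otimes> f')"
    and tens_ob_assoc: "\<lbrakk>A \<in> Ob C; B \<in> Ob C; D \<in> Ob C\<rbrakk>
        \<Longrightarrow> (A \<boxtimes> B) \<boxtimes> D = A \<boxtimes> (B \<boxtimes> D)"
    and tens_ob_unit: "A \<in> Ob C \<Longrightarrow> \<K> \<boxtimes> A = A" "A \<in> Ob C \<Longrightarrow> A \<boxtimes> \<K> = A"
    and tens_assoc: "\<lbrakk>A \<in> Ob C; B \<in> Ob C; A' \<in> Ob C; B' \<in> Ob C; A'' \<in> Ob C; B'' \<in> Ob C;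
        f \<in> Hom C A B; g \<in> Hom C A' B'; h \<in> Hom C A'' B''\<rbrakk>
        \<Longrightarrow> (f \<otimes> g) \<otimes> h = f \<otimes> (g \<otimes> h)"
    and tens_unit: "\<lbrakk>A \<in> Ob C; B \<in> Ob C; f \<in> Hom C A B\<rbrakk> \<Longrightarrow> Idm C \<K> \<otimes> f = f"
      "\<lbrakk>A \<in> Ob C; B \<in> Ob C; f \<in> Hom C A B\<rbrakk> \<Longrightarrow> f \<otimes> Idm C \<K> = f"

locale strict_braided_category = strict_monoidal_category C
  for C :: "('o, 'm, 'z) braided_cat_scheme" (structure) +
  assumes braid_hom: "\<lbrakk>A \<in> Ob C; B \<in> Ob C\<rbrakk> \<Longrightarrow> \<c> A B \<in> Hom C (A \<boxtimes> B) (B \<boxtimes> A)"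
    and braid_iso: "\<lbrakk>A \<in> Ob C; B \<in> Ob C\<rbrakk> \<Longrightarrow> \<exists>d\<in>Hom C (B \<boxtimes> A) (A \<boxtimes> B).
        d \<bullet> \<c> A B = Idm C (A \<boxtimes> B) \<and> \<c> A B \<bullet> d = Idm C (B \<boxtimes> A)"
    and braid_natural: "\<lbrakk>A \<in> Ob C; B \<in> Ob C; D \<in> Ob C; E \<in> Ob C;
        f \<in> Hom C A B; g \<in> Hom C D E\<rbrakk> \<Longrightarrow> \<c> B E \<bullet> (f \<otimes> g) = (g \<otimes> f) \<bullet> \<c> A D"
    and hexagon_right: "\<lbrakk>A \<in> Ob C; B \<in> Ob C; D \<in> Ob C\<rbrakk>
        \<Longrightarrow> \<c> A (B \<boxtimes> D) = (Idm C B \<otimes> \<c> A D) \<bullet> (\<c> A B \<otimes> Idm C D)"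
    and hexagon_left: "\<lbrakk>A \<in> Ob C; B \<in> Ob C; D \<in> Ob C\<rbrakk>
        \<Longrightarrow> \<c> (A \<boxtimes> B) D = (\<c> A D \<otimes> Idm C B) \<bullet> (Idm C A \<otimes> \<c> B D)"

section \<open>Algebras, coalgebras and Hopf algebras\<close>

text \<open>
  A bare algebra-coalgebra structure. Predicates about algebras (coalgebras) only use the
  algebra (coalgebra) fields.
\<close>

record ('o, 'm) algcoalg =
  obj :: 'o
  unit :: 'm
  mult :: 'm
  counit :: 'm
  comult :: 'm

record ('o, 'm) hopf = "('o, 'm) algcoalg" +
  antipode :: 'm

text \<open>A relative Rota-Baxter operator \<open>(T : H \<rightarrow> B, \<phi>)\<close> with \<open>\<phi> : B \<otimes> H \<rightarrow> H\<close>.\<close>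

record ('o, 'm) rrb =
  src :: "('o, 'm) hopf"
  tgt :: "('o, 'm) hopf"
  opr :: 'm
  act :: 'm

type_synonym ('o, 'm) brace = "('o, 'm) hopf \<times> ('o, 'm) hopf"

type_synonym ('o, 'm) brace_proj = "('o, 'm) brace \<times> ('o, 'm) brace \<times> 'm \<times> 'm"

type_synonym ('o, 'm) rrb_proj = "('o, 'm) rrb \<times> ('o, 'm) rrb \<times> 'm \<times> 'm \<times> 'm \<times> 'm"

locale braided_data =
  fixes C :: "('o, 'm, 'z) braided_cat_scheme" (structure)
begin

definition is_algebra :: "('o, 'm, 'x) algcoalg_scheme \<Rightarrow> bool" where
  "is_algebra A \<longleftrightarrow> obj A \<in> Ob C
    \<and> unit A \<in> Hom C \<K> (obj A)
    \<and> mult A \<in> Hom C (obj A \<boxtimes> obj A) (obj A)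
    \<and> mult A \<bullet> (Idm C (obj A) \<otimes> unit A) = Idm C (obj A)
    \<and> mult A \<bullet> (unit A \<otimes> Idm C (obj A)) = Idm C (obj A)
    \<and> mult A \<bullet> (Idm C (obj A) \<otimes> mult A) = mult A \<bullet> (mult A \<otimes> Idm C (obj A))"

definition is_coalgebra :: "('o, 'm, 'x) algcoalg_scheme \<Rightarrow> bool" where
  "is_coalgebra D \<longleftrightarrow> obj D \<in> Ob C
    \<and> counit D \<in> Hom C (obj D) \<K>
    \<and> comult D \<in> Hom C (obj D) (obj D \<boxtimes> obj D)
    \<and> (Idm C (obj D) \<otimes> counit D) \<bullet> comult D = Idm C (obj D)
    \<and> (counit D \<otimes> Idm C (obj D)) \<bullet> comult D = Idm C (obj D)
    \<and> (Idm C (obj D) \<otimes> comult D) \<bullet> comult D = (comult D \<otimes> Idm C (obj D)) \<bullet> comult D"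

definition alg_mor ::
  "('o, 'm, 'x) algcoalg_scheme \<Rightarrow> ('o, 'm, 'y) algcoalg_scheme \<Rightarrow> 'm \<Rightarrow> bool" where
  "alg_mor A B f \<longleftrightarrow> f \<in> Hom C (obj A) (obj B)
    \<and> f \<bullet> unit A = unit B
    \<and> f \<bullet> mult A = mult B \<bullet> (f \<otimes> f)"

definition coalg_mor ::
  "('o, 'm, 'x) algcoalg_scheme \<Rightarrow> ('o, 'm, 'y) algcoalg_scheme \<Rightarrow> 'm \<Rightarrow> bool" where
  "coalg_mor D E f \<longleftrightarrow> f \<in> Hom C (obj D) (obj E)
    \<and> counit E \<bullet> f = counit D
    \<and> comult E \<bullet> f = (f \<otimes> f) \<bullet> comult D"

definition unit_algcoalg :: "('o, 'm) algcoalg" where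
  "unit_algcoalg =
    \<lparr>obj = \<K>, unit = Idm C \<K>, mult = Idm C \<K>, counit = Idm C \<K>, comult = Idm C \<K>\<rparr>"

definition tensor ::
  "('o, 'm, 'x) algcoalg_scheme \<Rightarrow> ('o, 'm, 'y) algcoalg_scheme \<Rightarrow> ('o, 'm) algcoalg" where
  "tensor A B =
    \<lparr>obj = obj A \<boxtimes> obj B,
     unit = unit A \<otimes> unit B,
     mult = (mult A \<otimes> mult B) \<bullet> (Idm C (obj A) \<otimes> \<c> (obj B) (obj A) \<otimes> Idm C (obj B)),
     counit = counit A \<otimes> counit B,
     comult = (Idm C (obj A) \<otimes> \<c> (obj A) (obj B) \<otimes> Idm C (obj B)) \<bullet> (comult A \<otimes> comult B)\<rparr>"

definition is_hopf :: "('o, 'm) hopf \<Rightarrow> bool" where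
  "is_hopf X \<longleftrightarrow> is_algebra X \<and> is_coalgebra X
    \<and> alg_mor X unit_algcoalg (counit X)
    \<and> alg_mor X (tensor X X) (comult X)
    \<and> antipode X \<in> Hom C (obj X) (obj X)
    \<and> mult X \<bullet> (Idm C (obj X) \<otimes> antipode X) \<bullet> comult X = unit X \<bullet> counit X
    \<and> mult X \<bullet> (antipode X \<otimes> Idm C (obj X)) \<bullet> comult X = unit X \<bullet> counit X"

definition cocommutative :: "('o, 'm, 'x) algcoalg_scheme \<Rightarrow> bool" where
  "cocommutative X \<longleftrightarrow> \<c> (obj X) (obj X) \<bullet> comult X = comult X"

definition hopf_mor :: "('o, 'm) hopf \<Rightarrow> ('o, 'm) hopf \<Rightarrow> 'm \<Rightarrow> bool" where
  "hopf_mor X Y f \<longleftrightarrow> alg_mor X Y f \<and> coalg_mor X Y f"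

definition is_left_module ::
  "('o, 'm, 'x) algcoalg_scheme \<Rightarrow> 'o \<Rightarrow> 'm \<Rightarrow> bool" where
  "is_left_module X M \<phi> \<longleftrightarrow> M \<in> Ob C
    \<and> \<phi> \<in> Hom C (obj X \<boxtimes> M) M
    \<and> \<phi> \<bullet> (unit X \<otimes> Idm C M) = Idm C M
    \<and> \<phi> \<bullet> (Idm C (obj X) \<otimes> \<phi>) = \<phi> \<bullet> (mult X \<otimes> Idm C M)"

definition is_module_algcoalg ::
  "('o, 'm) hopf \<Rightarrow> ('o, 'm, 'x) algcoalg_scheme \<Rightarrow> 'm \<Rightarrow> bool" where
  "is_module_algcoalg X A \<phi> \<longleftrightarrow> is_algebra A \<and> is_coalgebra A
    \<and> is_left_module X (obj A) \<phi>
    \<and> \<phi> \<bullet> (Idm C (obj X) \<otimes> unit A) = counit X \<otimes> unit A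
    \<and> \<phi> \<bullet> (Idm C (obj X) \<otimes> mult A)
        = mult A \<bullet> (\<phi> \<otimes> \<phi>)
            \<bullet> (Idm C (obj X) \<otimes> \<c> (obj X) (obj A) \<otimes> Idm C (obj A))
            \<bullet> (comult X \<otimes> Idm C (obj A) \<otimes> Idm C (obj A))
    \<and> coalg_mor (tensor X A) A \<phi>"

section \<open>Relative Rota-Baxter operators\<close>

definition rrb_mult :: "('o, 'm) rrb \<Rightarrow> 'm" where
  "rrb_mult T = mult (src T)
     \<bullet> (Idm C (obj (src T)) \<otimes> (act T \<bullet> (opr T \<otimes> Idm C (obj (src T)))))
     \<bullet> (comult (src T) \<otimes> Idm C (obj (src T)))"

definition rrb_antipode :: "('o, 'm) rrb \<Rightarrow> 'm" where
  "rrb_antipode T =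
     act T \<bullet> ((antipode (tgt T) \<bullet> opr T) \<otimes> antipode (src T)) \<bullet> comult (src T)"

definition is_rrb :: "('o, 'm) rrb \<Rightarrow> bool" where
  "is_rrb T \<longleftrightarrow> is_hopf (src T) \<and> is_hopf (tgt T)
    \<and> is_module_algcoalg (tgt T) (src T) (act T)
    \<and> coalg_mor (src T) (tgt T) (opr T)
    \<and> mult (tgt T) \<bullet> (opr T \<otimes> opr T) = opr T \<bullet> rrb_mult T"

definition rrb_mor :: "('o, 'm) rrb \<Rightarrow> ('o, 'm) rrb \<Rightarrow> 'm \<Rightarrow> 'm \<Rightarrow> bool" where
  "rrb_mor T L f h \<longleftrightarrow> hopf_mor (src T) (src L) f \<and> hopf_mor (tgt T) (tgt L) h
    \<and> opr L \<bullet> f = h \<bullet> opr T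
    \<and> f \<bullet> act T = act L \<bullet> (h \<otimes> f)"

definition rRB :: "(('o, 'm) rrb, 'm \<times> 'm) cat" where
  "rRB =
    \<lparr>Ob = {T. is_rrb T},
     Hom = (\<lambda>T L. {(f, h). rrb_mor T L f h}),
     Idm = (\<lambda>T. (Idm C (obj (src T)), Idm C (obj (tgt T)))),
     Comp = (\<lambda>(f', h') (f, h). (f' \<bullet> f, h' \<bullet> h))\<rparr>"

definition rRB_star :: "(('o, 'm) rrb, 'm \<times> 'm) cat" where
  "rRB_star = rRB\<lparr>Ob := {T \<in> Ob rRB. cocommutative (src T)}\<rparr>"

section \<open>Hopf braces\<close>

definition Gam :: "('o, 'm) brace \<Rightarrow> 'm" where
  "Gam = (\<lambda>(H1, H2).
     mult H1 \<bullet> (antipode H1 \<otimes> mult H2) \<bullet> (comult H1 \<otimes> Idm C (obj H1)))"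

definition is_brace :: "('o, 'm) brace \<Rightarrow> bool" where
  "is_brace = (\<lambda>(H1, H2). is_hopf H1 \<and> is_hopf H2
    \<and> obj H2 = obj H1 \<and> unit H2 = unit H1 \<and> counit H2 = counit H1 \<and> comult H2 = comult H1
    \<and> mult H2 \<bullet> (Idm C (obj H1) \<otimes> mult H1)
        = mult H1 \<bullet> (mult H2 \<otimes> Gam (H1, H2))
            \<bullet> (Idm C (obj H1) \<otimes> \<c> (obj H1) (obj H1) \<otimes> Idm C (obj H1))
            \<bullet> (comult H1 \<otimes> Idm C (obj H1) \<otimes> Idm C (obj H1)))"

definition brace_mor :: "('o, 'm) brace \<Rightarrow> ('o, 'm) brace \<Rightarrow> 'm \<Rightarrow> bool" where
  "brace_mor = (\<lambda>(H1, H2) (D1, D2) x. hopf_mor H1 D1 x \<and> hopf_mor H2 D2 x)"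

definition coc_HBr :: "(('o, 'm) brace, 'm) cat" where
  "coc_HBr =
    \<lparr>Ob = {HH. is_brace HH \<and> cocommutative (fst HH)},
     Hom = (\<lambda>HH DD. {x. brace_mor HH DD x}),
     Idm = (\<lambda>HH. Idm C (obj (fst HH))),
     Comp = (\<lambda>g f. g \<bullet> f)\<rparr>"

section \<open>The functors between Hopf braces and relative Rota-Baxter operators\<close>

definition F :: "(('o, 'm) brace, 'm, ('o, 'm) rrb, 'm \<times> 'm) cfunctor" where
  "F =
    \<lparr>fobj = (\<lambda>(H1, H2).
        \<lparr>src = H1, tgt = H2, opr = Idm C (obj H1), act = Gam (H1, H2)\<rparr>),
     fmor = (\<lambda>x. (x, x))\<rparr>"

definition G :: "(('o, 'm) rrb, 'm \<times> 'm, ('o, 'm) brace, 'm) cfunctor" where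
  "G =
    \<lparr>fobj = (\<lambda>T. (src T, (src T)\<lparr>mult := rrb_mult T, antipode := rrb_antipode T\<rparr>)),
     fmor = (\<lambda>(f, h). f)\<rparr>"

section \<open>Projections\<close>

definition hopf_proj :: "('o, 'm) hopf \<Rightarrow> ('o, 'm) hopf \<Rightarrow> 'm \<Rightarrow> 'm \<Rightarrow> bool" where
  "hopf_proj X Y f g \<longleftrightarrow> is_hopf X \<and> is_hopf Y
    \<and> hopf_mor X Y f \<and> hopf_mor Y X g \<and> g \<bullet> f = Idm C (obj X)"

definition hopf_proj_mor ::
  "('o, 'm) hopf \<times> ('o, 'm) hopf \<times> 'm \<times> 'm \<Rightarrow> ('o, 'm) hopf \<times> ('o, 'm) hopf \<times> 'm \<times> 'm
    \<Rightarrow> 'm \<Rightarrow> 'm \<Rightarrow> bool" where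
  "hopf_proj_mor = (\<lambda>(X, Y, f, g) (X', Y', f', g') x y.
     hopf_mor X X' x \<and> hopf_mor Y Y' y \<and> y \<bullet> f = f' \<bullet> x \<and> x \<bullet> g = g' \<bullet> y)"

definition P_rRB_star :: "(('o, 'm) rrb_proj, 'm \<times> 'm \<times> 'm \<times> 'm) cat" where
  "P_rRB_star =
    \<lparr>Ob = {(T, L, f, h, g, l). T \<in> Ob rRB_star \<and> L \<in> Ob rRB_star
        \<and> hopf_proj (src T) (src L) f g \<and> hopf_proj (tgt T) (tgt L) h l
        \<and> (f, h) \<in> Hom rRB_star T L \<and> (g, l) \<in> Hom rRB_star L T},
     Hom = (\<lambda>(T, L, f, h, g, l) (T', L', f', h', g', l'). {(x, y, z, t).
        hopf_proj_mor (src T, src L, f, g) (src T', src L', f', g') x y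
        \<and> hopf_proj_mor (tgt T, tgt L, h, l) (tgt T', tgt L', h', l') z t
        \<and> (x, z) \<in> Hom rRB_star T T' \<and> (y, t) \<in> Hom rRB_star L L'}),
     Idm = (\<lambda>(T, L, f, h, g, l).
        (Idm C (obj (src T)), Idm C (obj (src L)), Idm C (obj (tgt T)), Idm C (obj (tgt L)))),
     Comp = (\<lambda>(x', y', z', t') (x, y, z, t). (x' \<bullet> x, y' \<bullet> y, z' \<bullet> z, t' \<bullet> t))\<rparr>"

definition P_coc_HBr :: "(('o, 'm) brace_proj, 'm \<times> 'm) cat" where
  "P_coc_HBr =
    \<lparr>Ob = {(HH, DD, x, y). HH \<in> Ob coc_HBr \<and> DD \<in> Ob coc_HBr
        \<and> x \<in> Hom coc_HBr HH DD \<and> y \<in> Hom coc_HBr DD HH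
        \<and> y \<bullet>\<^bsub>coc_HBr\<^esub> x = Idm coc_HBr HH},
     Hom = (\<lambda>(HH, DD, x, y) (HH', DD', x', y'). {(z, t).
        z \<in> Hom coc_HBr HH HH' \<and> t \<in> Hom coc_HBr DD DD'
        \<and> x' \<bullet>\<^bsub>coc_HBr\<^esub> z = t \<bullet>\<^bsub>coc_HBr\<^esub> x
        \<and> y' \<bullet>\<^bsub>coc_HBr\<^esub> t = z \<bullet>\<^bsub>coc_HBr\<^esub> y}),
     Idm = (\<lambda>(HH, DD, x, y). (Idm coc_HBr HH, Idm coc_HBr DD)),
     Comp = (\<lambda>(z', t') (z, t). (z' \<bullet>\<^bsub>coc_HBr\<^esub> z, t' \<bullet>\<^bsub>coc_HBr\<^esub> t))\<rparr>"

definition Q :: "(('o, 'm) brace_proj, 'm \<times> 'm, ('o, 'm) rrb_proj, 'm \<times> 'm \<times> 'm \<times> 'm) cfunctor"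
  where
  "Q =
    \<lparr>fobj = (\<lambda>(HH, DD, x, y). (fobj F HH, fobj F DD, x, x, y, y)),
     fmor = (\<lambda>(z, t). (z, t, z, t))\<rparr>"

definition R :: "(('o, 'm) rrb_proj, 'm \<times> 'm \<times> 'm \<times> 'm, ('o, 'm) brace_proj, 'm \<times> 'm) cfunctor"
  where
  "R =
    \<lparr>fobj = (\<lambda>(T, L, f, h, g, l). (fobj G T, fobj G L, f, g)),
     fmor = (\<lambda>(x, y, z, t). (x, y))\<rparr>"

end

end

theory Submission
  imports Defs
begin

text \<open>
  The idea is to compute with generalized elements. If \<open>X\<close> is a cocommutative coalgebra and \<open>B\<close> a
  Hopf algebra, the coalgebra morphisms \<open>X \<rightarrow> B\<close> form a group under convolution, naturally in \<open>X\<close>.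
  A relative Rota-Baxter operator induces one between such groups, and a Hopf brace induces a skew
  brace, so all the identities behind the functors become identities in groups. To get back from
  elements to morphisms out of \<open>H \<otimes> H\<close> and \<open>H \<otimes> H \<otimes> H\<close>, these tensor powers must themselves be
  cocommutative coalgebras. This holds because the braiding of a cocommutative Hopf algebra is an
  involution: cocommutativity turns the bialgebra axiom for \<open>c\<close> into the one for \<open>c\<inverse>\<close>, and
  \<open>d \<mapsto> (\<mu> \<otimes> \<mu>) \<circ> (H \<otimes> d \<otimes> H) \<circ> (\<delta> \<otimes> \<delta>)\<close> is injective thanks to the antipode. The unit of the
  adjunction consists of identities, and its counit at a pair of operators \<open>T\<close>, \<open>L\<close> is
  \<open>(id, id, T, L)\<close>.
\<close>

section \<open>Groups, Rota-Baxter operators and skew braces\<close>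

text \<open>Cocommutativity is asked of the test coalgebra \<open>X\<close>: it makes
  \<open>(f \<otimes> g) \<bullet> comult X\<close> a coalgebra morphism when \<open>f\<close> and
  \<open>g\<close> are, and it turns the antipode, which in general reverses comultiplication, into
  an operation on coalgebra morphisms. The Hopf algebra \<open>B\<close> may be arbitrary, because
  every identity proved by elements has a tensor power of \<open>H\<close> as its source, and
  \<open>B\<close> only receives elements. The obstacle is that \<open>C\<close> is braided and not
  symmetric, so that tensor products of cocommutative coalgebras need not be cocommutative. The
  involutive braiding on \<open>H\<close> has to be found before equations can be tested on
  elements, hence by string diagrams. The last two components of the counit come from the
  Rota-Baxter equation: it says that \<open>T\<close> is multiplicative for the new product on
  \<open>H\<close>. The brace built from that product acts on \<open>H\<close> by \<phi> pulled back
  along \<open>T\<close>, which is what makes \<open>(id, T)\<close> a morphism of relative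
  Rota-Baxter operators.\<close>

locale group_on =
  fixes S :: "'a set" and m :: "'a \<Rightarrow> 'a \<Rightarrow> 'a" and e :: 'a and i :: "'a \<Rightarrow> 'a"
  assumes m_closed: "x \<in> S \<Longrightarrow> y \<in> S \<Longrightarrow> m x y \<in> S"
    and e_closed: "e \<in> S"
    and i_closed: "x \<in> S \<Longrightarrow> i x \<in> S"
    and m_assoc: "x \<in> S \<Longrightarrow> y \<in> S \<Longrightarrow> z \<in> S \<Longrightarrow> m (m x y) z = m x (m y z)"
    and m_e_left: "x \<in> S \<Longrightarrow> m e x = x"
    and m_e_right: "x \<in> S \<Longrightarrow> m x e = x"
    and m_i_left: "x \<in> S \<Longrightarrow> m (i x) x = e"
    and m_i_right: "x \<in> S \<Longrightarrow> m x (i x) = e"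
begin

lemma i_cancel_left: "x \<in> S \<Longrightarrow> y \<in> S \<Longrightarrow> m (i x) (m x y) = y"
  using m_assoc[of "i x" x y] by (simp add: i_closed m_i_left m_e_left)

lemma cancel_i_left: "x \<in> S \<Longrightarrow> y \<in> S \<Longrightarrow> m x (m (i x) y) = y"
  using m_assoc[of x "i x" y] by (simp add: i_closed m_i_right m_e_left)

lemma i_unique: "x \<in> S \<Longrightarrow> y \<in> S \<Longrightarrow> m x y = e \<Longrightarrow> y = i x"
  using i_cancel_left[of x y] by (simp add: i_closed m_e_right)

lemma idem_e: "x \<in> S \<Longrightarrow> m x x = x \<Longrightarrow> x = e"
  using i_cancel_left[of x x] by (simp add: m_i_left)

end

lemma group_on_hom_e:
  assumes "group_on S m e i" "group_on S' m' e' i'" "\<And>x. x \<in> S \<Longrightarrow> f x \<in> S'"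
    and "\<And>x y. x \<in> S \<Longrightarrow> y \<in> S \<Longrightarrow> f (m x y) = m' (f x) (f y)"
  shows "f e = e'"
proof -
  interpret A: group_on S m e i by fact
  interpret B: group_on S' m' e' i' by fact
  show ?thesis
    using assms(4)[OF A.e_closed A.e_closed] assms(3)[OF A.e_closed]
    by (intro B.idem_e) (simp_all add: A.m_e_left[OF A.e_closed])
qed

text \<open>\<open>hopf_mor\<close> does not mention antipodes. Applied to groups of generalized
  elements, this lemma supplies the compatibility of Hopf algebra morphisms with them.\<close>

lemma group_on_hom_i:
  assumes "group_on S m e i" "group_on S' m' e' i'" "\<And>x. x \<in> S \<Longrightarrow> f x \<in> S'"
    and "\<And>x y. x \<in> S \<Longrightarrow> y \<in> S \<Longrightarrow> f (m x y) = m' (f x) (f y)" and "x \<in> S"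
  shows "f (i x) = i' (f x)"
proof -
  interpret A: group_on S m e i by fact
  interpret B: group_on S' m' e' i' by fact
  note ix = A.i_closed[OF assms(5)]
  have "f e = e'"
    by (rule group_on_hom_e[where f = f and m = m and m' = m', OF assms(1,2)]) (fact assms(3,4))+
  then have "m' (f x) (f (i x)) = e'"
    using assms(4)[OF assms(5) ix] by (simp add: A.m_i_right assms(5))
  then show ?thesis
    by (rule B.i_unique[OF assms(3)[OF assms(5)] assms(3)[OF ix]])
qed

text \<open>A relative Rota-Baxter operator of weight one between groups: \<open>S'\<close> acts on
  \<open>S\<close> by automorphisms and \<open>T\<close> satisfies the Rota-Baxter equation. The
  operation \<open>rb_mult\<close> below is the descendent product.\<close>

locale rrb_group = H: group_on S m e i + B: group_on S' m' e' i'
  for S :: "'a set" and m e i and S' :: "'b set" and m' e' i' +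
  fixes act :: "'b \<Rightarrow> 'a \<Rightarrow> 'a" and T :: "'a \<Rightarrow> 'b"
  assumes act_closed: "b \<in> S' \<Longrightarrow> h \<in> S \<Longrightarrow> act b h \<in> S"
    and act_e': "h \<in> S \<Longrightarrow> act e' h = h"
    and act_act: "b \<in> S' \<Longrightarrow> b' \<in> S' \<Longrightarrow> h \<in> S \<Longrightarrow> act b (act b' h) = act (m' b b') h"
    and act_m: "b \<in> S' \<Longrightarrow> h \<in> S \<Longrightarrow> k \<in> S \<Longrightarrow> act b (m h k) = m (act b h) (act b k)"
    and T_closed: "h \<in> S \<Longrightarrow> T h \<in> S'"
    and T_m: "h \<in> S \<Longrightarrow> k \<in> S \<Longrightarrow> m' (T h) (T k) = T (m h (act (T h) k))"
begin

definition "rb_mult h k = m h (act (T h) k)"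
definition "rb_inv h = act (i' (T h)) (i h)"

lemma act_e: "b \<in> S' \<Longrightarrow> act b e = e"
  using act_m[of b e e] by (intro H.idem_e) (simp_all add: act_closed H.e_closed H.m_e_left)

lemma T_e: "T e = e'"
  using T_m[of e e] by (intro B.idem_e) (simp_all add: T_closed act_e H.e_closed H.m_e_left)

lemma i_rb_mult: "h \<in> S \<Longrightarrow> k \<in> S \<Longrightarrow> m (i h) (rb_mult h k) = act (T h) k"
  unfolding rb_mult_def by (simp add: H.i_cancel_left act_closed T_closed)

text \<open>The last two factors collapse to \<open>act (T h) l\<close>, so the skew brace axiom is
  nothing but multiplicativity of the action.\<close>

lemma brace_rb_mult:
  "h \<in> S \<Longrightarrow> k \<in> S \<Longrightarrow> l \<in> S \<Longrightarrow> rb_mult h (m k l) = m (rb_mult h k) (m (i h) (rb_mult h l))"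
  unfolding i_rb_mult by (simp add: rb_mult_def act_m T_closed H.m_assoc act_closed)

text \<open>Associativity rests on \<open>T\<close> being multiplicative from \<open>rb_mult\<close>
  to \<open>m'\<close>: nested actions then merge by \<open>act_act\<close>. The right inverse law
  is a direct computation, since the actions of \<open>T x\<close> and of its inverse
  cancel.\<close>

lemma group_on_rb_mult: "group_on S rb_mult e rb_inv"
proof
  show closed: "rb_mult x y \<in> S" if "x \<in> S" "y \<in> S" for x y
    using that by (simp add: rb_mult_def H.m_closed act_closed T_closed)
  show "e \<in> S" by (rule H.e_closed)
  show rb_inv: "rb_inv x \<in> S" if "x \<in> S" for x
    using that by (simp add: rb_inv_def act_closed T_closed B.i_closed H.i_closed)
  show assoc: "rb_mult (rb_mult x y) z = rb_mult x (rb_mult y z)" if "x \<in> S" "y \<in> S" "z \<in> S" for x y z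
  proof -
    have "T (rb_mult x y) = m' (T x) (T y)"
      using that by (simp add: rb_mult_def T_m)
    then show ?thesis
      using that
      by (simp add: rb_mult_def act_m T_closed H.m_assoc act_closed H.m_closed flip: act_act)
  qed
  show el: "rb_mult e x = x" if "x \<in> S" for x
    using that by (simp add: rb_mult_def T_e act_e' H.m_e_left)
  show er: "rb_mult x e = x" if "x \<in> S" for x
    using that by (simp add: rb_mult_def act_e T_closed H.m_e_right)
  show ir: "rb_mult x (rb_inv x) = e" if "x \<in> S" for x
    using that
    by (simp add: rb_mult_def rb_inv_def act_act T_closed B.i_closed H.i_closed B.m_i_right act_e' H.m_i_right)
  \<comment> \<open>In a monoid, right inverses of all elements are two-sided: the product is
    multiplied by \<open>rb_inv x\<close> times its own right inverse, and the factor
    \<open>x\<close> with \<open>rb_inv x\<close> in the middle cancels.\<close>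
  show "rb_mult (rb_inv x) x = e" if x: "x \<in> S" for x
  proof -
    have "rb_mult (rb_inv x) x = rb_mult (rb_mult (rb_inv x) x) (rb_mult (rb_inv x) (rb_inv (rb_inv x)))"
      using x by (simp add: ir er rb_inv closed)
    also have "\<dots> = rb_mult (rb_inv x) (rb_mult (rb_mult x (rb_inv x)) (rb_inv (rb_inv x)))"
      using x by (simp add: assoc closed rb_inv)
    also have "\<dots> = e"
      using x by (simp add: ir el rb_inv)
    finally show ?thesis .
  qed
qed

end

text \<open>Here \<open>m\<close> is the additive and \<open>n\<close> the circle group of a skew
  left brace. The neutral element is shared because the two Hopf algebras of a Hopf brace have the
  same unit and counit.\<close>

locale skew_brace = P: group_on S m e i + O: group_on S n e j
  for S :: "'a set" and m e i and n j +
  assumes brace: "a \<in> S \<Longrightarrow> b \<in> S \<Longrightarrow> c \<in> S \<Longrightarrow> n a (m b c) = m (n a b) (m (i a) (n a c))"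
begin

text \<open>The lambda map of the skew brace, through which the circle group acts on the additive
  group by automorphisms; on generalized elements it becomes \<open>Gam\<close>.\<close>

definition "gam a b = m (i a) (n a b)"

lemma gam_closed: "a \<in> S \<Longrightarrow> b \<in> S \<Longrightarrow> gam a b \<in> S"
  by (simp add: gam_def P.m_closed P.i_closed O.m_closed)

lemma m_gam: "a \<in> S \<Longrightarrow> b \<in> S \<Longrightarrow> m a (gam a b) = n a b"
  by (simp add: gam_def P.cancel_i_left O.m_closed)

lemma gam_e: "b \<in> S \<Longrightarrow> gam e b = b"
  using P.i_unique[of e e] by (simp add: gam_def P.e_closed O.m_e_left P.m_e_left)

lemma gam_m: "a \<in> S \<Longrightarrow> b \<in> S \<Longrightarrow> c \<in> S \<Longrightarrow> gam a (m b c) = m (gam a b) (gam a c)"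
  by (simp add: gam_def brace P.m_assoc P.m_closed P.i_closed O.m_closed)

lemma gam_e_right: "a \<in> S \<Longrightarrow> gam a e = e"
  by (simp add: gam_def O.m_e_right P.m_i_left)

text \<open>Multiplied by \<open>gam a b\<close> on the left, both sides become
  \<open>gam a (n b c)\<close>: one by additivity of \<open>gam a\<close>, the other by
  associativity of \<open>n\<close>.\<close>

lemma gam_gam:
  assumes [simp]: "a \<in> S" "b \<in> S" "c \<in> S"
  shows "gam a (gam b c) = gam (n a b) c"
proof -
  have "m (gam a b) (gam a (gam b c)) = gam a (n b c)"
    by (simp add: m_gam gam_closed flip: gam_m)
  also have "\<dots> = m (i a) (n (n a b) c)"
    by (simp add: gam_def O.m_assoc)
  also have "\<dots> = m (gam a b) (gam (n a b) c)"
    by (simp add: gam_def[of a b] P.m_assoc P.m_closed P.i_closed O.m_closed m_gam gam_closed)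
  finally have "m (i (gam a b)) (m (gam a b) (gam a (gam b c)))
      = m (i (gam a b)) (m (gam a b) (gam (n a b) c))" by simp
  then show ?thesis
    by (simp add: P.i_cancel_left gam_closed O.m_closed)
qed

end

section \<open>String diagrams with domains and codomains\<close>

text \<open>
  Hom-sets in a \<open>cat\<close> may overlap, so a morphism does not know its domain and codomain. Recording
  them makes the side conditions of the categorical laws computable by the simplifier.
\<close>

datatype ('o, 'm) tmor = Tm (dm: 'o) (mo: 'm) (cd: 'o)

locale braided_cat_data = strict_braided_category C + braided_data C
  for C :: "('o, 'm, 'z) braided_cat_scheme" (structure)
begin

definition tar :: "('o, 'm) tmor \<Rightarrow> bool" where
  "tar t \<longleftrightarrow> dm t \<in> Ob C \<and> cd t \<in> Ob C \<and> mo t \<in> Hom C (dm t) (cd t)"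

definition tcomp :: "('o, 'm) tmor \<Rightarrow> ('o, 'm) tmor \<Rightarrow> ('o, 'm) tmor" (infixr "\<cdot>" 55) where
  "g \<cdot> f = Tm (dm f) (mo g \<bullet> mo f) (cd g)"

definition ttens :: "('o, 'm) tmor \<Rightarrow> ('o, 'm) tmor \<Rightarrow> ('o, 'm) tmor" (infixr "\<odot>" 70) where
  "f \<odot> g = Tm (dm f \<boxtimes> dm g) (mo f \<otimes> mo g) (cd f \<boxtimes> cd g)"

definition tid :: "'o \<Rightarrow> ('o, 'm) tmor" where
  "tid A = Tm A (Idm C A) A"

definition tbr :: "'o \<Rightarrow> 'o \<Rightarrow> ('o, 'm) tmor" where
  "tbr A B = Tm (A \<boxtimes> B) (\<c> A B) (B \<boxtimes> A)"

lemma tmor_sel [simp]: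
  "dm (g \<cdot> f) = dm f" "cd (g \<cdot> f) = cd g" "mo (g \<cdot> f) = mo g \<bullet> mo f"
  "dm (f \<odot> g) = dm f \<boxtimes> dm g" "cd (f \<odot> g) = cd f \<boxtimes> cd g" "mo (f \<odot> g) = mo f \<otimes> mo g"
  "dm (tid A) = A" "cd (tid A) = A" "mo (tid A) = Idm C A"
  "dm (tbr A B) = A \<boxtimes> B" "cd (tbr A B) = B \<boxtimes> A" "mo (tbr A B) = \<c> A B"
  by (simp_all add: tcomp_def ttens_def tid_def tbr_def)

declare tens_ob [simp] unit_ob [simp] tens_ob_assoc [simp] tens_ob_unit [simp]

lemma tar_ob [simp]: "tar f \<Longrightarrow> dm f \<in> Ob C" "tar f \<Longrightarrow> cd f \<in> Ob C"
  by (simp_all add: tar_def)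

lemma tar_hom [simp]: "\<lbrakk>tar f; dm f = A; cd f = B\<rbrakk> \<Longrightarrow> mo f \<in> Hom C A B"
  by (auto simp: tar_def)

lemma tar_comp [simp]: "\<lbrakk>tar f; tar g; cd f = dm g\<rbrakk> \<Longrightarrow> tar (g \<cdot> f)"
  unfolding tar_def by (auto simp del: tar_ob intro: comp_hom)

lemma tar_tens [simp]: "\<lbrakk>tar f; tar g\<rbrakk> \<Longrightarrow> tar (f \<odot> g)"
  unfolding tar_def by (auto intro: tens_hom)

lemma tar_id [simp]: "A \<in> Ob C \<Longrightarrow> tar (tid A)"
  unfolding tar_def by (auto intro: id_hom)

lemma tar_br [simp]: "\<lbrakk>A \<in> Ob C; B \<in> Ob C\<rbrakk> \<Longrightarrow> tar (tbr A B)"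
  unfolding tar_def by (auto intro: braid_hom)

lemma tmor_eqI: "\<lbrakk>dm f = dm g; cd f = cd g; mo f = mo g\<rbrakk> \<Longrightarrow> f = g"
  by (cases f; cases g) auto

lemma tcomp_assoc [simp]:
  "\<lbrakk>tar f; tar g; tar h; cd f = dm g; cd g = dm h\<rbrakk> \<Longrightarrow> (h \<cdot> g) \<cdot> f = h \<cdot> g \<cdot> f"
  by (rule tmor_eqI) (simp_all add: comp_assoc[of "dm f" "dm g" "dm h" "cd h"])

lemma ttens_assoc [simp]:
  "\<lbrakk>tar f; tar g; tar h\<rbrakk> \<Longrightarrow> (f \<odot> g) \<odot> h = f \<odot> g \<odot> h"
  by (rule tmor_eqI)
    (simp_all add: tens_assoc[of "dm f" "cd f" "dm g" "cd g" "dm h" "cd h"])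

lemma tid_left [simp]: "\<lbrakk>tar f; cd f = A\<rbrakk> \<Longrightarrow> tid A \<cdot> f = f"
  by (rule tmor_eqI) (auto simp: comp_id_left[of "dm f" "cd f"])

lemma tid_right [simp]: "\<lbrakk>tar f; dm f = A\<rbrakk> \<Longrightarrow> f \<cdot> tid A = f"
  by (rule tmor_eqI) (auto simp: comp_id_right[of "dm f" "cd f"])

lemma tid_split [simp]: "\<lbrakk>A \<in> Ob C; B \<in> Ob C\<rbrakk> \<Longrightarrow> tid (A \<boxtimes> B) = tid A \<odot> tid B"
  by (rule tmor_eqI) (auto simp: tens_id)

text \<open>Since \<open>tid_split\<close> rewrites the identity of a tensor product into a tensor
  product of identities, the unit laws must also be available for the split form.\<close>

lemma tid_left2 [simp]:
  "\<lbrakk>tar f; A \<in> Ob C; B \<in> Ob C; cd f = A \<boxtimes> B\<rbrakk> \<Longrightarrow> (tid A \<odot> tid B) \<cdot> f = f"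
  by (simp flip: tid_split)

lemma tid_right2 [simp]:
  "\<lbrakk>tar f; A \<in> Ob C; B \<in> Ob C; dm f = A \<boxtimes> B\<rbrakk> \<Longrightarrow> f \<cdot> (tid A \<odot> tid B) = f"
  by (simp flip: tid_split)

lemma tid_left3 [simp]:
  "\<lbrakk>tar f; A \<in> Ob C; B \<in> Ob C; D \<in> Ob C; cd f = A \<boxtimes> B \<boxtimes> D\<rbrakk>
    \<Longrightarrow> (tid A \<odot> tid B \<odot> tid D) \<cdot> f = f"
  by (simp flip: tid_split)

lemma tid_left4 [simp]:
  "\<lbrakk>tar f; A \<in> Ob C; B \<in> Ob C; D \<in> Ob C; E \<in> Ob C; cd f = A \<boxtimes> B \<boxtimes> D \<boxtimes> E\<rbrakk>
    \<Longrightarrow> (tid A \<odot> tid B \<odot> tid D \<odot> tid E) \<cdot> f = f"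
  by (simp flip: tid_split)

lemma tid_unit [simp]: "tar f \<Longrightarrow> tid \<K> \<odot> f = f" "tar f \<Longrightarrow> f \<odot> tid \<K> = f"
  by (rule tmor_eqI; auto simp: tens_unit[of "dm f" "cd f"])+

lemma interchange:
  "\<lbrakk>tar f; tar g; tar f'; tar g'; cd f = dm g; cd f' = dm g'\<rbrakk>
    \<Longrightarrow> (g \<odot> g') \<cdot> (f \<odot> f') = (g \<cdot> f) \<odot> (g' \<cdot> f')"
  by (rule tmor_eqI)
    (simp_all add: tens_comp[of "dm f" "dm g" "cd g" "dm f'" "dm g'" "cd g'"])

text \<open>The interchange law for two factors in the middle of a composite that is nested to the
  right.\<close>

lemma interchange2:
  "\<lbrakk>tar f; tar g; tar f'; tar g'; tar r; cd f = dm g; cd f' = dm g'; cd r = dm f \<boxtimes> dm f'\<rbrakk>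
    \<Longrightarrow> (g \<odot> g') \<cdot> (f \<odot> f') \<cdot> r = ((g \<cdot> f) \<odot> (g' \<cdot> f')) \<cdot> r"
  by (subst interchange[symmetric]) auto

lemma tbr_natural:
  "\<lbrakk>tar f; tar g; cd f = B; cd g = E\<rbrakk> \<Longrightarrow> tbr B E \<cdot> (f \<odot> g) = (g \<odot> f) \<cdot> tbr (dm f) (dm g)"
  by (rule tmor_eqI) (auto simp: braid_natural[of "dm f" "cd f" "dm g" "cd g"])

lemma tbr_hex_right:
  "\<lbrakk>A \<in> Ob C; B \<in> Ob C; D \<in> Ob C\<rbrakk>
    \<Longrightarrow> tbr A (B \<boxtimes> D) = (tid B \<odot> tbr A D) \<cdot> (tbr A B \<odot> tid D)"
  by (rule tmor_eqI) (auto simp: hexagon_right)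

lemma tbr_hex_left:
  "\<lbrakk>A \<in> Ob C; B \<in> Ob C; D \<in> Ob C\<rbrakk>
    \<Longrightarrow> tbr (A \<boxtimes> B) D = (tbr A D \<odot> tid B) \<cdot> (tid A \<odot> tbr B D)"
  by (rule tmor_eqI) (auto simp: hexagon_left)

lemma tbr_inverse:
  assumes "A \<in> Ob C" "B \<in> Ob C"
  obtains d where "tar d" "dm d = B \<boxtimes> A" "cd d = A \<boxtimes> B"
    "d \<cdot> tbr A B = tid (A \<boxtimes> B)" "tbr A B \<cdot> d = tid (B \<boxtimes> A)"
proof -
  from braid_iso[OF assms] obtain d where
    "d \<in> Hom C (B \<boxtimes> A) (A \<boxtimes> B)" "d \<bullet> \<c> A B = Idm C (A \<boxtimes> B)" "\<c> A B \<bullet> d = Idm C (B \<boxtimes> A)"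
    by blast
  with assms show thesis
    by (intro that[of "Tm (B \<boxtimes> A) d (A \<boxtimes> B)"])
      (auto simp: tar_def tens_id simp del: tar_ob tar_hom intro!: tmor_eqI)
qed

text \<open>The locale does not assume this. The hexagon with \<open>\<K>\<close> in both right
  positions makes the braiding idempotent, and an invertible idempotent is an identity.\<close>

lemma tbr_unit_right [simp]:
  assumes "A \<in> Ob C" shows "tbr A \<K> = tid A"
proof -
  obtain d where d: "tar d" "dm d = \<K> \<boxtimes> A" "cd d = A \<boxtimes> \<K>"
    "d \<cdot> tbr A \<K> = tid (A \<boxtimes> \<K>)" "tbr A \<K> \<cdot> d = tid (\<K> \<boxtimes> A)"
    using tbr_inverse[OF assms unit_ob] .
  have "tbr A \<K> = (tid \<K> \<odot> tbr A \<K>) \<cdot> (tbr A \<K> \<odot> tid \<K>)"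
    using tbr_hex_right[of A \<K> \<K>] assms by (simp only: tens_ob_unit unit_ob)
  also have "\<dots> = tbr A \<K> \<cdot> tbr A \<K>"
    using assms by simp
  finally have "d \<cdot> tbr A \<K> = d \<cdot> tbr A \<K> \<cdot> tbr A \<K>"
    by (rule arg_cong)
  also have "\<dots> = (d \<cdot> tbr A \<K>) \<cdot> tbr A \<K>"
    using assms d(1-3) by simp
  finally have "d \<cdot> tbr A \<K> = (d \<cdot> tbr A \<K>) \<cdot> tbr A \<K>" .
  with d(4) assms show ?thesis by simp
qed

lemma tbr_unit_left [simp]:
  assumes "A \<in> Ob C" shows "tbr \<K> A = tid A"
proof -
  obtain d where d: "tar d" "dm d = A \<boxtimes> \<K>" "cd d = \<K> \<boxtimes> A"
    "d \<cdot> tbr \<K> A = tid (\<K> \<boxtimes> A)" "tbr \<K> A \<cdot> d = tid (A \<boxtimes> \<K>)"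
    using tbr_inverse[OF unit_ob assms] .
  have "tbr \<K> A = (tbr \<K> A \<odot> tid \<K>) \<cdot> (tid \<K> \<odot> tbr \<K> A)"
    using tbr_hex_left[of \<K> \<K> A] assms by (simp only: tens_ob_unit unit_ob)
  also have "\<dots> = tbr \<K> A \<cdot> tbr \<K> A"
    using assms by simp
  finally have "d \<cdot> tbr \<K> A = d \<cdot> tbr \<K> A \<cdot> tbr \<K> A"
    by (rule arg_cong)
  also have "\<dots> = (d \<cdot> tbr \<K> A) \<cdot> tbr \<K> A"
    using assms d(1-3) by simp
  finally have "d \<cdot> tbr \<K> A = (d \<cdot> tbr \<K> A) \<cdot> tbr \<K> A" .
  with d(4) assms show ?thesis by simp
qed

section \<open>Tensor products of coalgebras\<close>

text \<open>Naturality slides the second comultiplications below all crossings. Each side then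
  becomes a braid after the threefold comultiplications of the two factors, and only the braids
  remain to be compared.\<close>

lemma tensor_coassoc_typed:
  assumes A: "A \<in> Ob C" "tar a" "dm a = A" "cd a = A \<boxtimes> A"
    and B: "B \<in> Ob C" "tar b" "dm b = B" "cd b = B \<boxtimes> B"
    and ca: "(tid A \<odot> a) \<cdot> a = (a \<odot> tid A) \<cdot> a"
    and cb: "(tid B \<odot> b) \<cdot> b = (b \<odot> tid B) \<cdot> b"
  defines "D \<equiv> (tid A \<odot> tbr A B \<odot> tid B) \<cdot> (a \<odot> b)"
  shows "(tid (A \<boxtimes> B) \<odot> D) \<cdot> D = (D \<odot> tid (A \<boxtimes> B)) \<cdot> D"
proof -
  note [simp] = A B
  let ?c = "tbr A B"
  let ?aa = "(a \<odot> tid A) \<cdot> a" and ?bb = "(b \<odot> tid B) \<cdot> b"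
  have L: "(D \<odot> tid (A \<boxtimes> B)) \<cdot> D
     = (tid A \<odot> ((?c \<odot> tid B \<odot> tid A) \<cdot> (tid A \<odot> tbr A (B \<boxtimes> B))) \<odot> tid B) \<cdot> (?aa \<odot> ?bb)"
  proof -
    let ?X1 = "tid A \<odot> ?c \<odot> tid B \<odot> tid A \<odot> tid B" and ?X2 = "a \<odot> b \<odot> tid A \<odot> tid B"
      and ?X3 = "tid A \<odot> ?c \<odot> tid B"
    let ?Y1 = "tid A \<odot> tid A \<odot> tbr A (B \<boxtimes> B) \<odot> tid B" and ?Y2 = "a \<odot> tid A \<odot> b \<odot> tid B"
    have 1: "D \<odot> tid (A \<boxtimes> B) = ?X1 \<cdot> ?X2"
      unfolding D_def
      using interchange[of "a \<odot> b" "tid A \<odot> ?c \<odot> tid B" "tid (A \<boxtimes> B)" "tid (A \<boxtimes> B)"]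
      by (simp add: tid_split interchange)
    have "?X2 \<cdot> ?X3 = a \<odot> ((b \<odot> tid A) \<cdot> ?c) \<odot> tid B"
      using interchange[of ?c "b \<odot> tid A" "tid B" "tid B"] by (simp add: interchange)
    also have "\<dots> = a \<odot> (tbr A (B \<boxtimes> B) \<cdot> (tid A \<odot> b)) \<odot> tid B"
      using tbr_natural[of "tid A" b A "B \<boxtimes> B"] by simp
    also have "\<dots> = ?Y1 \<cdot> ?Y2"
      using interchange[of a "tid A \<odot> tid A" "tid A \<odot> b \<odot> tid B" "tbr A (B \<boxtimes> B) \<odot> tid B"]
        interchange[of "tid A \<odot> b" "tbr A (B \<boxtimes> B)" "tid B" "tid B"]
      by simp
    finally have 2: "?X2 \<cdot> ?X3 = ?Y1 \<cdot> ?Y2" .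
    have 3: "?Y2 \<cdot> (a \<odot> b) = ?aa \<odot> ?bb"
      using interchange[of a "a \<odot> tid A" b "b \<odot> tid B"] by simp
    have 4: "?X1 \<cdot> ?Y1 = tid A \<odot> ((?c \<odot> tid B \<odot> tid A) \<cdot> (tid A \<odot> tbr A (B \<boxtimes> B))) \<odot> tid B"
      using interchange[of "tid A \<odot> tbr A (B \<boxtimes> B)" "?c \<odot> tid B \<odot> tid A" "tid B" "tid B"]
      by (simp add: interchange)
    have "(D \<odot> tid (A \<boxtimes> B)) \<cdot> D = ?X1 \<cdot> (?X2 \<cdot> ?X3) \<cdot> (a \<odot> b)"
      unfolding 1 by (simp add: D_def)
    also have "\<dots> = (?X1 \<cdot> ?Y1) \<cdot> (?Y2 \<cdot> (a \<odot> b))"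
      unfolding 2 by simp
    finally show ?thesis unfolding 3 4 .
  qed
  have R: "(tid (A \<boxtimes> B) \<odot> D) \<cdot> D
     = (tid A \<odot> ((tid B \<odot> tid A \<odot> ?c) \<cdot> (tbr (A \<boxtimes> A) B \<odot> tid B)) \<odot> tid B)
       \<cdot> (((tid A \<odot> a) \<cdot> a) \<odot> ((tid B \<odot> b) \<cdot> b))"
  proof -
    let ?X1 = "tid A \<odot> tid B \<odot> tid A \<odot> ?c \<odot> tid B" and ?X2 = "tid A \<odot> tid B \<odot> a \<odot> b"
      and ?X3 = "tid A \<odot> ?c \<odot> tid B"
    let ?Y1 = "tid A \<odot> tbr (A \<boxtimes> A) B \<odot> tid B \<odot> tid B" and ?Y2 = "tid A \<odot> a \<odot> tid B \<odot> b"
    have 1: "tid (A \<boxtimes> B) \<odot> D = ?X1 \<cdot> ?X2"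
      unfolding D_def
      using interchange[of "tid (A \<boxtimes> B)" "tid (A \<boxtimes> B)" "a \<odot> b" "tid A \<odot> ?c \<odot> tid B"]
      by (simp add: tid_split interchange)
    have "?X2 \<cdot> ?X3 = tid A \<odot> ((tid B \<odot> a) \<cdot> ?c) \<odot> b"
      using interchange[of ?c "tid B \<odot> a" "tid B" b] by (simp add: interchange)
    also have "\<dots> = tid A \<odot> (tbr (A \<boxtimes> A) B \<cdot> (a \<odot> tid B)) \<odot> b"
      using tbr_natural[of a "tid B" "A \<boxtimes> A" B] by simp
    also have "\<dots> = ?Y1 \<cdot> ?Y2"
      using interchange[of "a \<odot> tid B" "tbr (A \<boxtimes> A) B" b "tid B \<odot> tid B"]
      by (simp add: interchange)
    finally have 2: "?X2 \<cdot> ?X3 = ?Y1 \<cdot> ?Y2" .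
    have 3: "?Y2 \<cdot> (a \<odot> b) = ((tid A \<odot> a) \<cdot> a) \<odot> ((tid B \<odot> b) \<cdot> b)"
      using interchange[of a "tid A \<odot> a" b "tid B \<odot> b"] by simp
    have 4: "?X1 \<cdot> ?Y1
        = tid A \<odot> ((tid B \<odot> tid A \<odot> ?c) \<cdot> (tbr (A \<boxtimes> A) B \<odot> tid B)) \<odot> tid B"
      using interchange[of "tbr (A \<boxtimes> A) B \<odot> tid B" "tid B \<odot> tid A \<odot> ?c" "tid B" "tid B"]
      by (simp add: interchange)
    have "(tid (A \<boxtimes> B) \<odot> D) \<cdot> D = ?X1 \<cdot> (?X2 \<cdot> ?X3) \<cdot> (a \<odot> b)"
      unfolding 1 by (simp add: D_def)
    also have "\<dots> = (?X1 \<cdot> ?Y1) \<cdot> (?Y2 \<cdot> (a \<odot> b))"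
      unfolding 2 by simp
    finally show ?thesis unfolding 3 4 .
  qed
  \<comment> \<open>By the hexagons, both braids perform the middle crossing and afterwards two
    disjoint crossings, whose order is irrelevant by interchange.\<close>
  have "(?c \<odot> tid B \<odot> tid A) \<cdot> (tid A \<odot> tbr A (B \<boxtimes> B))
      = ((?c \<odot> tid B \<odot> tid A) \<cdot> (tid A \<odot> tid B \<odot> ?c)) \<cdot> (tid A \<odot> ?c \<odot> tid B)"
    by (simp add: tbr_hex_right interchange)
  also have "(?c \<odot> tid B \<odot> tid A) \<cdot> (tid A \<odot> tid B \<odot> ?c) = ?c \<odot> ?c"
    using interchange[of "tid A \<odot> tid B" ?c ?c "tid B \<odot> tid A"] by simp
  also have "\<dots> = (tid B \<odot> tid A \<odot> ?c) \<cdot> (?c \<odot> tid A \<odot> tid B)"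
    using interchange[of ?c "tid B \<odot> tid A" "tid A \<odot> tid B" ?c] by simp
  also have "\<dots> \<cdot> (tid A \<odot> ?c \<odot> tid B)
      = (tid B \<odot> tid A \<odot> ?c) \<cdot> (tbr (A \<boxtimes> A) B \<odot> tid B)"
    using interchange[of "tid A \<odot> ?c" "?c \<odot> tid A" "tid B" "tid B"]
    by (simp add: tbr_hex_left)
  finally show ?thesis unfolding L R ca cb by simp
qed

text \<open>Maps applied to the four outputs of the comultiplication of a tensor product can be
  evaluated on \<open>a\<close> and \<open>b\<close> separately, at the price of one crossing of the
  two inner codomains. When an inner codomain is \<open>\<K>\<close>, the crossing disappears; the
  counit laws and the projections come from that case.\<close>

lemma tensor_pair_typed:
  assumes A: "A \<in> Ob C" "tar a" "dm a = A" "cd a = A \<boxtimes> A"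
    and B: "B \<in> Ob C" "tar b" "dm b = B" "cd b = B \<boxtimes> B"
    and x: "tar x" "dm x = A" "cd x = X" and u: "tar u" "dm u = A" "cd u = U"
    and v: "tar v" "dm v = B" "cd v = V" and y: "tar y" "dm y = B" "cd y = Y"
  shows "(x \<odot> v \<odot> u \<odot> y) \<cdot> (tid A \<odot> tbr A B \<odot> tid B) \<cdot> (a \<odot> b)
    = (tid X \<odot> tbr U V \<odot> tid Y) \<cdot> (((x \<odot> u) \<cdot> a) \<odot> ((v \<odot> y) \<cdot> b))"
proof -
  have ob [simp]: "X \<in> Ob C" "U \<in> Ob C" "V \<in> Ob C" "Y \<in> Ob C"
    using tar_ob(2)[OF x(1)] tar_ob(2)[OF u(1)] tar_ob(2)[OF v(1)] tar_ob(2)[OF y(1)] x u v y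
    by simp_all
  note [simp] = A B x u v y
  have "(x \<odot> v \<odot> u \<odot> y) \<cdot> (tid A \<odot> tbr A B \<odot> tid B) = x \<odot> ((v \<odot> u) \<cdot> tbr A B) \<odot> y"
    using interchange[of "tbr A B" "v \<odot> u" "tid B" y] by (simp add: interchange)
  also have "\<dots> = x \<odot> (tbr U V \<cdot> (u \<odot> v)) \<odot> y"
    using tbr_natural[of u v U V] by simp
  also have "\<dots> = (tid X \<odot> tbr U V \<odot> tid Y) \<cdot> (x \<odot> u \<odot> v \<odot> y)"
    using interchange[of "u \<odot> v" "tbr U V" y "tid Y"] by (simp add: interchange)
  finally have "(x \<odot> v \<odot> u \<odot> y) \<cdot> (tid A \<odot> tbr A B \<odot> tid B) \<cdot> (a \<odot> b)
     = (tid X \<odot> tbr U V \<odot> tid Y) \<cdot> ((x \<odot> u \<odot> v \<odot> y) \<cdot> (a \<odot> b))"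
    by (simp flip: tcomp_assoc)
  also have "(x \<odot> u \<odot> v \<odot> y) \<cdot> (a \<odot> b) = ((x \<odot> u) \<cdot> a) \<odot> ((v \<odot> y) \<cdot> b)"
    using interchange[of a "x \<odot> u" b "v \<odot> y"] by simp
  finally show ?thesis .
qed

text \<open>The hexagons resolve the crossing of two pairs of strands into four simple crossings.
  This form separates \<open>tbr A A\<close> and \<open>tbr B B\<close>, which cocommutativity
  absorbs, from the two mixed crossings.\<close>

lemma tbr_square:
  assumes [simp]: "A \<in> Ob C" "B \<in> Ob C"
  shows "tbr (A \<boxtimes> B) (A \<boxtimes> B)
    = (tid A \<odot> tbr A B \<odot> tid B) \<cdot> (tbr A A \<odot> tbr B B) \<cdot> (tid A \<odot> tbr B A \<odot> tid B)"
proof -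
  let ?m = "tid A \<odot> tbr A B \<odot> tid B" and ?n = "tid A \<odot> tbr B A \<odot> tid B"
  have "tbr (A \<boxtimes> B) (A \<boxtimes> B)
      = (((tid A \<odot> tbr A B) \<cdot> (tbr A A \<odot> tid B)) \<odot> tid B)
        \<cdot> (tid A \<odot> ((tid A \<odot> tbr B B) \<cdot> (tbr B A \<odot> tid B)))"
    by (simp add: tbr_hex_left[of A B "A \<boxtimes> B"] tbr_hex_right[of A A B] tbr_hex_right[of B A B])
  also have "\<dots> = (?m \<cdot> (tbr A A \<odot> tid B \<odot> tid B)) \<cdot> ((tid A \<odot> tid A \<odot> tbr B B) \<cdot> ?n)"
    using interchange[of "tbr A A \<odot> tid B" "tid A \<odot> tbr A B" "tid B" "tid B"]
    by (simp add: interchange)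
  also have "\<dots> = ?m \<cdot> ((tbr A A \<odot> tid B \<odot> tid B) \<cdot> (tid A \<odot> tid A \<odot> tbr B B)) \<cdot> ?n"
    by simp
  also have "(tbr A A \<odot> tid B \<odot> tid B) \<cdot> (tid A \<odot> tid A \<odot> tbr B B) = tbr A A \<odot> tbr B B"
    using interchange[of "tid A \<odot> tid A" "tbr A A" "tbr B B" "tid B \<odot> tid B"]
    by simp
  finally show ?thesis .
qed

text \<open>In \<open>tbr_square\<close> the crossing that acts first meets the one inside the
  tensor comultiplication. The two cancel by \<open>sym\<close>, and cocommutativity of the factors
  absorbs the crossings that come next.\<close>

lemma tensor_cocomm_typed:
  assumes A: "A \<in> Ob C" "tar a" "dm a = A" "cd a = A \<boxtimes> A"
    and B: "B \<in> Ob C" "tar b" "dm b = B" "cd b = B \<boxtimes> B"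
    and ca: "tbr A A \<cdot> a = a" and cb: "tbr B B \<cdot> b = b"
    and sym: "tbr B A \<cdot> tbr A B = tid (A \<boxtimes> B)"
  shows "tbr (A \<boxtimes> B) (A \<boxtimes> B) \<cdot> (tid A \<odot> tbr A B \<odot> tid B) \<cdot> (a \<odot> b)
    = (tid A \<odot> tbr A B \<odot> tid B) \<cdot> (a \<odot> b)"
proof -
  note [simp] = A B
  let ?m = "tid A \<odot> tbr A B \<odot> tid B" and ?n = "tid A \<odot> tbr B A \<odot> tid B"
  have "?n \<cdot> ?m = tid (A \<boxtimes> A \<boxtimes> B \<boxtimes> B)"
    by (simp add: interchange sym)
  then have "?n \<cdot> ?m \<cdot> (a \<odot> b) = a \<odot> b"
    using tcomp_assoc[of "a \<odot> b" ?m ?n] by simp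
  then have "tbr (A \<boxtimes> B) (A \<boxtimes> B) \<cdot> ?m \<cdot> (a \<odot> b) = ?m \<cdot> (tbr A A \<odot> tbr B B) \<cdot> (a \<odot> b)"
    by (simp add: tbr_square)
  also have "\<dots> = ?m \<cdot> (a \<odot> b)"
    by (simp add: interchange ca cb)
  finally show ?thesis .
qed

text \<open>The hexagons give four copies of \<open>tbr H H\<close>, which cancel in pairs from the
  inside. This is the symmetry needed to see that the tensor product of \<open>H\<close> with
  \<open>H \<boxtimes> H\<close> is cocommutative.\<close>

lemma tbr_sym_square:
  assumes H: "H \<in> Ob C" and sym: "tbr H H \<cdot> tbr H H = tid (H \<boxtimes> H)"
  shows "tbr (H \<boxtimes> H) H \<cdot> tbr H (H \<boxtimes> H) = tid (H \<boxtimes> H \<boxtimes> H)"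
proof -
  note [simp] = H
  have "(tid H \<odot> tbr H H) \<cdot> (tid H \<odot> tbr H H) \<cdot> (tbr H H \<odot> tid H) = tbr H H \<odot> tid H"
    by (simp add: interchange2 sym)
  then show ?thesis
    by (simp add: tbr_hex_left tbr_hex_right interchange sym)
qed

text \<open>
  The operator \<open>x \<mapsto> (\<mu> \<otimes> Z) \<circ> (H \<otimes> x) \<circ> (\<delta> \<otimes> W)\<close> has a left inverse, obtained by
  inserting the antipode; similarly on the right.
\<close>

lemma antipode_cancel_left:
  assumes H: "H \<in> Ob C" "W \<in> Ob C" "Z \<in> Ob C"
    and m: "tar m" "dm m = H \<boxtimes> H" "cd m = H" and e: "tar e" "dm e = \<K>" "cd e = H"
    and d: "tar d" "dm d = H" "cd d = H \<boxtimes> H" and n: "tar n" "dm n = H" "cd n = \<K>"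
    and l: "tar l" "dm l = H" "cd l = H"
    and x: "tar x" "dm x = H \<boxtimes> W" "cd x = H \<boxtimes> Z"
    and assoc: "m \<cdot> (tid H \<odot> m) = m \<cdot> (m \<odot> tid H)" and unit: "m \<cdot> (e \<odot> tid H) = tid H"
    and coassoc: "(tid H \<odot> d) \<cdot> d = (d \<odot> tid H) \<cdot> d" and counit: "(n \<odot> tid H) \<cdot> d = tid H"
    and anti: "m \<cdot> (l \<odot> tid H) \<cdot> d = e \<cdot> n"
  shows "(m \<odot> tid Z) \<cdot> (l \<odot> ((m \<odot> tid Z) \<cdot> (tid H \<odot> x) \<cdot> (d \<odot> tid W))) \<cdot> (d \<odot> tid W) = x"
proof -
  note [simp] = H m e d n l x
  have 1: "l \<odot> ((m \<odot> tid Z) \<cdot> (tid H \<odot> x) \<cdot> (d \<odot> tid W))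
      = (tid H \<odot> m \<odot> tid Z) \<cdot> (l \<odot> tid H \<odot> x) \<cdot> (tid H \<odot> d \<odot> tid W)"
    by (simp add: interchange)
  have 2: "(tid H \<odot> d \<odot> tid W) \<cdot> (d \<odot> tid W) = (d \<odot> tid H \<odot> tid W) \<cdot> (d \<odot> tid W)"
    using interchange[of d "tid H \<odot> d" "tid W" "tid W"] interchange[of d "d \<odot> tid H" "tid W" "tid W"]
    by (simp add: coassoc)
  have 3: "(m \<odot> tid Z) \<cdot> (tid H \<odot> m \<odot> tid Z) = (m \<odot> tid Z) \<cdot> (m \<odot> tid H \<odot> tid Z)"
    using interchange[of "tid H \<odot> m" m "tid Z" "tid Z"] interchange[of "m \<odot> tid H" m "tid Z" "tid Z"]
    by (simp add: assoc)
  \<comment> \<open>After regrouping, \<open>l\<close> and the two operations around it no longer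
    touch \<open>x\<close>, so the antipode axiom replaces them by counit and unit; the facts
    \<open>5\<close> and \<open>6\<close> remove these.\<close>
  have "(m \<odot> tid H \<odot> tid Z) \<cdot> (l \<odot> tid H \<odot> x) \<cdot> (d \<odot> tid H \<odot> tid W)
      = (m \<cdot> (l \<odot> tid H) \<cdot> d) \<odot> x"
    using interchange[of d "l \<odot> tid H" "tid H \<odot> tid W" x]
      interchange[of "(l \<odot> tid H) \<cdot> d" m x "tid H \<odot> tid Z"]
    by simp
  also have "\<dots> = (e \<odot> tid H \<odot> tid Z) \<cdot> x \<cdot> (n \<odot> tid H \<odot> tid W)"
    using interchange[of n e x "tid H \<odot> tid Z"]
      interchange[of n "tid \<K>" "tid H \<odot> tid W" x] unfolding anti
    by simp
  finally have 4: "(m \<odot> tid H \<odot> tid Z) \<cdot> (l \<odot> tid H \<odot> x) \<cdot> (d \<odot> tid H \<odot> tid W)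
      = (e \<odot> tid H \<odot> tid Z) \<cdot> x \<cdot> (n \<odot> tid H \<odot> tid W)" .
  have 5: "(m \<odot> tid Z) \<cdot> (e \<odot> tid H \<odot> tid Z) = tid (H \<boxtimes> Z)"
    using interchange[of "e \<odot> tid H" m "tid Z" "tid Z"] by (simp add: unit)
  have 6: "(n \<odot> tid H \<odot> tid W) \<cdot> (d \<odot> tid W) = tid (H \<boxtimes> W)"
    using interchange[of d "n \<odot> tid H" "tid W" "tid W"] by (simp add: counit)
  have "(m \<odot> tid Z) \<cdot> (l \<odot> ((m \<odot> tid Z) \<cdot> (tid H \<odot> x) \<cdot> (d \<odot> tid W))) \<cdot> (d \<odot> tid W)
      = ((m \<odot> tid Z) \<cdot> (tid H \<odot> m \<odot> tid Z)) \<cdot> (l \<odot> tid H \<odot> x)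
        \<cdot> ((tid H \<odot> d \<odot> tid W) \<cdot> (d \<odot> tid W))"
    unfolding 1 by simp
  also have "\<dots> = (m \<odot> tid Z) \<cdot> ((m \<odot> tid H \<odot> tid Z) \<cdot> (l \<odot> tid H \<odot> x)
      \<cdot> (d \<odot> tid H \<odot> tid W)) \<cdot> (d \<odot> tid W)"
    unfolding 2 3 by simp
  also have "\<dots> = ((m \<odot> tid Z) \<cdot> (e \<odot> tid H \<odot> tid Z)) \<cdot> x
      \<cdot> ((n \<odot> tid H \<odot> tid W) \<cdot> (d \<odot> tid W))"
    unfolding 4 by simp
  also have "\<dots> = x"
    unfolding 5 6 by simp
  finally show ?thesis .
qed

lemma antipode_cancel_right:
  assumes H: "H \<in> Ob C" "W \<in> Ob C" "Z \<in> Ob C"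
    and m: "tar m" "dm m = H \<boxtimes> H" "cd m = H" and e: "tar e" "dm e = \<K>" "cd e = H"
    and d: "tar d" "dm d = H" "cd d = H \<boxtimes> H" and n: "tar n" "dm n = H" "cd n = \<K>"
    and l: "tar l" "dm l = H" "cd l = H"
    and x: "tar x" "dm x = W \<boxtimes> H" "cd x = Z \<boxtimes> H"
    and assoc: "m \<cdot> (tid H \<odot> m) = m \<cdot> (m \<odot> tid H)" and unit: "m \<cdot> (tid H \<odot> e) = tid H"
    and coassoc: "(tid H \<odot> d) \<cdot> d = (d \<odot> tid H) \<cdot> d" and counit: "(tid H \<odot> n) \<cdot> d = tid H"
    and anti: "m \<cdot> (tid H \<odot> l) \<cdot> d = e \<cdot> n"
  shows "(tid Z \<odot> m) \<cdot> (((tid Z \<odot> m) \<cdot> (x \<odot> tid H) \<cdot> (tid W \<odot> d)) \<odot> l) \<cdot> (tid W \<odot> d) = x"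
proof -
  note [simp] = H m e d n l x
  have 1: "((tid Z \<odot> m) \<cdot> (x \<odot> tid H) \<cdot> (tid W \<odot> d)) \<odot> l
      = (tid Z \<odot> m \<odot> tid H) \<cdot> (x \<odot> tid H \<odot> l) \<cdot> (tid W \<odot> d \<odot> tid H)"
    using interchange[of "tid W \<odot> d" "x \<odot> tid H" "tid H" l]
      interchange[of "(x \<odot> tid H) \<cdot> (tid W \<odot> d)" "tid Z \<odot> m" l "tid H"]
    by simp
  have 2: "(tid W \<odot> d \<odot> tid H) \<cdot> (tid W \<odot> d) = (tid W \<odot> tid H \<odot> d) \<cdot> (tid W \<odot> d)"
    by (simp add: interchange coassoc)
  have 3: "(tid Z \<odot> m) \<cdot> (tid Z \<odot> m \<odot> tid H) = (tid Z \<odot> m) \<cdot> (tid Z \<odot> tid H \<odot> m)"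
    by (simp add: interchange assoc)
  have "(tid Z \<odot> tid H \<odot> m) \<cdot> (x \<odot> tid H \<odot> l) \<cdot> (tid W \<odot> tid H \<odot> d)
      = x \<odot> (m \<cdot> (tid H \<odot> l) \<cdot> d)"
    using interchange[of "tid W \<odot> tid H" x d "tid H \<odot> l"]
      interchange[of x "tid Z \<odot> tid H" "(tid H \<odot> l) \<cdot> d" m]
    by simp
  also have "\<dots> = (tid Z \<odot> tid H \<odot> e) \<cdot> x \<cdot> (tid W \<odot> tid H \<odot> n)"
    using interchange[of x "tid Z \<odot> tid H" n e]
      interchange[of "tid W \<odot> tid H" x n "tid \<K>"] unfolding anti
    by simp
  finally have 4: "(tid Z \<odot> tid H \<odot> m) \<cdot> (x \<odot> tid H \<odot> l) \<cdot> (tid W \<odot> tid H \<odot> d)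
      = (tid Z \<odot> tid H \<odot> e) \<cdot> x \<cdot> (tid W \<odot> tid H \<odot> n)" .
  have 5: "(tid Z \<odot> m) \<cdot> (tid Z \<odot> tid H \<odot> e) = tid (Z \<boxtimes> H)"
    by (simp add: interchange unit)
  have 6: "(tid W \<odot> tid H \<odot> n) \<cdot> (tid W \<odot> d) = tid (W \<boxtimes> H)"
    by (simp add: interchange counit)
  have "(tid Z \<odot> m) \<cdot> (((tid Z \<odot> m) \<cdot> (x \<odot> tid H) \<cdot> (tid W \<odot> d)) \<odot> l) \<cdot> (tid W \<odot> d)
      = ((tid Z \<odot> m) \<cdot> (tid Z \<odot> m \<odot> tid H)) \<cdot> (x \<odot> tid H \<odot> l)
        \<cdot> ((tid W \<odot> d \<odot> tid H) \<cdot> (tid W \<odot> d))"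
    unfolding 1 by simp
  also have "\<dots> = (tid Z \<odot> m) \<cdot> ((tid Z \<odot> tid H \<odot> m) \<cdot> (x \<odot> tid H \<odot> l)
      \<cdot> (tid W \<odot> tid H \<odot> d)) \<cdot> (tid W \<odot> d)"
    unfolding 2 3 by simp
  also have "\<dots> = ((tid Z \<odot> m) \<cdot> (tid Z \<odot> tid H \<odot> e)) \<cdot> x
      \<cdot> ((tid W \<odot> tid H \<odot> n) \<cdot> (tid W \<odot> d))"
    unfolding 4 by simp
  also have "\<dots> = x"
    unfolding 5 6 by simp
  finally show ?thesis .
qed

text \<open>The inverse \<open>r\<close> of the braiding is compared with the braiding itself: both
  give the same result when inserted as the middle crossing of the bialgebra axiom, and that
  crossing can be recovered from the result.\<close>

lemma cocomm_hopf_braid_typed: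
  assumes H: "H \<in> Ob C"
    and m: "tar m" "dm m = H \<boxtimes> H" "cd m = H" and e: "tar e" "dm e = \<K>" "cd e = H"
    and d: "tar d" "dm d = H" "cd d = H \<boxtimes> H" and n: "tar n" "dm n = H" "cd n = \<K>"
    and l: "tar l" "dm l = H" "cd l = H"
    and assoc: "m \<cdot> (tid H \<odot> m) = m \<cdot> (m \<odot> tid H)"
    and unit: "m \<cdot> (e \<odot> tid H) = tid H" "m \<cdot> (tid H \<odot> e) = tid H"
    and coassoc: "(tid H \<odot> d) \<cdot> d = (d \<odot> tid H) \<cdot> d"
    and counit: "(n \<odot> tid H) \<cdot> d = tid H" "(tid H \<odot> n) \<cdot> d = tid H"
    and anti: "m \<cdot> (l \<odot> tid H) \<cdot> d = e \<cdot> n" "m \<cdot> (tid H \<odot> l) \<cdot> d = e \<cdot> n"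
    and bialg: "d \<cdot> m = (m \<odot> m) \<cdot> (tid H \<odot> tbr H H \<odot> tid H) \<cdot> (d \<odot> d)"
    and cocomm: "tbr H H \<cdot> d = d"
  shows "tbr H H \<cdot> tbr H H = tid (H \<boxtimes> H)"
proof -
  note [simp] = H m e d n l
  let ?c = "tbr H H"
  obtain r where r [simp]: "tar r" "dm r = H \<boxtimes> H" "cd r = H \<boxtimes> H"
    and rc: "r \<cdot> ?c = tid (H \<boxtimes> H)" "?c \<cdot> r = tid (H \<boxtimes> H)"
    using tbr_inverse[OF H H] .
  \<comment> \<open>The right-hand side of \<open>bialg\<close> with its crossing replaced by a
    variable. It factors as \<open>\<Phi>\<^sub>2\<close> after \<open>\<Phi>\<^sub>1\<close>, one
    for each outer strand, so the antipode is used once on either side.\<close>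
  define \<Phi> where "\<Phi> x = (m \<odot> m) \<cdot> (tid H \<odot> x \<odot> tid H) \<cdot> (d \<odot> d)" for x
  define \<Phi>\<^sub>1 where "\<Phi>\<^sub>1 x = (m \<odot> tid H) \<cdot> (tid H \<odot> x) \<cdot> (d \<odot> tid H)" for x
  define \<Psi>\<^sub>1 where "\<Psi>\<^sub>1 u = (m \<odot> tid H) \<cdot> (l \<odot> u) \<cdot> (d \<odot> tid H)" for u
  define \<Phi>\<^sub>2 where "\<Phi>\<^sub>2 x = (tid H \<odot> m) \<cdot> (x \<odot> tid H) \<cdot> (tid H \<odot> d)" for x
  define \<Psi>\<^sub>2 where "\<Psi>\<^sub>2 u = (tid H \<odot> m) \<cdot> (u \<odot> l) \<cdot> (tid H \<odot> d)" for u
  have \<Phi>_inv: "\<Psi>\<^sub>1 (\<Psi>\<^sub>2 (\<Phi> x)) = x" if x [simp]: "tar x" "dm x = H \<boxtimes> H" "cd x = H \<boxtimes> H" for x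
  proof -
    have \<Phi>\<^sub>1 [simp]: "tar (\<Phi>\<^sub>1 x)" "dm (\<Phi>\<^sub>1 x) = H \<boxtimes> H" "cd (\<Phi>\<^sub>1 x) = H \<boxtimes> H"
      unfolding \<Phi>\<^sub>1_def by simp_all
    have "(m \<odot> m) = (tid H \<odot> m) \<cdot> (m \<odot> tid H \<odot> tid H)"
      using interchange[of m "tid H" "tid H \<odot> tid H" m] by simp
    moreover have "(d \<odot> d) = (d \<odot> tid H \<odot> tid H) \<cdot> (tid H \<odot> d)"
      using interchange[of "tid H" d d "tid H \<odot> tid H"] by simp
    moreover have "\<Phi>\<^sub>1 x \<odot> tid H = (m \<odot> tid H \<odot> tid H) \<cdot> (tid H \<odot> x \<odot> tid H) \<cdot> (d \<odot> tid H \<odot> tid H)"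
      unfolding \<Phi>\<^sub>1_def
      using interchange[of "d \<odot> tid H" "tid H \<odot> x" "tid H" "tid H"]
        interchange[of "(tid H \<odot> x) \<cdot> (d \<odot> tid H)" "m \<odot> tid H" "tid H" "tid H"]
      by simp
    ultimately have "\<Phi> x = \<Phi>\<^sub>2 (\<Phi>\<^sub>1 x)"
      unfolding \<Phi>_def \<Phi>\<^sub>2_def by simp
    moreover have "\<Psi>\<^sub>2 (\<Phi>\<^sub>2 (\<Phi>\<^sub>1 x)) = \<Phi>\<^sub>1 x"
      unfolding \<Psi>\<^sub>2_def \<Phi>\<^sub>2_def
      by (rule antipode_cancel_right) (use assoc unit coassoc counit anti in simp_all)
    moreover have "\<Psi>\<^sub>1 (\<Phi>\<^sub>1 x) = x"
      unfolding \<Psi>\<^sub>1_def \<Phi>\<^sub>1_def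
      by (rule antipode_cancel_left) (use assoc unit coassoc counit anti in simp_all)
    ultimately show ?thesis by simp
  qed
  have "\<Phi> r = \<Phi> ?c"
  proof -
    let ?m = "tid H \<odot> ?c \<odot> tid H" and ?r = "tid H \<odot> r \<odot> tid H"
    have [simp]: "tar (\<Phi> r)" "dm (\<Phi> r) = H \<boxtimes> H" "cd (\<Phi> r) = H \<boxtimes> H"
      "tar (\<Phi> ?c)" "dm (\<Phi> ?c) = H \<boxtimes> H" "cd (\<Phi> ?c) = H \<boxtimes> H"
      unfolding \<Phi>_def by simp_all
    have br: "tbr (H \<boxtimes> H) (H \<boxtimes> H) \<cdot> ?r \<cdot> (d \<odot> d) = ?m \<cdot> (d \<odot> d)"
    proof -
      have "?m \<cdot> ?r = tid (H \<boxtimes> H \<boxtimes> H \<boxtimes> H)"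
        by (simp add: interchange rc)
      then have "?m \<cdot> ?r \<cdot> (d \<odot> d) = d \<odot> d"
        using tcomp_assoc[of "d \<odot> d" ?r ?m] by simp
      then have "tbr (H \<boxtimes> H) (H \<boxtimes> H) \<cdot> ?r \<cdot> (d \<odot> d) = ?m \<cdot> (?c \<odot> ?c) \<cdot> (d \<odot> d)"
        by (simp add: tbr_square)
      then show ?thesis by (simp add: interchange cocomm)
    qed
    \<comment> \<open>The outer crossing passes through \<open>m \<odot> m\<close> by naturality;
      one of the four crossings so obtained cancels \<open>r\<close>. What is left is
      \<open>\<Phi> ?c\<close>, that is \<open>d \<cdot> m\<close>, which is fixed by the braiding
      because \<open>d\<close> is.\<close>
    have "?c \<cdot> \<Phi> r = (?c \<cdot> (m \<odot> m)) \<cdot> ?r \<cdot> (d \<odot> d)"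
      unfolding \<Phi>_def by simp
    also have "?c \<cdot> (m \<odot> m) = (m \<odot> m) \<cdot> tbr (H \<boxtimes> H) (H \<boxtimes> H)"
      using tbr_natural[of m m H H] by simp
    also have "(\<dots>) \<cdot> ?r \<cdot> (d \<odot> d) = \<Phi> ?c"
      unfolding \<Phi>_def using br by simp
    also have "\<dots> = ?c \<cdot> \<Phi> ?c"
      using bialg cocomm tcomp_assoc[of m d ?c] unfolding \<Phi>_def by simp
    finally have "r \<cdot> ?c \<cdot> \<Phi> r = r \<cdot> ?c \<cdot> \<Phi> ?c" by simp
    then show ?thesis
      using tcomp_assoc[of "\<Phi> r" ?c r] tcomp_assoc[of "\<Phi> ?c" ?c r] rc by simp
  qed
  then have "\<Psi>\<^sub>1 (\<Psi>\<^sub>2 (\<Phi> r)) = \<Psi>\<^sub>1 (\<Psi>\<^sub>2 (\<Phi> ?c))"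
    by (rule arg_cong)
  moreover have "\<Psi>\<^sub>1 (\<Psi>\<^sub>2 (\<Phi> r)) = r" "\<Psi>\<^sub>1 (\<Psi>\<^sub>2 (\<Phi> ?c)) = ?c"
    by (rule \<Phi>_inv; simp)+
  ultimately have "r = ?c" by (simp only:)
  with rc show ?thesis by simp
qed

section \<open>Tensor products of algebras\<close>

text \<open>The mirror image of \<open>tensor_coassoc_typed\<close>. The algebra
  \<open>H \<boxtimes> H\<close> is where the comultiplicativity of the antipode will be
  decided.\<close>

lemma tensor_assoc_typed:
  assumes A: "A \<in> Ob C" "tar m" "dm m = A \<boxtimes> A" "cd m = A"
    and B: "B \<in> Ob C" "tar n" "dm n = B \<boxtimes> B" "cd n = B"
    and am: "m \<cdot> (tid A \<odot> m) = m \<cdot> (m \<odot> tid A)"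
    and an: "n \<cdot> (tid B \<odot> n) = n \<cdot> (n \<odot> tid B)"
  defines "M \<equiv> (m \<odot> n) \<cdot> (tid A \<odot> tbr B A \<odot> tid B)"
  shows "M \<cdot> (tid (A \<boxtimes> B) \<odot> M) = M \<cdot> (M \<odot> tid (A \<boxtimes> B))"
proof -
  note [simp] = A B
  let ?c = "tbr B A"
  let ?mm = "m \<cdot> (m \<odot> tid A)" and ?nn = "n \<cdot> (n \<odot> tid B)"
  have L: "M \<cdot> (M \<odot> tid (A \<boxtimes> B))
     = (?mm \<odot> ?nn) \<cdot> (tid A \<odot> ((tid A \<odot> tbr (B \<boxtimes> B) A) \<cdot> (?c \<odot> tid B \<odot> tid A)) \<odot> tid B)"
  proof -
    let ?X1 = "tid A \<odot> ?c \<odot> tid B \<odot> tid A \<odot> tid B" and ?X2 = "m \<odot> n \<odot> tid A \<odot> tid B"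
      and ?X3 = "tid A \<odot> ?c \<odot> tid B"
    let ?Y1 = "tid A \<odot> tid A \<odot> tbr (B \<boxtimes> B) A \<odot> tid B" and ?Y2 = "m \<odot> tid A \<odot> n \<odot> tid B"
    have 1: "M \<odot> tid (A \<boxtimes> B) = ?X2 \<cdot> ?X1"
      unfolding M_def
      using interchange[of "tid A \<odot> ?c \<odot> tid B" "m \<odot> n" "tid (A \<boxtimes> B)" "tid (A \<boxtimes> B)"]
      by (simp add: interchange)
    have "?X3 \<cdot> ?X2 = m \<odot> (?c \<cdot> (n \<odot> tid A)) \<odot> tid B"
      using interchange[of "n \<odot> tid A" ?c "tid B" "tid B"] by (simp add: interchange)
    also have "\<dots> = m \<odot> ((tid A \<odot> n) \<cdot> tbr (B \<boxtimes> B) A) \<odot> tid B"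
      using tbr_natural[of n "tid A" B A] by simp
    also have "\<dots> = ?Y2 \<cdot> ?Y1"
      using interchange[of "tid A \<odot> tid A" m "tbr (B \<boxtimes> B) A \<odot> tid B" "tid A \<odot> n \<odot> tid B"]
        interchange[of "tbr (B \<boxtimes> B) A" "tid A \<odot> n" "tid B" "tid B"]
      by simp
    finally have 2: "?X3 \<cdot> ?X2 = ?Y2 \<cdot> ?Y1" .
    have 3: "(m \<odot> n) \<cdot> ?Y2 = ?mm \<odot> ?nn"
      using interchange[of "m \<odot> tid A" m "n \<odot> tid B" n] by simp
    have 4: "?Y1 \<cdot> ?X1 = tid A \<odot> ((tid A \<odot> tbr (B \<boxtimes> B) A) \<cdot> (?c \<odot> tid B \<odot> tid A)) \<odot> tid B"
      using interchange[of "?c \<odot> tid B \<odot> tid A" "tid A \<odot> tbr (B \<boxtimes> B) A" "tid B" "tid B"]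
      by (simp add: interchange)
    have "M \<cdot> (M \<odot> tid (A \<boxtimes> B)) = (m \<odot> n) \<cdot> (?X3 \<cdot> ?X2) \<cdot> ?X1"
      unfolding 1 by (simp add: M_def)
    also have "\<dots> = ((m \<odot> n) \<cdot> ?Y2) \<cdot> (?Y1 \<cdot> ?X1)"
      unfolding 2 by simp
    finally show ?thesis unfolding 3 4 .
  qed
  have R: "M \<cdot> (tid (A \<boxtimes> B) \<odot> M)
     = ((m \<cdot> (tid A \<odot> m)) \<odot> (n \<cdot> (tid B \<odot> n)))
       \<cdot> (tid A \<odot> ((tbr B (A \<boxtimes> A) \<odot> tid B) \<cdot> (tid B \<odot> tid A \<odot> ?c)) \<odot> tid B)"
  proof -
    let ?X1 = "tid A \<odot> tid B \<odot> tid A \<odot> ?c \<odot> tid B" and ?X2 = "tid A \<odot> tid B \<odot> m \<odot> n"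
      and ?X3 = "tid A \<odot> ?c \<odot> tid B"
    let ?Y1 = "tid A \<odot> tbr B (A \<boxtimes> A) \<odot> tid B \<odot> tid B" and ?Y2 = "tid A \<odot> m \<odot> tid B \<odot> n"
    have 1: "tid (A \<boxtimes> B) \<odot> M = ?X2 \<cdot> ?X1"
      unfolding M_def
      using interchange[of "tid (A \<boxtimes> B)" "tid (A \<boxtimes> B)" "tid A \<odot> ?c \<odot> tid B" "m \<odot> n"]
      by (simp add: interchange)
    have "?X3 \<cdot> ?X2 = tid A \<odot> (?c \<cdot> (tid B \<odot> m)) \<odot> n"
      using interchange[of "tid B \<odot> m" ?c n "tid B"] by (simp add: interchange)
    also have "\<dots> = tid A \<odot> ((m \<odot> tid B) \<cdot> tbr B (A \<boxtimes> A)) \<odot> n"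
      using tbr_natural[of "tid B" m B A] by simp
    also have "\<dots> = ?Y2 \<cdot> ?Y1"
      using interchange[of "tbr B (A \<boxtimes> A)" "m \<odot> tid B" "tid B \<odot> tid B" n]
      by (simp add: interchange)
    finally have 2: "?X3 \<cdot> ?X2 = ?Y2 \<cdot> ?Y1" .
    have 3: "(m \<odot> n) \<cdot> ?Y2 = (m \<cdot> (tid A \<odot> m)) \<odot> (n \<cdot> (tid B \<odot> n))"
      using interchange[of "tid A \<odot> m" m "tid B \<odot> n" n] by simp
    have 4: "?Y1 \<cdot> ?X1
        = tid A \<odot> ((tbr B (A \<boxtimes> A) \<odot> tid B) \<cdot> (tid B \<odot> tid A \<odot> ?c)) \<odot> tid B"
      using interchange[of "tid B \<odot> tid A \<odot> ?c" "tbr B (A \<boxtimes> A) \<odot> tid B" "tid B" "tid B"]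
      by (simp add: interchange)
    have "M \<cdot> (tid (A \<boxtimes> B) \<odot> M) = (m \<odot> n) \<cdot> (?X3 \<cdot> ?X2) \<cdot> ?X1"
      unfolding 1 by (simp add: M_def)
    also have "\<dots> = ((m \<odot> n) \<cdot> ?Y2) \<cdot> (?Y1 \<cdot> ?X1)"
      unfolding 2 by simp
    finally show ?thesis unfolding 3 4 .
  qed
  have "(tid A \<odot> tbr (B \<boxtimes> B) A) \<cdot> (?c \<odot> tid B \<odot> tid A)
      = (tid A \<odot> ?c \<odot> tid B) \<cdot> ((tid A \<odot> tid B \<odot> ?c) \<cdot> (?c \<odot> tid B \<odot> tid A))"
    by (simp add: tbr_hex_left interchange2)
  also have "(tid A \<odot> tid B \<odot> ?c) \<cdot> (?c \<odot> tid B \<odot> tid A) = ?c \<odot> ?c"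
    using interchange[of ?c "tid A \<odot> tid B" "tid B \<odot> tid A" ?c] by simp
  also have "\<dots> = (?c \<odot> tid A \<odot> tid B) \<cdot> (tid B \<odot> tid A \<odot> ?c)"
    using interchange[of "tid B \<odot> tid A" ?c ?c "tid A \<odot> tid B"] by simp
  also have "(tid A \<odot> ?c \<odot> tid B) \<cdot> \<dots>
      = (tbr B (A \<boxtimes> A) \<odot> tid B) \<cdot> (tid B \<odot> tid A \<odot> ?c)"
    using interchange[of "?c \<odot> tid A" "tid A \<odot> ?c" "tid B" "tid B"]
    by (simp add: tbr_hex_right flip: tcomp_assoc)
  finally show ?thesis unfolding L R am an by simp
qed

text \<open>By naturality, a crossing with a unit morphism becomes a crossing with
  \<open>\<K>\<close>, which is an identity.\<close>

lemma tensor_unit_typed: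
  assumes A: "A \<in> Ob C" "tar m" "dm m = A \<boxtimes> A" "cd m = A" "tar e" "dm e = \<K>" "cd e = A"
    and B: "B \<in> Ob C" "tar n" "dm n = B \<boxtimes> B" "cd n = B" "tar i" "dm i = \<K>" "cd i = B"
    and um: "m \<cdot> (tid A \<odot> e) = tid A" "m \<cdot> (e \<odot> tid A) = tid A"
    and un: "n \<cdot> (tid B \<odot> i) = tid B" "n \<cdot> (i \<odot> tid B) = tid B"
  shows "(m \<odot> n) \<cdot> (tid A \<odot> tbr B A \<odot> tid B) \<cdot> (tid A \<odot> tid B \<odot> e \<odot> i) = tid (A \<boxtimes> B)"
    and "(m \<odot> n) \<cdot> (tid A \<odot> tbr B A \<odot> tid B) \<cdot> (e \<odot> i \<odot> tid A \<odot> tid B) = tid (A \<boxtimes> B)"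
proof -
  note [simp] = A B
  have "(tid A \<odot> tbr B A \<odot> tid B) \<cdot> (tid A \<odot> tid B \<odot> e \<odot> i) = tid A \<odot> (tbr B A \<cdot> (tid B \<odot> e)) \<odot> i"
    using interchange[of "tid B \<odot> e" "tbr B A" i "tid B"] by (simp add: interchange)
  also have "\<dots> = (tid A \<odot> e) \<odot> (tid B \<odot> i)"
    using tbr_natural[of "tid B" e B A] by simp
  finally show "(m \<odot> n) \<cdot> (tid A \<odot> tbr B A \<odot> tid B) \<cdot> (tid A \<odot> tid B \<odot> e \<odot> i) = tid (A \<boxtimes> B)"
    using interchange[of "tid A \<odot> e" m "tid B \<odot> i" n] um un by simp
  have "(tid A \<odot> tbr B A \<odot> tid B) \<cdot> (e \<odot> i \<odot> tid A \<odot> tid B) = e \<odot> (tbr B A \<cdot> (i \<odot> tid A)) \<odot> tid B"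
    using interchange[of "i \<odot> tid A" "tbr B A" "tid B" "tid B"]
      interchange[of e "tid A" "i \<odot> tid A \<odot> tid B" "tbr B A \<odot> tid B"] by simp
  also have "\<dots> = (e \<odot> tid A) \<odot> (i \<odot> tid B)"
    using tbr_natural[of i "tid A" B A] by simp
  finally show "(m \<odot> n) \<cdot> (tid A \<odot> tbr B A \<odot> tid B) \<cdot> (e \<odot> i \<odot> tid A \<odot> tid B) = tid (A \<boxtimes> B)"
    using interchange[of "e \<odot> tid A" m "i \<odot> tid B" n] um un by simp
qed

section \<open>Generalized elements\<close>

definition arr :: "'m \<Rightarrow> 'o \<Rightarrow> 'o \<Rightarrow> bool" where
  "arr f A B \<longleftrightarrow> A \<in> Ob C \<and> B \<in> Ob C \<and> f \<in> Hom C A B"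

lemma arrD: "arr f A B \<Longrightarrow> A \<in> Ob C" "arr f A B \<Longrightarrow> B \<in> Ob C" "arr f A B \<Longrightarrow> f \<in> Hom C A B"
  by (simp_all add: arr_def)

lemma tar_Tm [simp]: "tar (Tm A f B) \<longleftrightarrow> arr f A B"
  by (auto simp: tar_def arr_def simp del: tar_ob tar_hom)

lemma arr_id: "A \<in> Ob C \<Longrightarrow> arr (Idm C A) A A"
  by (simp add: arr_def id_hom)

lemma arr_comp: "\<lbrakk>arr f A B; arr g B D\<rbrakk> \<Longrightarrow> arr (g \<bullet> f) A D"
  by (auto simp: arr_def intro: comp_hom)

lemma arr_tens: "\<lbrakk>arr f A B; arr g D E\<rbrakk> \<Longrightarrow> arr (f \<otimes> g) (A \<boxtimes> D) (B \<boxtimes> E)"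
  by (auto simp: arr_def intro: tens_hom)

lemma arr_braid: "\<lbrakk>A \<in> Ob C; B \<in> Ob C\<rbrakk> \<Longrightarrow> arr (\<c> A B) (A \<boxtimes> B) (B \<boxtimes> A)"
  by (auto simp: arr_def intro: braid_hom)

lemma arr_assoc: "\<lbrakk>arr f A B; arr g B D; arr h D E\<rbrakk> \<Longrightarrow> (h \<bullet> g) \<bullet> f = h \<bullet> g \<bullet> f"
  unfolding arr_def by (rule comp_assoc[of A B D E]) auto

lemma arr_id_left: "arr f A B \<Longrightarrow> Idm C B \<bullet> f = f"
  unfolding arr_def by (rule comp_id_left[of A B]) auto

lemma arr_id_right: "arr f A B \<Longrightarrow> f \<bullet> Idm C A = f"
  unfolding arr_def by (rule comp_id_right[of A B]) auto

lemma arr_interchange: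
  "\<lbrakk>arr f A B; arr g B D; arr f' A' B'; arr g' B' D'\<rbrakk>
    \<Longrightarrow> (g \<otimes> g') \<bullet> (f \<otimes> f') = (g \<bullet> f) \<otimes> (g' \<bullet> f')"
  unfolding arr_def by (rule tens_comp[symmetric, of A B D A' B' D']) auto

lemma arr_tens_assoc:
  "\<lbrakk>arr f A B; arr g A' B'; arr h A'' B''\<rbrakk> \<Longrightarrow> (f \<otimes> g) \<otimes> h = f \<otimes> g \<otimes> h"
  unfolding arr_def by (rule tens_assoc[of A B A' B' A'' B'']) auto

lemma coalgD:
  assumes "is_coalgebra X"
  shows "obj X \<in> Ob C" "arr (counit X) (obj X) \<K>" "arr (comult X) (obj X) (obj X \<boxtimes> obj X)"
    "(Idm C (obj X) \<otimes> counit X) \<bullet> comult X = Idm C (obj X)"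
    "(counit X \<otimes> Idm C (obj X)) \<bullet> comult X = Idm C (obj X)"
    "(Idm C (obj X) \<otimes> comult X) \<bullet> comult X = (comult X \<otimes> Idm C (obj X)) \<bullet> comult X"
  using assms by (auto simp: is_coalgebra_def arr_def)

lemma algD:
  assumes "is_algebra A"
  shows "obj A \<in> Ob C" "arr (unit A) \<K> (obj A)" "arr (mult A) (obj A \<boxtimes> obj A) (obj A)"
    "mult A \<bullet> (Idm C (obj A) \<otimes> unit A) = Idm C (obj A)"
    "mult A \<bullet> (unit A \<otimes> Idm C (obj A)) = Idm C (obj A)"
    "mult A \<bullet> (Idm C (obj A) \<otimes> mult A) = mult A \<bullet> (mult A \<otimes> Idm C (obj A))"
  using assms by (auto simp: is_algebra_def arr_def)

lemma coalg_mor_arr: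
  "\<lbrakk>is_coalgebra X; is_coalgebra Y; coalg_mor X Y f\<rbrakk> \<Longrightarrow> arr f (obj X) (obj Y)"
  by (simp add: coalg_mor_def arr_def coalgD(1))

lemma coalg_mor_id: "is_coalgebra X \<Longrightarrow> coalg_mor X X (Idm C (obj X))"
  using coalgD[of X]
  by (auto simp: coalg_mor_def arrD arr_id_left[of _ "obj X" "obj X \<boxtimes> obj X"]
      arr_id_right[of _ "obj X" "obj X \<boxtimes> obj X"] arr_id_right[of _ "obj X" \<K>] tens_id id_hom)

lemma coalg_mor_comp:
  assumes X: "is_coalgebra X" and Y: "is_coalgebra Y" and Z: "is_coalgebra Z"
    and f: "coalg_mor X Y f" and g: "coalg_mor Y Z g"
  shows "coalg_mor X Z (g \<bullet> f)"
proof -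
  note af = coalg_mor_arr[OF X Y f] and ag = coalg_mor_arr[OF Y Z g]
  have "counit Z \<bullet> g \<bullet> f = counit X"
    using arr_assoc[OF af ag coalgD(2)[OF Z]] f g by (simp add: coalg_mor_def)
  moreover have "comult Z \<bullet> g \<bullet> f = ((g \<otimes> g) \<bullet> comult Y) \<bullet> f"
    using arr_assoc[OF af ag coalgD(3)[OF Z]] g by (simp add: coalg_mor_def)
  moreover have "\<dots> = (g \<otimes> g) \<bullet> (f \<otimes> f) \<bullet> comult X"
    using arr_assoc[OF af coalgD(3)[OF Y] arr_tens[OF ag ag]] f by (simp add: coalg_mor_def)
  moreover have "\<dots> = ((g \<bullet> f) \<otimes> (g \<bullet> f)) \<bullet> comult X"
    using arr_assoc[OF coalgD(3)[OF X] arr_tens[OF af af] arr_tens[OF ag ag]]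
      arr_interchange[OF af ag af ag] by simp
  ultimately show ?thesis
    using arr_comp[OF af ag] by (simp add: coalg_mor_def arr_def)
qed

lemma braid_unit: "A \<in> Ob C \<Longrightarrow> \<c> A \<K> = Idm C A" "A \<in> Ob C \<Longrightarrow> \<c> \<K> A = Idm C A"
  by (metis tbr_unit_right tmor_sel(9,12), metis tbr_unit_left tmor_sel(9,12))

section \<open>Pairs of generalized elements\<close>

text \<open>In Sweedler notation, \<open>x\<close> goes to f(x1) \<otimes> g(x2). For coalgebra
  morphisms out of a cocommutative \<open>X\<close> this is the pairing of a cartesian
  product.\<close>

definition pair :: "('o, 'm, 'x) algcoalg_scheme \<Rightarrow> 'm \<Rightarrow> 'm \<Rightarrow> 'm" where
  "pair X f g = (f \<otimes> g) \<bullet> comult X"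

lemma arr_pair:
  "\<lbrakk>is_coalgebra X; arr f (obj X) A; arr g (obj X) B\<rbrakk> \<Longrightarrow> arr (pair X f g) (obj X) (A \<boxtimes> B)"
  unfolding pair_def by (rule arr_comp[OF coalgD(3) arr_tens])

lemma tens_pair:
  assumes X: "is_coalgebra X" and f: "arr f (obj X) A" and g: "arr g (obj X) B"
    and u: "arr u A A'" and v: "arr v B B'"
  shows "(u \<otimes> v) \<bullet> pair X f g = pair X (u \<bullet> f) (v \<bullet> g)"
  unfolding pair_def
  using arr_assoc[OF coalgD(3)[OF X] arr_tens[OF f g] arr_tens[OF u v]]
    arr_interchange[OF f u g v] by simp

lemma pair_assoc:
  assumes X: "is_coalgebra X" and f: "arr f (obj X) A" and g: "arr g (obj X) B"
    and h: "arr h (obj X) D"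
  shows "pair X (pair X f g) h = pair X f (pair X g h)"
proof -
  let ?d = "comult X" and ?i = "Idm C (obj X)"
  note d = coalgD(3)[OF X] and i = arr_id[OF coalgD(1)[OF X]]
  have "pair X (pair X f g) h = (((f \<otimes> g) \<otimes> h) \<bullet> (?d \<otimes> ?i)) \<bullet> ?d"
    unfolding pair_def
    using arr_interchange[OF d arr_tens[OF f g] i h] arr_id_right[OF h] by simp
  also have "\<dots> = (f \<otimes> g \<otimes> h) \<bullet> (?d \<otimes> ?i) \<bullet> ?d"
    using arr_assoc[OF d arr_tens[OF d i] arr_tens[OF arr_tens[OF f g] h]]
      arr_tens_assoc[OF f g h] by simp
  also have "\<dots> = (f \<otimes> g \<otimes> h) \<bullet> (?i \<otimes> ?d) \<bullet> ?d"
    using coalgD(6)[OF X] by simp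
  also have "\<dots> = ((f \<otimes> g \<otimes> h) \<bullet> (?i \<otimes> ?d)) \<bullet> ?d"
    using arr_assoc[OF d arr_tens[OF i d] arr_tens[OF f arr_tens[OF g h], simplified]]
      coalgD(1)[OF X] by simp
  also have "\<dots> = pair X f (pair X g h)"
    unfolding pair_def
    using arr_interchange[OF i f d arr_tens[OF g h]] arr_id_right[OF f] by simp
  finally show ?thesis .
qed

lemma pair_counit_right:
  assumes X: "is_coalgebra X" and f: "arr f (obj X) A"
  shows "pair X f (counit X) = f"
proof -
  note n = coalgD(2)[OF X] and i = arr_id[OF coalgD(1)[OF X]]
  have "pair X f (counit X) = (f \<otimes> Idm C \<K>) \<bullet> pair X (Idm C (obj X)) (counit X)"
    using tens_pair[OF X i n f arr_id[OF unit_ob]] arr_id_left[OF n] arr_id_right[OF f] by simp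
  also have "\<dots> = f"
    using f coalgD(4)[OF X] arr_id_right[OF f]
    by (simp add: pair_def tens_unit(2)[of "obj X" A] arrD)
  finally show ?thesis .
qed

lemma pair_counit_left:
  assumes X: "is_coalgebra X" and f: "arr f (obj X) A"
  shows "pair X (counit X) f = f"
proof -
  note n = coalgD(2)[OF X] and i = arr_id[OF coalgD(1)[OF X]]
  have "pair X (counit X) f = (Idm C \<K> \<otimes> f) \<bullet> pair X (counit X) (Idm C (obj X))"
    using tens_pair[OF X n i arr_id[OF unit_ob] f] arr_id_left[OF n] arr_id_right[OF f] by simp
  also have "\<dots> = f"
    using f coalgD(5)[OF X] arr_id_right[OF f]
    by (simp add: pair_def tens_unit(1)[of "obj X" A] arrD)
  finally show ?thesis .
qed

lemma comult_coalg_mor: "coalg_mor X Y f \<Longrightarrow> comult Y \<bullet> f = pair X f f"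
  by (simp add: coalg_mor_def pair_def)

lemma counit_coalg_mor: "coalg_mor X Y f \<Longrightarrow> counit Y \<bullet> f = counit X"
  by (simp add: coalg_mor_def)

lemma pair_comp:
  assumes X: "is_coalgebra X" and Y: "is_coalgebra Y" and f: "arr f (obj Y) A"
    and g: "arr g (obj Y) B" and h: "coalg_mor X Y h"
  shows "pair Y f g \<bullet> h = pair X (f \<bullet> h) (g \<bullet> h)"
proof -
  note ah = coalg_mor_arr[OF X Y h]
  have "pair Y f g \<bullet> h = (f \<otimes> g) \<bullet> pair X h h"
    unfolding pair_def using arr_assoc[OF ah coalgD(3)[OF Y] arr_tens[OF f g]] h
    by (simp add: coalg_mor_def)
  also have "\<dots> = pair X (f \<bullet> h) (g \<bullet> h)"
    by (rule tens_pair[OF X ah ah f g])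
  finally show ?thesis .
qed

definition ccoalg :: "('o, 'm, 'x) algcoalg_scheme \<Rightarrow> bool" where
  "ccoalg X \<longleftrightarrow> is_coalgebra X \<and> cocommutative X"

lemma ccoalgD: "ccoalg X \<Longrightarrow> is_coalgebra X"
  by (simp add: ccoalg_def)

text \<open>Naturality moves the crossing to the two outputs of \<open>comult X\<close>, where
  cocommutativity absorbs it. On pairs the braiding is thus a mere exchange of entries.\<close>

lemma braid_pair:
  assumes X: "ccoalg X" and f: "arr f (obj X) A" and g: "arr g (obj X) B"
  shows "\<c> A B \<bullet> pair X f g = pair X g f"
proof -
  note X' = ccoalgD[OF X]
  have "\<c> A B \<bullet> pair X f g = (\<c> A B \<bullet> (f \<otimes> g)) \<bullet> comult X"
    unfolding pair_def
    using arr_assoc[OF coalgD(3)[OF X'] arr_tens[OF f g] arr_braid] f g by (simp add: arrD)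
  also have "\<dots> = ((g \<otimes> f) \<bullet> \<c> (obj X) (obj X)) \<bullet> comult X"
    using braid_natural[of "obj X" A "obj X" B f g] f g by (simp add: arrD)
  also have "\<dots> = pair X g f"
    unfolding pair_def
    using arr_assoc[OF coalgD(3)[OF X'] arr_braid arr_tens[OF g f]] X X' coalgD(1)[OF X']
    by (simp add: ccoalg_def cocommutative_def)
  finally show ?thesis .
qed

text \<open>By coassociativity of pairing, \<open>g\<close> and \<open>h\<close> become neighbours;
  they are exchanged, and the brackets are restored.\<close>

lemma shuffle_pair:
  assumes X: "ccoalg X" and f: "arr f (obj X) A" and g: "arr g (obj X) B"
    and h: "arr h (obj X) D" and k: "arr k (obj X) E"
  shows "(Idm C A \<otimes> \<c> B D \<otimes> Idm C E) \<bullet> pair X (pair X f g) (pair X h k)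
    = pair X (pair X f h) (pair X g k)"
proof -
  note X' = ccoalgD[OF X]
  have regroup: "pair X (pair X f g) (pair X h k) = pair X f (pair X (pair X g h) k)"
    if "arr g (obj X) B" "arr h (obj X) D" for g h B D
    using pair_assoc[OF X' f that(1) arr_pair[OF X' that(2) k]] pair_assoc[OF X' that k]
    by simp
  note gh = arr_pair[OF X' g h] and c = arr_braid[OF arrD(2)[OF g] arrD(2)[OF h]]
    and iA = arr_id[OF arrD(2)[OF f]] and iE = arr_id[OF arrD(2)[OF k]]
  have "(Idm C A \<otimes> \<c> B D \<otimes> Idm C E) \<bullet> pair X f (pair X (pair X g h) k)
      = pair X f (pair X (pair X h g) k)"
    using tens_pair[OF X' f arr_pair[OF X' gh k] iA arr_tens[OF c iE]] tens_pair[OF X' gh k c iE]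
      arr_id_left[OF f] arr_id_left[OF k] braid_pair[OF X g h] by simp
  then show ?thesis
    using regroup[OF g h] regroup[OF h g] by simp
qed

text \<open>Comultiplying each entry gives the pairs \<open>(f, f)\<close> and
  \<open>(g, g)\<close>, and the crossing in the comultiplication of \<open>tensor A B\<close>
  rearranges them into two copies of \<open>(f, g)\<close>.\<close>

lemma coalg_mor_pair:
  assumes X: "ccoalg X" and A: "is_coalgebra A" and B: "is_coalgebra B"
    and f: "coalg_mor X A f" and g: "coalg_mor X B g"
  shows "coalg_mor X (tensor A B) (pair X f g)"
proof -
  note X' = ccoalgD[OF X]
  note af = coalg_mor_arr[OF X' A f] and ag = coalg_mor_arr[OF X' B g]
  have "pair X f g \<in> Hom C (obj X) (obj (tensor A B))"
    using arrD(3)[OF arr_pair[OF X' af ag]] by (simp add: tensor_def)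
  moreover have "counit (tensor A B) \<bullet> pair X f g = counit X"
    using tens_pair[OF X' af ag coalgD(2)[OF A] coalgD(2)[OF B]]
      pair_counit_right[OF X' coalgD(2)[OF X']] f g
    by (simp add: tensor_def counit_coalg_mor)
  moreover have "comult (tensor A B) \<bullet> pair X f g = pair X (pair X f g) (pair X f g)"
  proof -
    let ?s = "Idm C (obj A) \<otimes> \<c> (obj A) (obj B) \<otimes> Idm C (obj B)"
    have s: "arr ?s ((obj A \<boxtimes> obj A) \<boxtimes> (obj B \<boxtimes> obj B)) ((obj A \<boxtimes> obj B) \<boxtimes> (obj A \<boxtimes> obj B))"
      using arr_tens[OF arr_id arr_tens[OF arr_braid arr_id]] coalgD(1)[OF A] coalgD(1)[OF B]
      by simp
    have "comult (tensor A B) \<bullet> pair X f g = ?s \<bullet> (comult A \<otimes> comult B) \<bullet> pair X f g"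
      using arr_assoc[OF arr_pair[OF X' af ag] arr_tens[OF coalgD(3)[OF A] coalgD(3)[OF B]] s]
      by (simp add: tensor_def)
    also have "\<dots> = ?s \<bullet> pair X (pair X f f) (pair X g g)"
      using tens_pair[OF X' af ag coalgD(3)[OF A] coalgD(3)[OF B]] f g
      by (simp add: comult_coalg_mor)
    also have "\<dots> = pair X (pair X f g) (pair X f g)"
      by (rule shuffle_pair[OF X af af ag ag])
    finally show ?thesis .
  qed
  ultimately show ?thesis
    unfolding coalg_mor_def by (simp add: pair_def)
qed

section \<open>Tensor coalgebras and their projections\<close>

abbreviation proj1 :: "('o, 'm, 'x) algcoalg_scheme \<Rightarrow> ('o, 'm, 'y) algcoalg_scheme \<Rightarrow> 'm" where
  "proj1 A B \<equiv> Idm C (obj A) \<otimes> counit B"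

abbreviation proj2 :: "('o, 'm, 'x) algcoalg_scheme \<Rightarrow> ('o, 'm, 'y) algcoalg_scheme \<Rightarrow> 'm" where
  "proj2 A B \<equiv> counit A \<otimes> Idm C (obj B)"

context
  fixes A :: "('o, 'm, 'x) algcoalg_scheme" and B :: "('o, 'm, 'y) algcoalg_scheme"
  assumes A: "is_coalgebra A" and B: "is_coalgebra B"
begin

private abbreviation "a \<equiv> Tm (obj A) (comult A) (obj A \<boxtimes> obj A)"
private abbreviation "b \<equiv> Tm (obj B) (comult B) (obj B \<boxtimes> obj B)"
private abbreviation "na \<equiv> Tm (obj A) (counit A) \<K>"
private abbreviation "nb \<equiv> Tm (obj B) (counit B) \<K>"
private abbreviation "D \<equiv> (tid (obj A) \<odot> tbr (obj A) (obj B) \<odot> tid (obj B)) \<cdot> (a \<odot> b)"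

private lemma typed [simp]:
  "obj A \<in> Ob C" "obj B \<in> Ob C" "arr (comult A) (obj A) (obj A \<boxtimes> obj A)"
  "arr (comult B) (obj B) (obj B \<boxtimes> obj B)" "arr (counit A) (obj A) \<K>" "arr (counit B) (obj B) \<K>"
  "(tid (obj A) \<odot> na) \<cdot> a = tid (obj A)" "(na \<odot> tid (obj A)) \<cdot> a = tid (obj A)"
  "(tid (obj B) \<odot> nb) \<cdot> b = tid (obj B)" "(nb \<odot> tid (obj B)) \<cdot> b = tid (obj B)"
  using coalgD[OF A] coalgD[OF B] by (auto intro!: tmor_eqI)

private lemma typed_coassoc:
  "(tid (obj A) \<odot> a) \<cdot> a = (a \<odot> tid (obj A)) \<cdot> a" "(tid (obj B) \<odot> b) \<cdot> b = (b \<odot> tid (obj B)) \<cdot> b"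
  using coalgD[OF A] coalgD[OF B] by (auto intro!: tmor_eqI)

private lemma D_mo: "comult (tensor A B) = mo D"
  by (simp add: tensor_def)

private lemma pair_tensor:
  assumes "arr x (obj A) X" "arr u (obj A) U" "arr v (obj B) V" "arr y (obj B) Y"
  shows "((x \<otimes> v) \<otimes> (u \<otimes> y)) \<bullet> comult (tensor A B)
    = (Idm C X \<otimes> \<c> U V \<otimes> Idm C Y) \<bullet> (((x \<otimes> u) \<bullet> comult A) \<otimes> ((v \<otimes> y) \<bullet> comult B))"
  using arg_cong[OF tensor_pair_typed[of "obj A" a "obj B" b "Tm (obj A) x X" X "Tm (obj A) u U" U
      "Tm (obj B) v V" V "Tm (obj B) y Y" Y], of mo] assms
    arr_tens_assoc[OF assms(1,3) arr_tens[OF assms(2,4)]]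
  by (simp add: D_mo)

lemma is_coalgebra_tensor: "is_coalgebra (tensor A B)"
proof -
  have ar: "arr (comult (tensor A B)) (obj A \<boxtimes> obj B) (obj A \<boxtimes> obj B \<boxtimes> obj A \<boxtimes> obj B)"
  proof -
    have "tar D" by simp
    from tar_hom[OF this refl refl] show ?thesis by (simp add: D_mo arr_def)
  qed
  have co: "(Idm C (obj A \<boxtimes> obj B) \<otimes> comult (tensor A B)) \<bullet> comult (tensor A B)
      = (comult (tensor A B) \<otimes> Idm C (obj A \<boxtimes> obj B)) \<bullet> comult (tensor A B)"
    using arg_cong[OF tensor_coassoc_typed[OF _ _ _ _ _ _ _ _ typed_coassoc], of mo]
    by (simp add: D_mo del: tcomp_assoc ttens_assoc tid_split)
  have "(Idm C (obj A \<boxtimes> obj B) \<otimes> (counit A \<otimes> counit B)) \<bullet> comult (tensor A B)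
      = Idm C (obj A \<boxtimes> obj B)"
    using pair_tensor[of "Idm C (obj A)" "obj A" "counit A" \<K> "Idm C (obj B)" "obj B" "counit B" \<K>]
      coalgD[OF A] coalgD[OF B]
    by (simp add: braid_unit arr_id tens_id tens_unit[of \<K> \<K>] tens_unit[of "obj B" "obj B"]
        id_hom comp_id_left[of "obj A \<boxtimes> obj B" "obj A \<boxtimes> obj B"])
  moreover have "((counit A \<otimes> counit B) \<otimes> Idm C (obj A \<boxtimes> obj B)) \<bullet> comult (tensor A B)
      = Idm C (obj A \<boxtimes> obj B)"
    using pair_tensor[of "counit A" \<K> "Idm C (obj A)" "obj A" "counit B" \<K> "Idm C (obj B)" "obj B"]
      coalgD[OF A] coalgD[OF B]
    by (simp add: braid_unit arr_id tens_id tens_unit[of "obj A \<boxtimes> obj B" "obj A \<boxtimes> obj B"]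
        id_hom comp_id_left[of "obj A \<boxtimes> obj B" "obj A \<boxtimes> obj B"])
  ultimately show ?thesis
    using ar co arrD(3)[OF arr_tens[OF coalgD(2)[OF A] coalgD(2)[OF B]]]
    unfolding is_coalgebra_def by (simp add: arr_def tensor_def)
qed

lemma coalg_mor_proj1: "coalg_mor (tensor A B) A (proj1 A B)"
proof -
  note dA = coalgD[OF A] and dB = coalgD[OF B]
  note p = arr_tens[OF arr_id[OF dA(1)] dB(2), simplified tens_ob_unit(2)[OF dA(1)]]
  have "comult A \<bullet> proj1 A B = comult A \<otimes> counit B"
    using arr_interchange[OF arr_id[OF dA(1)] dA(3) dB(2) arr_id[OF unit_ob]] dA
    by (simp add: arr_id_right[OF dA(3)] arr_id_left[OF dB(2)]
        tens_unit(2)[of "obj A" "obj A \<boxtimes> obj A"] arrD)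
  moreover have "(proj1 A B \<otimes> proj1 A B) \<bullet> comult (tensor A B) = comult A \<otimes> counit B"
    using pair_tensor[OF arr_id arr_id dB(2) dB(2)] dA dB
      pair_counit_right[OF B dB(2)]
      arr_id_left[OF arr_tens[OF dA(3) dB(2)]] arr_id_left[OF dA(3)]
    by (simp add: braid_unit tens_id pair_def[symmetric])
  moreover have "counit A \<bullet> proj1 A B = counit A \<otimes> counit B"
    using arr_interchange[OF arr_id[OF dA(1)] dA(2) dB(2) arr_id[OF unit_ob]] dA
    by (simp add: arr_id_right[OF dA(2)] arr_id_left[OF dB(2)]
        tens_unit(2)[of "obj A" \<K>] arrD)
  ultimately show ?thesis
    using arrD(3)[OF p] unfolding coalg_mor_def by (simp add: tensor_def)
qed

lemma coalg_mor_proj2: "coalg_mor (tensor A B) B (proj2 A B)"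
proof -
  note dA = coalgD[OF A] and dB = coalgD[OF B]
  note p = arr_tens[OF dA(2) arr_id[OF dB(1)], simplified tens_ob_unit(1)[OF dB(1)]]
  have "comult B \<bullet> proj2 A B = counit A \<otimes> comult B"
    using arr_interchange[OF dA(2) arr_id[OF unit_ob] arr_id[OF dB(1)] dB(3)] dB
    by (simp add: arr_id_right[OF dB(3)] arr_id_left[OF dA(2)]
        tens_unit(1)[of "obj B" "obj B \<boxtimes> obj B"] arrD)
  moreover have "(proj2 A B \<otimes> proj2 A B) \<bullet> comult (tensor A B) = counit A \<otimes> comult B"
    using pair_tensor[OF dA(2) dA(2) arr_id arr_id] dA dB
      pair_counit_right[OF A dA(2)]
      arr_id_left[OF arr_tens[OF dA(2) dB(3)]] arr_id_left[OF dB(3)]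
    by (simp add: braid_unit tens_id tens_unit[of "obj B \<boxtimes> obj B" "obj B \<boxtimes> obj B"] id_hom pair_def[symmetric])
  moreover have "counit B \<bullet> proj2 A B = counit A \<otimes> counit B"
    using arr_interchange[OF dA(2) arr_id[OF unit_ob] arr_id[OF dB(1)] dB(2)] dB
    by (simp add: arr_id_right[OF dB(2)] arr_id_left[OF dA(2)]
        tens_unit(1)[of "obj B" \<K>] arrD)
  ultimately show ?thesis
    using arrD(3)[OF p] unfolding coalg_mor_def by (simp add: tensor_def)
qed

text \<open>The two inner legs end in counits, so the only crossing is that of \<open>\<K>\<close>
  with itself. It makes the projections the universal pair of elements: an equation checked at them
  holds as an equation of morphisms.\<close>

lemma pair_proj: "pair (tensor A B) (proj1 A B) (proj2 A B) = Idm C (obj A \<boxtimes> obj B)"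
  unfolding pair_def
  using pair_tensor[of "Idm C (obj A)" "obj A" "counit A" \<K> "counit B" \<K> "Idm C (obj B)" "obj B"]
    coalgD[OF A] coalgD[OF B] by (simp add: braid_unit arr_id tens_id tens_unit[of "obj B" "obj B"] id_hom
      comp_id_left[of "obj A \<boxtimes> obj B" "obj A \<boxtimes> obj B"])

lemma cocommutative_tensor:
  assumes "cocommutative A" "cocommutative B"
    and "\<c> (obj B) (obj A) \<bullet> \<c> (obj A) (obj B) = Idm C (obj A \<boxtimes> obj B)"
  shows "cocommutative (tensor A B)"
proof -
  have "tbr (obj A) (obj A) \<cdot> a = a" "tbr (obj B) (obj B) \<cdot> b = b"
    "tbr (obj B) (obj A) \<cdot> tbr (obj A) (obj B) = tid (obj A \<boxtimes> obj B)"
    using assms coalgD(1)[OF A] coalgD(1)[OF B]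
    by (auto simp: cocommutative_def tens_id intro!: tmor_eqI)
  from arg_cong[OF tensor_cocomm_typed[OF _ _ _ _ _ _ _ _ this], of mo]
  show ?thesis
    by (simp add: cocommutative_def tensor_def)
qed

end

lemma is_algebra_tensor:
  assumes A: "is_algebra A" and B: "is_algebra B"
  shows "is_algebra (tensor A B)"
proof -
  define m n where "m = Tm (obj A \<boxtimes> obj A) (mult A) (obj A)"
    and "n = Tm (obj B \<boxtimes> obj B) (mult B) (obj B)"
  define e i where "e = Tm \<K> (unit A) (obj A)" and "i = Tm \<K> (unit B) (obj B)"
  note dA = algD[OF A] and dB = algD[OF B]
  have [simp]: "obj A \<in> Ob C" "obj B \<in> Ob C" by (fact dA(1) dB(1))+
  have [simp]: "tar m" "dm m = obj A \<boxtimes> obj A" "cd m = obj A" "tar n" "dm n = obj B \<boxtimes> obj B"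
    "cd n = obj B" "tar e" "dm e = \<K>" "cd e = obj A" "tar i" "dm i = \<K>" "cd i = obj B"
    and mo: "mo m = mult A" "mo n = mult B" "mo e = unit A" "mo i = unit B"
    using dA dB by (simp_all add: m_def n_def e_def i_def)
  have eqs: "m \<cdot> (tid (obj A) \<odot> m) = m \<cdot> (m \<odot> tid (obj A))"
    "n \<cdot> (tid (obj B) \<odot> n) = n \<cdot> (n \<odot> tid (obj B))"
    "m \<cdot> (tid (obj A) \<odot> e) = tid (obj A)" "m \<cdot> (e \<odot> tid (obj A)) = tid (obj A)"
    "n \<cdot> (tid (obj B) \<odot> i) = tid (obj B)" "n \<cdot> (i \<odot> tid (obj B)) = tid (obj B)"
    using dA dB mo by (auto intro!: tmor_eqI)
  let ?M = "(m \<odot> n) \<cdot> (tid (obj A) \<odot> tbr (obj B) (obj A) \<odot> tid (obj B))"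
  have M: "mult (tensor A B) = mo ?M"
    by (simp add: tensor_def mo)
  have "tar ?M" by simp
  then have "mult (tensor A B) \<in> Hom C (obj A \<boxtimes> obj B \<boxtimes> obj A \<boxtimes> obj B) (obj A \<boxtimes> obj B)"
    unfolding M by (rule tar_hom) simp_all
  moreover have "mult (tensor A B) \<bullet> (Idm C (obj A \<boxtimes> obj B) \<otimes> mult (tensor A B))
      = mult (tensor A B) \<bullet> (mult (tensor A B) \<otimes> Idm C (obj A \<boxtimes> obj B))"
    using arg_cong[OF tensor_assoc_typed[OF _ _ _ _ _ _ _ _ eqs(1,2)], of mo]
    unfolding M by (simp del: tcomp_assoc ttens_assoc tid_split)
  moreover have "mult (tensor A B) \<bullet> (Idm C (obj A \<boxtimes> obj B) \<otimes> unit A \<otimes> unit B)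
      = Idm C (obj A \<boxtimes> obj B)"
  proof -
    have "?M \<cdot> (tid (obj A) \<odot> tid (obj B) \<odot> e \<odot> i) = tid (obj A \<boxtimes> obj B)"
      using tensor_unit_typed(1)[OF _ _ _ _ _ _ _ _ _ _ _ _ _ _ eqs(3-6)] by simp
    then have "mo (?M \<cdot> (tid (obj A) \<odot> tid (obj B) \<odot> e \<odot> i)) = mo (tid (obj A \<boxtimes> obj B))"
      by (rule arg_cong)
    moreover have "mo (tid (obj A) \<odot> tid (obj B) \<odot> e \<odot> i)
        = Idm C (obj A \<boxtimes> obj B) \<otimes> unit A \<otimes> unit B"
      using arr_tens_assoc[OF arr_id arr_id arr_tens[OF dA(2) dB(2)]] dA(1) dB(1)
      by (simp add: mo tens_id)
    ultimately show ?thesis unfolding M by (simp del: tcomp_assoc ttens_assoc tid_split)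
  qed
  moreover have "mult (tensor A B) \<bullet> ((unit A \<otimes> unit B) \<otimes> Idm C (obj A \<boxtimes> obj B))
      = Idm C (obj A \<boxtimes> obj B)"
  proof -
    have "?M \<cdot> (e \<odot> i \<odot> tid (obj A) \<odot> tid (obj B)) = tid (obj A \<boxtimes> obj B)"
      using tensor_unit_typed(2)[OF _ _ _ _ _ _ _ _ _ _ _ _ _ _ eqs(3-6)] by simp
    then have "mo (?M \<cdot> (e \<odot> i \<odot> tid (obj A) \<odot> tid (obj B))) = mo (tid (obj A \<boxtimes> obj B))"
      by (rule arg_cong)
    moreover have "mo (e \<odot> i \<odot> tid (obj A) \<odot> tid (obj B))
        = (unit A \<otimes> unit B) \<otimes> Idm C (obj A \<boxtimes> obj B)"
      using arr_tens_assoc[OF dA(2) dB(2) arr_id[of "obj A \<boxtimes> obj B"]] dA(1) dB(1)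
      by (simp add: mo tens_id)
    ultimately show ?thesis unfolding M by (simp del: tcomp_assoc ttens_assoc tid_split)
  qed
  ultimately show ?thesis
    using arrD(3)[OF arr_tens[OF dA(2) dB(2)]]
    by (simp add: is_algebra_def tensor_def)
qed

section \<open>Convolution groups\<close>

lemma hopf_alg: "is_hopf H \<Longrightarrow> is_algebra H"
  by (simp add: is_hopf_def)

lemma hopf_coalg: "is_hopf H \<Longrightarrow> is_coalgebra H"
  by (simp add: is_hopf_def)

lemma arr_antipode: "is_hopf H \<Longrightarrow> arr (antipode H) (obj H) (obj H)"
  unfolding is_hopf_def is_coalgebra_def arr_def by blast

lemma hopf_mor_axioms:
  assumes "is_hopf H"
  shows "alg_mor H unit_algcoalg (counit H)" "alg_mor H (tensor H H) (comult H)"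
  using assms unfolding is_hopf_def by blast+

lemma hopf_antipode:
  assumes "is_hopf H"
  shows "mult H \<bullet> (Idm C (obj H) \<otimes> antipode H) \<bullet> comult H = unit H \<bullet> counit H"
    "mult H \<bullet> (antipode H \<otimes> Idm C (obj H)) \<bullet> comult H = unit H \<bullet> counit H"
  using assms unfolding is_hopf_def by blast+

lemma hopf_unit:
  assumes "is_hopf H"
  shows "counit H \<bullet> unit H = Idm C \<K>" "comult H \<bullet> unit H = unit H \<otimes> unit H"
  using hopf_mor_axioms[OF assms] by (simp_all add: alg_mor_def unit_algcoalg_def tensor_def)

lemma arr_shuffle:
  "\<lbrakk>A \<in> Ob C; B \<in> Ob C; D \<in> Ob C; E \<in> Ob C\<rbrakk>
    \<Longrightarrow> arr (Idm C A \<otimes> \<c> B D \<otimes> Idm C E) ((A \<boxtimes> B) \<boxtimes> D \<boxtimes> E) ((A \<boxtimes> D) \<boxtimes> B \<boxtimes> E)"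
  using arr_tens[OF arr_id arr_tens[OF arr_braid arr_id], of A B D E] by simp

text \<open>The bialgebra axioms are symmetric: \<open>is_hopf\<close> states them as counit and
  comultiplication being algebra morphisms, and two of the resulting equations are the
  claim.\<close>

lemma coalg_mor_mult:
  assumes H: "is_hopf H"
  shows "coalg_mor (tensor H H) H (mult H)"
proof -
  note dA = algD[OF hopf_alg[OF H]] and dC = coalgD[OF hopf_coalg[OF H]]
  note s = arr_shuffle[OF dA(1) dA(1) dA(1) dA(1)]
  have "comult H \<bullet> mult H = (mult H \<otimes> mult H) \<bullet> comult (tensor H H)"
    using arr_assoc[OF arr_tens[OF dC(3) dC(3)] s arr_tens[OF dA(3) dA(3)]] hopf_mor_axioms(2)[OF H]
    by (simp add: alg_mor_def tensor_def)
  moreover have "counit H \<bullet> mult H = counit H \<otimes> counit H"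
    using hopf_mor_axioms(1)[OF H] arr_id_left[OF arr_tens[OF dC(2) dC(2)]]
    by (simp add: alg_mor_def unit_algcoalg_def)
  ultimately show ?thesis
    using arrD(3)[OF dA(3)] by (simp add: coalg_mor_def tensor_def)
qed

definition conv :: "('o, 'm, 'x) algcoalg_scheme \<Rightarrow> ('o, 'm, 'y) algcoalg_scheme \<Rightarrow> 'm \<Rightarrow> 'm \<Rightarrow> 'm" where
  "conv X A f g = mult A \<bullet> pair X f g"

definition conv_unit :: "('o, 'm, 'x) algcoalg_scheme \<Rightarrow> ('o, 'm, 'y) algcoalg_scheme \<Rightarrow> 'm" where
  "conv_unit X A = unit A \<bullet> counit X"

lemma arr_conv_unit:
  "\<lbrakk>is_coalgebra X; is_algebra A\<rbrakk> \<Longrightarrow> arr (conv_unit X A) (obj X) (obj A)"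
  unfolding conv_unit_def by (rule arr_comp[OF coalgD(2) algD(2)])

lemma conv_assoc:
  assumes X: "is_coalgebra X" and A: "is_algebra A" and f: "arr f (obj X) (obj A)"
    and g: "arr g (obj X) (obj A)" and h: "arr h (obj X) (obj A)"
  shows "conv X A (conv X A f g) h = conv X A f (conv X A g h)"
proof -
  note m = algD(3)[OF A] and i = arr_id[OF algD(1)[OF A]]
  note fg = arr_pair[OF X f g] and gh = arr_pair[OF X g h]
  have "conv X A (conv X A f g) h = mult A \<bullet> (mult A \<otimes> Idm C (obj A)) \<bullet> pair X (pair X f g) h"
    unfolding conv_def using tens_pair[OF X fg h m i] arr_id_left[OF h] by simp
  also have "\<dots> = (mult A \<bullet> (mult A \<otimes> Idm C (obj A))) \<bullet> pair X (pair X f g) h"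
    using arr_assoc[OF arr_pair[OF X fg h] arr_tens[OF m i] m] by simp
  also have "\<dots> = (mult A \<bullet> (Idm C (obj A) \<otimes> mult A)) \<bullet> pair X f (pair X g h)"
    using algD(6)[OF A] pair_assoc[OF X f g h] by simp
  also have "\<dots> = mult A \<bullet> (Idm C (obj A) \<otimes> mult A) \<bullet> pair X f (pair X g h)"
    using arr_assoc[OF arr_pair[OF X f gh] arr_tens[OF i m] m] by simp
  also have "\<dots> = conv X A f (conv X A g h)"
    unfolding conv_def using tens_pair[OF X f gh i m] arr_id_left[OF f] by simp
  finally show ?thesis .
qed

lemma conv_unit_left:
  assumes X: "is_coalgebra X" and A: "is_algebra A" and f: "arr f (obj X) (obj A)"
  shows "conv X A (conv_unit X A) f = f"
proof -
  note m = algD(3)[OF A] and i = arr_id[OF algD(1)[OF A]] and e = algD(2)[OF A]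
  note n = coalgD(2)[OF X]
  have "pair X (conv_unit X A) f = (unit A \<otimes> Idm C (obj A)) \<bullet> f"
    unfolding conv_unit_def
    using tens_pair[OF X n f e i] arr_id_left[OF f] pair_counit_left[OF X f] by simp
  then show ?thesis
    unfolding conv_def
    using arr_assoc[OF _ arr_tens[OF e i] m] algD(1,5)[OF A] f arr_id_left[OF f] by simp
qed

lemma conv_unit_right:
  assumes X: "is_coalgebra X" and A: "is_algebra A" and f: "arr f (obj X) (obj A)"
  shows "conv X A f (conv_unit X A) = f"
proof -
  note m = algD(3)[OF A] and i = arr_id[OF algD(1)[OF A]] and e = algD(2)[OF A]
  note n = coalgD(2)[OF X]
  have "pair X f (conv_unit X A) = (Idm C (obj A) \<otimes> unit A) \<bullet> f"
    unfolding conv_unit_def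
    using tens_pair[OF X f n i e] arr_id_left[OF f] pair_counit_right[OF X f] by simp
  then show ?thesis
    unfolding conv_def
    using arr_assoc[OF _ arr_tens[OF i e] m] algD(1,4)[OF A] f arr_id_left[OF f] by simp
qed

lemma coalg_mor_conv:
  assumes X: "ccoalg X" and H: "is_hopf H" and f: "coalg_mor X H f" and g: "coalg_mor X H g"
  shows "coalg_mor X H (conv X H f g)"
proof -
  note H' = hopf_coalg[OF H]
  show ?thesis
    unfolding conv_def
    by (rule coalg_mor_comp[OF ccoalgD[OF X] is_coalgebra_tensor[OF H' H'] H'
          coalg_mor_pair[OF X H' H' f g] coalg_mor_mult[OF H]])
qed

lemma coalg_mor_conv_unit:
  assumes X: "is_coalgebra X" and H: "is_hopf H"
  shows "coalg_mor X H (conv_unit X H)"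
proof -
  note dA = algD[OF hopf_alg[OF H]] and dC = coalgD[OF hopf_coalg[OF H]] and n = coalgD(2)[OF X]
  have "counit H \<bullet> conv_unit X H = counit X"
    unfolding conv_unit_def
    using arr_assoc[OF n dA(2) dC(2)] hopf_unit[OF H] arr_id_left[OF n] by simp
  moreover have "comult H \<bullet> conv_unit X H = (unit H \<otimes> unit H) \<bullet> counit X"
    unfolding conv_unit_def using arr_assoc[OF n dA(2) dC(3)] hopf_unit[OF H] by simp
  moreover have "(unit H \<otimes> unit H) \<bullet> counit X = pair X (conv_unit X H) (conv_unit X H)"
    unfolding conv_unit_def
    using tens_pair[OF X n n dA(2) dA(2)] pair_counit_right[OF X n] by simp
  ultimately show ?thesis
    using arrD(3)[OF arr_conv_unit[OF X hopf_alg[OF H]]] by (simp add: coalg_mor_def pair_def)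
qed

lemma conv_antipode:
  assumes X: "is_coalgebra X" and H: "is_hopf H" and f: "coalg_mor X H f"
  shows "conv X H (antipode H \<bullet> f) f = conv_unit X H"
    and "conv X H f (antipode H \<bullet> f) = conv_unit X H"
proof -
  note dA = algD[OF hopf_alg[OF H]] and dC = coalgD[OF hopf_coalg[OF H]]
    and l = arr_antipode[OF H] and i = arr_id[OF algD(1)[OF hopf_alg[OF H]]]
    and af = coalg_mor_arr[OF X hopf_coalg[OF H] f]
  have *: "mult H \<bullet> pair X (u \<bullet> f) (v \<bullet> f) = conv_unit X H"
    if u: "arr u (obj H) (obj H)" and v: "arr v (obj H) (obj H)"
      and uv: "mult H \<bullet> (u \<otimes> v) \<bullet> comult H = unit H \<bullet> counit H" for u v
  proof -
    note t = arr_tens[OF u v]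
    have "mult H \<bullet> pair X (u \<bullet> f) (v \<bullet> f) = mult H \<bullet> (u \<otimes> v) \<bullet> comult H \<bullet> f"
      using tens_pair[OF X af af u v] f by (simp add: comult_coalg_mor)
    also have "\<dots> = (mult H \<bullet> (u \<otimes> v) \<bullet> comult H) \<bullet> f"
      using arr_assoc[OF af arr_comp[OF dC(3) t] dA(3)] arr_assoc[OF af dC(3) t] by simp
    also have "\<dots> = conv_unit X H"
      unfolding uv conv_unit_def using arr_assoc[OF af dC(2) dA(2)] f
      by (simp add: counit_coalg_mor)
    finally show ?thesis .
  qed
  show "conv X H (antipode H \<bullet> f) f = conv_unit X H"
    using *[OF l i hopf_antipode(2)[OF H]] arr_id_left[OF af] by (simp add: conv_def)
  show "conv X H f (antipode H \<bullet> f) = conv_unit X H"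
    using *[OF i l hopf_antipode(1)[OF H]] arr_id_left[OF af] by (simp add: conv_def)
qed

lemma conv_comp_left:
  assumes X: "is_coalgebra X" and A: "is_algebra A" and B: "is_algebra B" and u: "alg_mor A B u"
    and f: "arr f (obj X) (obj A)" and g: "arr g (obj X) (obj A)"
  shows "u \<bullet> conv X A f g = conv X B (u \<bullet> f) (u \<bullet> g)"
    and "u \<bullet> conv_unit X A = conv_unit X B"
proof -
  have au: "arr u (obj A) (obj B)"
    using u algD(1)[OF A] algD(1)[OF B] by (simp add: alg_mor_def arr_def)
  show "u \<bullet> conv X A f g = conv X B (u \<bullet> f) (u \<bullet> g)"
    unfolding conv_def
    using arr_assoc[OF arr_pair[OF X f g] algD(3)[OF A] au] tens_pair[OF X f g au au]
      arr_assoc[OF arr_pair[OF X f g] arr_tens[OF au au] algD(3)[OF B]] u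
    by (simp add: alg_mor_def)
  show "u \<bullet> conv_unit X A = conv_unit X B"
    unfolding conv_unit_def
    using arr_assoc[OF coalgD(2)[OF X] algD(2)[OF A] au] u by (simp add: alg_mor_def)
qed

text \<open>
  Both \<open>\<delta> \<circ> \<lambda> \<circ> f\<close> and \<open>(\<lambda> \<circ> f \<otimes> \<lambda> \<circ> f) \<circ> \<delta>\<close> are convolution inverses of
  \<open>\<delta> \<circ> f\<close> with respect to the algebra \<open>H \<otimes> H\<close>.
\<close>

lemma coalg_mor_antipode:
  assumes X: "ccoalg X" and H: "is_hopf H" and f: "coalg_mor X H f"
  shows "coalg_mor X H (antipode H \<bullet> f)"
proof -
  note X' = ccoalgD[OF X] and A = hopf_alg[OF H]
  note dA = algD[OF A] and dC = coalgD[OF hopf_coalg[OF H]]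
  note n = coalgD(2)[OF X'] and d = dC(3)
  let ?T = "tensor H H" and ?s = "antipode H \<bullet> f"
  note T = is_algebra_tensor[OF A A]
  have obT: "obj ?T = obj H \<boxtimes> obj H" by (simp add: tensor_def)
  note af = coalg_mor_arr[OF X' hopf_coalg[OF H] f]
  note as = arr_comp[OF af arr_antipode[OF H]]
  note dmor = hopf_mor_axioms(2)[OF H]
  have uT: "conv_unit X ?T = pair X (conv_unit X H) (conv_unit X H)"
    unfolding conv_unit_def
    using tens_pair[OF X' n n dA(2) dA(2)] pair_counit_right[OF X' n] by (simp add: tensor_def)
  have ds: "arr (comult H \<bullet> ?s) (obj X) (obj ?T)" and ss: "arr (pair X ?s ?s) (obj X) (obj ?T)"
    and ff: "arr (pair X f f) (obj X) (obj ?T)"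
    unfolding obT by (rule arr_comp[OF as d], rule arr_pair[OF X' as as], rule arr_pair[OF X' af af])
  have 1: "conv X ?T (pair X f f) (pair X ?s ?s) = conv_unit X ?T"
  proof -
    note q = arr_pair[OF X' arr_pair[OF X' af af] arr_pair[OF X' as as]]
    have "conv X ?T (pair X f f) (pair X ?s ?s)
        = (mult H \<otimes> mult H) \<bullet> pair X (pair X f ?s) (pair X f ?s)"
      unfolding conv_def
      using arr_assoc[OF q arr_shuffle arr_tens[OF dA(3) dA(3)]] dA(1)
        shuffle_pair[OF X af af as as] by (simp add: tensor_def)
    also have "\<dots> = pair X (conv_unit X H) (conv_unit X H)"
      using tens_pair[OF X' arr_pair[OF X' af as] arr_pair[OF X' af as] dA(3) dA(3)]
        conv_antipode[OF X' H f] by (simp add: conv_def)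
    finally show ?thesis unfolding uT .
  qed
  have 2: "conv X ?T (comult H \<bullet> ?s) (pair X f f) = conv_unit X ?T"
    using conv_comp_left[OF X' A T dmor as af] conv_antipode[OF X' H f] f
    by (simp add: comult_coalg_mor)
  have "comult H \<bullet> ?s = conv X ?T (comult H \<bullet> ?s) (conv X ?T (pair X f f) (pair X ?s ?s))"
    unfolding 1 using conv_unit_right[OF X' T ds] by simp
  also have "\<dots> = pair X ?s ?s"
    using conv_assoc[OF X' T ds ff ss] conv_unit_left[OF X' T ss] 2 by simp
  finally have comult: "comult H \<bullet> ?s = pair X ?s ?s" .
  have cs: "arr (counit H \<bullet> ?s) (obj X) \<K>"
    by (rule arr_comp[OF as dC(2)])
  \<comment> \<open>The counit is multiplicative and \<open>f\<close> preserves it, so applying it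
    to the relation between \<open>?s\<close> and \<open>f\<close> isolates the counit of
    \<open>?s\<close>.\<close>
  have "counit H \<bullet> conv X H ?s f = pair X (counit H \<bullet> ?s) (counit X)"
    unfolding conv_def
    using arr_assoc[OF arr_pair[OF X' as af] dA(3) dC(2)] tens_pair[OF X' as af dC(2) dC(2)] f
      coalg_mor_mult[OF H] by (simp add: coalg_mor_def tensor_def)
  then have "counit H \<bullet> ?s = counit X"
    using pair_counit_right[OF X' cs] conv_antipode[OF X' H f]
      coalg_mor_conv_unit[OF X' H] by (simp add: coalg_mor_def)
  with comult as show ?thesis
    by (simp add: coalg_mor_def pair_def arrD)
qed

definition pts :: "('o, 'm, 'x) algcoalg_scheme \<Rightarrow> ('o, 'm, 'y) algcoalg_scheme \<Rightarrow> 'm set" where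
  "pts X A = {f. coalg_mor X A f}"

lemma group_on_pts:
  assumes X: "ccoalg X" and H: "is_hopf H"
  shows "group_on (pts X H) (conv X H) (conv_unit X H) ((\<bullet>) (antipode H))"
proof -
  note X' = ccoalgD[OF X] and A = hopf_alg[OF H]
  note ar = coalg_mor_arr[OF X' hopf_coalg[OF H]]
  show ?thesis
    by standard
      (auto simp: pts_def ar coalg_mor_conv[OF X H] coalg_mor_conv_unit[OF X' H]
        coalg_mor_antipode[OF X H] conv_antipode[OF X' H] conv_assoc[OF X' A]
        conv_unit_left[OF X' A] conv_unit_right[OF X' A])
qed

section \<open>Morphisms determined by generalized elements\<close>

lemma cocommutative_hopf_braid:
  assumes H: "is_hopf H" and co: "cocommutative H"
  shows "tbr (obj H) (obj H) \<cdot> tbr (obj H) (obj H) = tid (obj H \<boxtimes> obj H)"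
proof -
  define m e where "m = Tm (obj H \<boxtimes> obj H) (mult H) (obj H)" and "e = Tm \<K> (unit H) (obj H)"
  define d n where "d = Tm (obj H) (comult H) (obj H \<boxtimes> obj H)" and "n = Tm (obj H) (counit H) \<K>"
  define l where "l = Tm (obj H) (antipode H) (obj H)"
  note dA = algD[OF hopf_alg[OF H]] and dC = coalgD[OF hopf_coalg[OF H]]
  have bialg: "comult H \<bullet> mult H = (mult H \<otimes> mult H)
      \<bullet> (Idm C (obj H) \<otimes> \<c> (obj H) (obj H) \<otimes> Idm C (obj H)) \<bullet> (comult H \<otimes> comult H)"
    using coalg_mor_mult[OF H] by (simp add: coalg_mor_def tensor_def)
  show ?thesis
    by (rule cocomm_hopf_braid_typed[of "obj H" m e d n l])
      (use dA dC hopf_antipode[OF H] arr_antipode[OF H] co bialg in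
        \<open>auto simp: m_def e_def d_def n_def l_def cocommutative_def tens_id intro!: tmor_eqI\<close>)
qed

lemma ccoalg_hopf: "is_hopf H \<Longrightarrow> cocommutative H \<Longrightarrow> ccoalg H"
  by (simp add: ccoalg_def hopf_coalg)

lemma ccoalg_tensor2:
  assumes H: "is_hopf H" and co: "cocommutative H"
  shows "ccoalg (tensor H H)"
proof -
  note H' = hopf_coalg[OF H]
  have "\<c> (obj H) (obj H) \<bullet> \<c> (obj H) (obj H) = Idm C (obj H \<boxtimes> obj H)"
    using arg_cong[OF cocommutative_hopf_braid[OF H co], of mo] by (simp del: tid_split)
  then show ?thesis
    unfolding ccoalg_def
    using is_coalgebra_tensor[OF H' H'] cocommutative_tensor[OF H' H' co co] by simp
qed

lemma ccoalg_tensor3: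
  assumes H: "is_hopf H" and co: "cocommutative H"
  shows "ccoalg (tensor H (tensor H H))"
proof -
  note H' = hopf_coalg[OF H] and HH = ccoalg_tensor2[OF H co]
  have "\<c> (obj H \<boxtimes> obj H) (obj H) \<bullet> \<c> (obj H) (obj H \<boxtimes> obj H)
      = Idm C (obj H \<boxtimes> obj H \<boxtimes> obj H)"
    using arg_cong[OF tbr_sym_square[OF coalgD(1)[OF H'] cocommutative_hopf_braid[OF H co]], of mo]
    by (simp del: tid_split)
  then show ?thesis
    unfolding ccoalg_def
    using is_coalgebra_tensor[OF H' ccoalgD[OF HH]] HH
      cocommutative_tensor[OF H' ccoalgD[OF HH] co]
    by (simp add: ccoalg_def) (simp add: tensor_def)
qed

lemma pts_arr: "\<lbrakk>is_coalgebra X; is_coalgebra A; f \<in> pts X A\<rbrakk> \<Longrightarrow> arr f (obj X) (obj A)"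
  by (simp add: pts_def coalg_mor_arr)

text \<open>The hypothesis is used at the two projections out of \<open>tensor H H\<close>, whose
  pair is the identity. The variable \<open>X\<close> has the plain record type since a hypothesis
  cannot be polymorphic, and \<open>tensor\<close> yields exactly that type.\<close>

lemma ext2:
  assumes H: "is_hopf H" and co: "cocommutative H"
    and u: "arr u (obj H \<boxtimes> obj H) Z" and v: "arr v (obj H \<boxtimes> obj H) Z"
    and eq: "\<And>(X :: ('o, 'm) algcoalg) f g. \<lbrakk>ccoalg X; f \<in> pts X H; g \<in> pts X H\<rbrakk>
      \<Longrightarrow> u \<bullet> pair X f g = v \<bullet> pair X f g"
  shows "u = v"
proof -
  note H' = hopf_coalg[OF H]
  have "u \<bullet> Idm C (obj H \<boxtimes> obj H) = v \<bullet> Idm C (obj H \<boxtimes> obj H)"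
    using eq[OF ccoalg_tensor2[OF H co]] coalg_mor_proj1[OF H' H'] coalg_mor_proj2[OF H' H']
    unfolding pair_proj[OF H' H', symmetric] pts_def by simp
  then show ?thesis
    by (simp add: arr_id_right[OF u] arr_id_right[OF v])
qed

text \<open>The universal triple consists of the first projection and the two projections of
  \<open>H \<boxtimes> H\<close> composed with the second one; \<open>pair_comp\<close> reassembles
  the latter two.\<close>

lemma ext3:
  assumes H: "is_hopf H" and co: "cocommutative H"
    and u: "arr u (obj H \<boxtimes> obj H \<boxtimes> obj H) Z" and v: "arr v (obj H \<boxtimes> obj H \<boxtimes> obj H) Z"
    and eq: "\<And>(X :: ('o, 'm) algcoalg) f g h. \<lbrakk>ccoalg X; f \<in> pts X H; g \<in> pts X H; h \<in> pts X H\<rbrakk>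
      \<Longrightarrow> u \<bullet> pair X f (pair X g h) = v \<bullet> pair X f (pair X g h)"
  shows "u = v"
proof -
  let ?HH = "tensor H H" and ?X = "tensor H (tensor H H)"
  note H' = hopf_coalg[OF H] and HH = ccoalgD[OF ccoalg_tensor2[OF H co]]
    and X = ccoalgD[OF ccoalg_tensor3[OF H co]]
  note p1 = coalg_mor_proj1[OF H' HH] and p2 = coalg_mor_proj2[OF H' HH]
    and q1 = coalg_mor_proj1[OF H' H'] and q2 = coalg_mor_proj2[OF H' H']
  note c1 = coalg_mor_comp[OF X HH H' p2 q1] and c2 = coalg_mor_comp[OF X HH H' p2 q2]
  have obHH: "obj ?HH = obj H \<boxtimes> obj H"
    by (simp add: tensor_def)
  have "pair ?X (proj1 H H \<bullet> proj2 H ?HH) (proj2 H H \<bullet> proj2 H ?HH) = proj2 H ?HH"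
    using pair_comp[OF X HH coalg_mor_arr[OF HH H' q1] coalg_mor_arr[OF HH H' q2] p2]
      arr_id_left[OF coalg_mor_arr[OF X HH p2]]
    unfolding pair_proj[OF H' H'] obHH by simp
  then have "pair ?X (proj1 H ?HH) (pair ?X (proj1 H H \<bullet> proj2 H ?HH) (proj2 H H \<bullet> proj2 H ?HH))
      = Idm C (obj H \<boxtimes> obj H \<boxtimes> obj H)"
    using pair_proj[OF H' HH] by (simp add: obHH)
  then have "u \<bullet> Idm C (obj H \<boxtimes> obj H \<boxtimes> obj H) = v \<bullet> Idm C (obj H \<boxtimes> obj H \<boxtimes> obj H)"
    using eq[OF ccoalg_tensor3[OF H co], of "proj1 H ?HH" "proj1 H H \<bullet> proj2 H ?HH"
        "proj2 H H \<bullet> proj2 H ?HH"] p1 c1 c2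
    by (simp add: pts_def)
  then show ?thesis
    by (simp add: arr_id_right[OF u] arr_id_right[OF v])
qed

lemma eval_tens:
  assumes X: "is_coalgebra X" and f: "arr f (obj X) A" and g: "arr g (obj X) B"
    and v: "arr v A A'" and w: "arr w B B'" and u: "arr u (A' \<boxtimes> B') Z"
  shows "(u \<bullet> (v \<otimes> w)) \<bullet> pair X f g = u \<bullet> pair X (v \<bullet> f) (w \<bullet> g)"
  using arr_assoc[OF arr_pair[OF X f g] arr_tens[OF v w] u] tens_pair[OF X f g v w] by simp

lemma dup_pair:
  assumes X: "is_coalgebra X" and H: "is_coalgebra H" and f: "f \<in> pts X H" and g: "arr g (obj X) B"
  shows "(comult H \<otimes> Idm C B) \<bullet> pair X f g = pair X f (pair X f g)"
proof -
  note af = pts_arr[OF X H f]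
  show ?thesis
    using tens_pair[OF X af g coalgD(3)[OF H] arr_id[OF arrD(2)[OF g]]] arr_id_left[OF g] f
      pair_assoc[OF X af af g] by (simp add: pts_def comult_coalg_mor)
qed

lemma arr_dup:
  assumes "is_coalgebra H" "B \<in> Ob C" "arr v (obj H) A'" "arr \<psi> (obj H \<boxtimes> B) B'" "arr u (A' \<boxtimes> B') Z"
  shows "arr (u \<bullet> (v \<otimes> \<psi>) \<bullet> (comult H \<otimes> Idm C B)) (obj H \<boxtimes> B) Z"
  using arr_comp[OF arr_comp[OF arr_tens[OF coalgD(3)[OF assms(1)] arr_id[OF assms(2)]],
        of "v \<otimes> \<psi>"] assms(5)] arr_tens[OF assms(3,4)] coalgD(1)[OF assms(1)] assms(2)
  by simp

text \<open>In Sweedler notation the value is u(v(f1), \<psi>(f2, g)). Both \<open>Gam\<close> and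
  \<open>rrb_mult\<close> have this shape: with \<open>v\<close> the antipode and \<psi> the second
  product, and with \<open>v\<close> the identity and \<psi> the action after the operator.\<close>

lemma eval_dup:
  assumes X: "is_coalgebra X" and H: "is_coalgebra H" and f: "f \<in> pts X H" and g: "arr g (obj X) B"
    and v: "arr v (obj H) A'" and \<psi>: "arr \<psi> (obj H \<boxtimes> B) B'" and u: "arr u (A' \<boxtimes> B') Z"
  shows "(u \<bullet> (v \<otimes> \<psi>) \<bullet> (comult H \<otimes> Idm C B)) \<bullet> pair X f g
    = u \<bullet> pair X (v \<bullet> f) (\<psi> \<bullet> pair X f g)"
proof -
  note af = pts_arr[OF X H f]
  note p = arr_pair[OF X af g] and t = arr_tens[OF coalgD(3)[OF H] arr_id[OF arrD(2)[OF g]]]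
  have w: "arr (v \<otimes> \<psi>) ((obj H \<boxtimes> obj H) \<boxtimes> B) (A' \<boxtimes> B')"
    using arr_tens[OF v \<psi>] coalgD(1)[OF H] arrD(2)[OF g] by simp
  have "(u \<bullet> (v \<otimes> \<psi>) \<bullet> (comult H \<otimes> Idm C B)) \<bullet> pair X f g
      = u \<bullet> (v \<otimes> \<psi>) \<bullet> pair X f (pair X f g)"
    using arr_assoc[OF p arr_comp[OF t w] u] arr_assoc[OF p t w] dup_pair[OF X H f g] by simp
  then show ?thesis
    using tens_pair[OF X af p v \<psi>] by simp
qed

lemma arr_module:
  assumes B: "is_coalgebra B" and A: "A \<in> Ob C" and D: "D \<in> Ob C"
    and v: "arr v (obj B \<boxtimes> A) A'" and w: "arr w (obj B \<boxtimes> D) D'" and u: "arr u (A' \<boxtimes> D') Z"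
  shows "arr (u \<bullet> (v \<otimes> w) \<bullet> (Idm C (obj B) \<otimes> \<c> (obj B) A \<otimes> Idm C D)
      \<bullet> (comult B \<otimes> Idm C A \<otimes> Idm C D)) (obj B \<boxtimes> A \<boxtimes> D) Z"
proof -
  note oB = coalgD(1)[OF B]
  have t: "arr (comult B \<otimes> Idm C A \<otimes> Idm C D) (obj B \<boxtimes> A \<boxtimes> D) ((obj B \<boxtimes> obj B) \<boxtimes> A \<boxtimes> D)"
    by (rule arr_tens[OF coalgD(3)[OF B] arr_tens[OF arr_id[OF A] arr_id[OF D]]])
  show ?thesis
    by (rule arr_comp[OF arr_comp[OF arr_comp[OF t arr_shuffle[OF oB oB A D]] arr_tens[OF v w]] u])
qed

text \<open>The value is u(v(b1, h), w(b2, k)). The right-hand sides of the brace axiom and of the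
  compatibility of an action with a product are of this form.\<close>

lemma eval_module:
  assumes X: "ccoalg X" and B: "is_coalgebra B" and b: "b \<in> pts X B"
    and h: "arr h (obj X) A" and k: "arr k (obj X) D"
    and v: "arr v (obj B \<boxtimes> A) A'" and w: "arr w (obj B \<boxtimes> D) D'" and u: "arr u (A' \<boxtimes> D') Z"
  shows "(u \<bullet> (v \<otimes> w) \<bullet> (Idm C (obj B) \<otimes> \<c> (obj B) A \<otimes> Idm C D)
      \<bullet> (comult B \<otimes> Idm C A \<otimes> Idm C D)) \<bullet> pair X b (pair X h k)
    = u \<bullet> pair X (v \<bullet> pair X b h) (w \<bullet> pair X b k)"
proof -
  note X' = ccoalgD[OF X] and oB = coalgD(1)[OF B] and A = arrD(2)[OF h] and D = arrD(2)[OF k]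
  note ab = pts_arr[OF X' B b]
  note hk = arr_pair[OF X' h k] and bh = arr_pair[OF X' ab h] and bk = arr_pair[OF X' ab k]
  let ?s = "Idm C (obj B) \<otimes> \<c> (obj B) A \<otimes> Idm C D" and ?t = "comult B \<otimes> Idm C A \<otimes> Idm C D"
  have t: "arr ?t (obj B \<boxtimes> A \<boxtimes> D) ((obj B \<boxtimes> obj B) \<boxtimes> A \<boxtimes> D)"
    by (rule arr_tens[OF coalgD(3)[OF B] arr_tens[OF arr_id[OF A] arr_id[OF D]]])
  note s = arr_shuffle[OF oB oB A D] and p = arr_pair[OF X' ab hk]
  have "(u \<bullet> (v \<otimes> w) \<bullet> ?s \<bullet> ?t) \<bullet> pair X b (pair X h k)
      = u \<bullet> (v \<otimes> w) \<bullet> ?s \<bullet> ?t \<bullet> pair X b (pair X h k)"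
    using arr_assoc[OF p arr_comp[OF arr_comp[OF t s] arr_tens[OF v w]] u]
      arr_assoc[OF p arr_comp[OF t s] arr_tens[OF v w]] arr_assoc[OF p t s] by simp
  also have "?t \<bullet> pair X b (pair X h k) = pair X (pair X b b) (pair X h k)"
    using dup_pair[OF X' B b hk] pair_assoc[OF X' ab ab hk] A D by (simp add: tens_id)
  also have "?s \<bullet> \<dots> = pair X (pair X b h) (pair X b k)"
    by (rule shuffle_pair[OF X ab ab h k])
  also have "(v \<otimes> w) \<bullet> \<dots> = pair X (v \<bullet> pair X b h) (w \<bullet> pair X b k)"
    by (rule tens_pair[OF X' bh bk v w])
  finally show ?thesis .
qed

text \<open>Forgets the antipode, so that a Hopf algebra can serve as test coalgebra of type \<open>algcoalg\<close>.\<close>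

definition core :: "('o, 'm, 'x) algcoalg_scheme \<Rightarrow> ('o, 'm) algcoalg" where
  "core X = \<lparr>obj = obj X, unit = unit X, mult = mult X, counit = counit X, comult = comult X\<rparr>"

lemma core_sel [simp]:
  "obj (core X) = obj X" "counit (core X) = counit X" "comult (core X) = comult X"
  by (simp_all add: core_def)

lemma core_coalg [simp]:
  "is_coalgebra (core X) = is_coalgebra X" "ccoalg (core X) = ccoalg X"
  "pts (core X) A = pts X A" "pair (core X) f g = pair X f g" "conv_unit (core X) A = conv_unit X A"
  by (simp_all only: is_coalgebra_def ccoalg_def cocommutative_def pts_def coalg_mor_def pair_def
      conv_unit_def core_sel)

lemma unit_pair:
  assumes X: "is_coalgebra X" and A: "is_algebra A"
  shows "pair X (Idm C (obj X)) (conv_unit X A) = Idm C (obj X) \<otimes> unit A"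
    and "pair X (conv_unit X A) (Idm C (obj X)) = unit A \<otimes> Idm C (obj X)"
proof -
  note i = arr_id[OF coalgD(1)[OF X]] and n = coalgD(2)[OF X] and e = algD(2)[OF A]
  show "pair X (Idm C (obj X)) (conv_unit X A) = Idm C (obj X) \<otimes> unit A"
    unfolding conv_unit_def
    using tens_pair[OF X i n i e] pair_counit_right[OF X i] arr_id_left[OF i]
      arr_id_right[OF arr_tens[OF i e]] coalgD(1)[OF X] by simp
  show "pair X (conv_unit X A) (Idm C (obj X)) = unit A \<otimes> Idm C (obj X)"
    unfolding conv_unit_def
    using tens_pair[OF X n i e i] pair_counit_left[OF X i] arr_id_left[OF i]
      arr_id_right[OF arr_tens[OF e i]] coalgD(1)[OF X] by simp
qed

text \<open>A Yoneda argument for group objects. The unit and antipode laws are read off at the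
  identity of \<open>H\<close>, taken as an element over \<open>H\<close> itself, and associativity
  at the universal triple. Closure under products, at the universal pair, says that
  \<open>mult K\<close> is a coalgebra morphism, which is the bialgebra axiom read from the other
  side.\<close>

lemma is_hopfI:
  assumes H: "is_hopf H" and co: "cocommutative H"
    and K: "obj K = obj H" "unit K = unit H" "counit K = counit H" "comult K = comult H"
    and m: "arr (mult K) (obj H \<boxtimes> obj H) (obj H)" and l: "arr (antipode K) (obj H) (obj H)"
    and grp: "\<And>X :: ('o, 'm) algcoalg. ccoalg X
      \<Longrightarrow> group_on (pts X H) (\<lambda>f g. mult K \<bullet> pair X f g) (conv_unit X H) ((\<bullet>) (antipode K))"
  shows "is_hopf K"
proof -
  note H' = hopf_coalg[OF H] and A = hopf_alg[OF H]
  note dC = coalgD[OF H'] and dA = algD[OF A]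
  note i = arr_id[OF dC(1)]
  have id_pts: "Idm C (obj H) \<in> pts H H"
    by (simp add: pts_def coalg_mor_id[OF H'])
  interpret P: group_on "pts H H" "\<lambda>f g. mult K \<bullet> pair H f g" "conv_unit H H" "(\<bullet>) (antipode K)"
    using grp[of "core H"] ccoalg_hopf[OF H co] by simp
  have units: "mult K \<bullet> (Idm C (obj H) \<otimes> unit H) = Idm C (obj H)"
    "mult K \<bullet> (unit H \<otimes> Idm C (obj H)) = Idm C (obj H)"
    using P.m_e_right[OF id_pts] P.m_e_left[OF id_pts] unit_pair[OF H' A] by simp_all
  have anti: "mult K \<bullet> (Idm C (obj H) \<otimes> antipode K) \<bullet> comult H = unit H \<bullet> counit H"
    "mult K \<bullet> (antipode K \<otimes> Idm C (obj H)) \<bullet> comult H = unit H \<bullet> counit H"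
    using P.m_i_right[OF id_pts] P.m_i_left[OF id_pts] arr_id_right[OF l]
    by (simp_all add: pair_def conv_unit_def)
  have assoc: "mult K \<bullet> (Idm C (obj H) \<otimes> mult K) = mult K \<bullet> (mult K \<otimes> Idm C (obj H))"
  proof (rule ext3[OF H co])
    show "arr (mult K \<bullet> (Idm C (obj H) \<otimes> mult K)) (obj H \<boxtimes> obj H \<boxtimes> obj H) (obj H)"
      by (rule arr_comp[OF arr_tens[OF i m] m])
    show "arr (mult K \<bullet> (mult K \<otimes> Idm C (obj H))) (obj H \<boxtimes> obj H \<boxtimes> obj H) (obj H)"
      using arr_comp[OF arr_tens[OF m i] m] dC(1) by simp
    fix X :: "('o, 'm) algcoalg" and f g h
    assume X: "ccoalg X" and fgh: "f \<in> pts X H" "g \<in> pts X H" "h \<in> pts X H"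
    interpret X: group_on "pts X H" "\<lambda>f g. mult K \<bullet> pair X f g" "conv_unit X H" "(\<bullet>) (antipode K)"
      by (rule grp[OF X])
    note X' = ccoalgD[OF X]
    note af = pts_arr[OF X' H' fgh(1)] and ag = pts_arr[OF X' H' fgh(2)]
      and ah = pts_arr[OF X' H' fgh(3)]
    have "(mult K \<bullet> (Idm C (obj H) \<otimes> mult K)) \<bullet> pair X f (pair X g h)
        = mult K \<bullet> pair X f (mult K \<bullet> pair X g h)"
      using eval_tens[OF X' af arr_pair[OF X' ag ah] i m m] arr_id_left[OF af] by simp
    moreover have "(mult K \<bullet> (mult K \<otimes> Idm C (obj H))) \<bullet> pair X f (pair X g h)
        = mult K \<bullet> pair X (mult K \<bullet> pair X f g) h"
      using eval_tens[OF X' arr_pair[OF X' af ag] ah m i m] arr_id_left[OF ah]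
        pair_assoc[OF X' af ag ah] by simp
    ultimately show "(mult K \<bullet> (Idm C (obj H) \<otimes> mult K)) \<bullet> pair X f (pair X g h)
        = (mult K \<bullet> (mult K \<otimes> Idm C (obj H))) \<bullet> pair X f (pair X g h)"
      using X.m_assoc[OF fgh] by simp
  qed
  have mor: "coalg_mor (tensor H H) H (mult K)"
  proof -
    interpret T: group_on "pts (tensor H H) H" "\<lambda>f g. mult K \<bullet> pair (tensor H H) f g"
        "conv_unit (tensor H H) H" "(\<bullet>) (antipode K)"
      by (rule grp[OF ccoalg_tensor2[OF H co]])
    have "mult K \<bullet> pair (tensor H H) (proj1 H H) (proj2 H H) \<in> pts (tensor H H) H"
      using coalg_mor_proj1[OF H' H'] coalg_mor_proj2[OF H' H']
      by (intro T.m_closed) (simp_all add: pts_def)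
    then show ?thesis
      unfolding pair_proj[OF H' H'] by (simp add: arr_id_right[OF m] pts_def)
  qed
  have "alg_mor K unit_algcoalg (counit K)"
    using mor hopf_unit[OF H] arr_id_left[OF arr_tens[OF dC(2) dC(2)]] arrD(3)[OF dC(2)]
    by (simp add: alg_mor_def unit_algcoalg_def coalg_mor_def tensor_def K)
  moreover have "alg_mor K (tensor K K) (comult K)"
    using mor hopf_unit[OF H] arrD(3)[OF dC(3)]
      arr_assoc[OF arr_tens[OF dC(3) dC(3)] arr_shuffle[OF dC(1) dC(1) dC(1) dC(1)] arr_tens[OF m m]]
    by (simp add: alg_mor_def coalg_mor_def tensor_def K)
  moreover have "is_algebra K"
    unfolding is_algebra_def K using units assoc dA(1) arrD(3)[OF dA(2)] arrD(3)[OF m] by blast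
  moreover have "is_coalgebra K"
    using H' unfolding is_coalgebra_def K .
  ultimately show ?thesis
    unfolding is_hopf_def K using anti arrD(3)[OF l] by blast
qed

section \<open>Relative Rota-Baxter operators and Hopf braces\<close>

lemma module_algcoalgD:
  assumes "is_module_algcoalg B H \<phi>"
  shows "is_algebra H" "is_coalgebra H" "\<phi> \<in> Hom C (obj B \<boxtimes> obj H) (obj H)"
    "\<phi> \<bullet> (unit B \<otimes> Idm C (obj H)) = Idm C (obj H)"
    "\<phi> \<bullet> (Idm C (obj B) \<otimes> \<phi>) = \<phi> \<bullet> (mult B \<otimes> Idm C (obj H))"
    "\<phi> \<bullet> (Idm C (obj B) \<otimes> mult H) = mult H \<bullet> (\<phi> \<otimes> \<phi>)
      \<bullet> (Idm C (obj B) \<otimes> \<c> (obj B) (obj H) \<otimes> Idm C (obj H))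
      \<bullet> (comult B \<otimes> Idm C (obj H) \<otimes> Idm C (obj H))"
    "coalg_mor (tensor B H) H \<phi>"
  using assms unfolding is_module_algcoalg_def is_left_module_def by blast+

text \<open>On elements, a module algebra-coalgebra is an action by automorphisms. Closure holds
  because \<open>pair X b h\<close> is a coalgebra morphism into \<open>tensor B H\<close> as soon
  as \<open>X\<close> is cocommutative, and so is \<phi> after it.\<close>

lemma module_pts:
  assumes B: "is_hopf B" and M: "is_module_algcoalg B H \<phi>" and X: "ccoalg X"
    and b: "b \<in> pts X B" and h: "h \<in> pts X H"
  shows "\<phi> \<bullet> pair X b h \<in> pts X H"
    and "\<phi> \<bullet> pair X (conv_unit X B) h = h"
    and "b' \<in> pts X B \<Longrightarrow> \<phi> \<bullet> pair X b (\<phi> \<bullet> pair X b' h) = \<phi> \<bullet> pair X (conv X B b b') h"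
    and "k \<in> pts X H
      \<Longrightarrow> \<phi> \<bullet> pair X b (conv X H h k) = conv X H (\<phi> \<bullet> pair X b h) (\<phi> \<bullet> pair X b k)"
proof -
  note MD = module_algcoalgD[OF M] and X' = ccoalgD[OF X] and B' = hopf_coalg[OF B]
  note dB = algD[OF hopf_alg[OF B]] and dH = algD[OF MD(1)]
  note n = coalgD(2)[OF X'] and i = arr_id[OF dH(1)] and j = arr_id[OF dB(1)]
  have \<phi>: "arr \<phi> (obj B \<boxtimes> obj H) (obj H)"
    using MD(3) dB(1) dH(1) by (simp add: arr_def)
  note ab = pts_arr[OF X' B' b] and ah = pts_arr[OF X' MD(2) h]
  show "\<phi> \<bullet> pair X b h \<in> pts X H"
    using coalg_mor_comp[OF X' is_coalgebra_tensor[OF B' MD(2)] MD(2)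
        coalg_mor_pair[OF X B' MD(2)] MD(7)] b h
    by (simp add: pts_def)
  show "\<phi> \<bullet> pair X (conv_unit X B) h = h"
    unfolding conv_unit_def
    using eval_tens[OF X' n ah dB(2) i \<phi>] MD(4) dH(1) pair_counit_left[OF X' ah]
      arr_id_left[OF ah] by simp
  show "\<phi> \<bullet> pair X b (\<phi> \<bullet> pair X b' h) = \<phi> \<bullet> pair X (conv X B b b') h" if b': "b' \<in> pts X B"
  proof -
    note ab' = pts_arr[OF X' B' b']
    have "\<phi> \<bullet> pair X b (\<phi> \<bullet> pair X b' h) = (\<phi> \<bullet> (Idm C (obj B) \<otimes> \<phi>)) \<bullet> pair X b (pair X b' h)"
      using eval_tens[OF X' ab arr_pair[OF X' ab' ah] j \<phi> \<phi>] arr_id_left[OF ab] by simp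
    also have "\<dots> = (\<phi> \<bullet> (mult B \<otimes> Idm C (obj H))) \<bullet> pair X (pair X b b') h"
      unfolding MD(5) using pair_assoc[OF X' ab ab' ah] by simp
    also have "\<dots> = \<phi> \<bullet> pair X (conv X B b b') h"
      unfolding conv_def
      using eval_tens[OF X' arr_pair[OF X' ab ab'] ah dB(3) i \<phi>] arr_id_left[OF ah] by simp
    finally show ?thesis .
  qed
  show "\<phi> \<bullet> pair X b (conv X H h k) = conv X H (\<phi> \<bullet> pair X b h) (\<phi> \<bullet> pair X b k)"
    if k: "k \<in> pts X H"
  proof -
    note ak = pts_arr[OF X' MD(2) k]
    have "\<phi> \<bullet> pair X b (conv X H h k) = (\<phi> \<bullet> (Idm C (obj B) \<otimes> mult H)) \<bullet> pair X b (pair X h k)"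
      unfolding conv_def
      using eval_tens[OF X' ab arr_pair[OF X' ah ak] j dH(3) \<phi>] arr_id_left[OF ab] by simp
    also have "\<dots> = conv X H (\<phi> \<bullet> pair X b h) (\<phi> \<bullet> pair X b k)"
      unfolding MD(6) conv_def by (rule eval_module[OF X B' b ah ak \<phi> \<phi> dH(3)])
    finally show ?thesis .
  qed
qed

section \<open>From relative Rota-Baxter operators to Hopf braces\<close>

lemma rrbD:
  assumes "is_rrb T"
  shows "is_hopf (src T)" "is_hopf (tgt T)" "is_module_algcoalg (tgt T) (src T) (act T)"
    "coalg_mor (src T) (tgt T) (opr T)" "mult (tgt T) \<bullet> (opr T \<otimes> opr T) = opr T \<bullet> rrb_mult T"
    "arr (opr T) (obj (src T)) (obj (tgt T))"
    "arr (act T) (obj (tgt T) \<boxtimes> obj (src T)) (obj (src T))"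
proof -
  show *: "is_hopf (src T)" "is_hopf (tgt T)" "is_module_algcoalg (tgt T) (src T) (act T)"
    "coalg_mor (src T) (tgt T) (opr T)" "mult (tgt T) \<bullet> (opr T \<otimes> opr T) = opr T \<bullet> rrb_mult T"
    using assms unfolding is_rrb_def by blast+
  show "arr (opr T) (obj (src T)) (obj (tgt T))"
    by (rule coalg_mor_arr[OF hopf_coalg[OF *(1)] hopf_coalg[OF *(2)] *(4)])
  show "arr (act T) (obj (tgt T) \<boxtimes> obj (src T)) (obj (src T))"
    using module_algcoalgD(3)[OF *(3)] algD(1)[OF hopf_alg[OF *(1)]] algD(1)[OF hopf_alg[OF *(2)]]
    by (simp add: arr_def)
qed

lemma arr_act_opr:
  assumes T: "is_rrb T"
  shows "arr (act T \<bullet> (opr T \<otimes> Idm C (obj (src T)))) (obj (src T) \<boxtimes> obj (src T)) (obj (src T))"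
  using arr_comp[OF arr_tens[OF rrbD(6)[OF T] arr_id] rrbD(7)[OF T]]
    algD(1)[OF hopf_alg[OF rrbD(1)[OF T]]] by simp

lemma arr_rrb_mult:
  assumes T: "is_rrb T"
  shows "arr (rrb_mult T) (obj (src T) \<boxtimes> obj (src T)) (obj (src T))"
proof -
  note dH = algD[OF hopf_alg[OF rrbD(1)[OF T]]]
  show ?thesis
    unfolding rrb_mult_def
    by (rule arr_dup[OF hopf_coalg[OF rrbD(1)[OF T]] dH(1) arr_id[OF dH(1)] arr_act_opr[OF T] dH(3)])
qed

lemma rrb_mult_pair:
  assumes T: "is_rrb T" and X: "is_coalgebra X" and f: "f \<in> pts X (src T)"
    and g: "arr g (obj X) (obj (src T))"
  shows "rrb_mult T \<bullet> pair X f g = conv X (src T) f (act T \<bullet> pair X (opr T \<bullet> f) g)"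
proof -
  note dH = algD[OF hopf_alg[OF rrbD(1)[OF T]]] and H' = hopf_coalg[OF rrbD(1)[OF T]]
  note i = arr_id[OF dH(1)] and af = pts_arr[OF X H' f]
  show ?thesis
    unfolding rrb_mult_def conv_def
    using eval_dup[OF X H' f g i arr_act_opr[OF T] dH(3)]
      eval_tens[OF X af g rrbD(6)[OF T] i rrbD(7)[OF T]] arr_id_left[OF af] arr_id_left[OF g]
    by simp
qed

lemma arr_rrb_antipode:
  assumes T: "is_rrb T"
  shows "arr (rrb_antipode T) (obj (src T)) (obj (src T))"
  unfolding rrb_antipode_def
  by (rule arr_comp[OF arr_comp[OF coalgD(3)[OF hopf_coalg[OF rrbD(1)[OF T]]]
          arr_tens[OF arr_comp[OF rrbD(6)[OF T] arr_antipode[OF rrbD(2)[OF T]]]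
            arr_antipode[OF rrbD(1)[OF T]]]] rrbD(7)[OF T]])

lemma rrb_antipode_comp:
  assumes T: "is_rrb T" and X: "is_coalgebra X" and f: "f \<in> pts X (src T)"
  shows "rrb_antipode T \<bullet> f
    = act T \<bullet> pair X (antipode (tgt T) \<bullet> opr T \<bullet> f) (antipode (src T) \<bullet> f)"
proof -
  note H = rrbD(1)[OF T] and B = rrbD(2)[OF T] and o = rrbD(6)[OF T]
  note H' = hopf_coalg[OF H] and l = arr_antipode[OF H] and k = arr_antipode[OF B]
  note af = pts_arr[OF X H' f] and d = coalgD(3)[OF H']
  note ko = arr_comp[OF o k]
  note t = arr_tens[OF ko l]
  have "rrb_antipode T \<bullet> f
      = act T \<bullet> ((antipode (tgt T) \<bullet> opr T) \<otimes> antipode (src T)) \<bullet> comult (src T) \<bullet> f"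
    unfolding rrb_antipode_def
    using arr_assoc[OF af arr_comp[OF d t] rrbD(7)[OF T]] arr_assoc[OF af d t] by simp
  then show ?thesis
    using tens_pair[OF X af af ko l] arr_assoc[OF af o k] f
    by (simp add: pts_def comult_coalg_mor)
qed

lemma rrb_group_pts:
  assumes T: "is_rrb T" and X: "ccoalg X"
  shows "rrb_group (pts X (src T)) (conv X (src T)) (conv_unit X (src T)) ((\<bullet>) (antipode (src T)))
    (pts X (tgt T)) (conv X (tgt T)) (conv_unit X (tgt T)) ((\<bullet>) (antipode (tgt T)))
    (\<lambda>b h. act T \<bullet> pair X b h) ((\<bullet>) (opr T))"
proof -
  note H = rrbD(1)[OF T] and B = rrbD(2)[OF T] and o = rrbD(6)[OF T]
  note X' = ccoalgD[OF X] and H' = hopf_coalg[OF H] and B' = hopf_coalg[OF B]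
  note mod = module_pts[OF B rrbD(3)[OF T] X]
  have T_pts: "opr T \<bullet> h \<in> pts X (tgt T)" if "h \<in> pts X (src T)" for h
    using coalg_mor_comp[OF X' H' B' _ rrbD(4)[OF T]] that by (simp add: pts_def)
  have T_m: "conv X (tgt T) (opr T \<bullet> h) (opr T \<bullet> k)
      = opr T \<bullet> conv X (src T) h (act T \<bullet> pair X (opr T \<bullet> h) k)"
    if h: "h \<in> pts X (src T)" and k: "k \<in> pts X (src T)" for h k
  proof -
    note ah = pts_arr[OF X' H' h] and ak = pts_arr[OF X' H' k]
    have "conv X (tgt T) (opr T \<bullet> h) (opr T \<bullet> k) = (opr T \<bullet> rrb_mult T) \<bullet> pair X h k"
      unfolding conv_def
      using eval_tens[OF X' ah ak o o algD(3)[OF hopf_alg[OF B]]] rrbD(5)[OF T] by simp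
    also have "\<dots> = opr T \<bullet> rrb_mult T \<bullet> pair X h k"
      by (rule arr_assoc[OF arr_pair[OF X' ah ak] arr_rrb_mult[OF T] o])
    finally show ?thesis
      using rrb_mult_pair[OF T X' h ak] by simp
  qed
  have unit_pt: "conv_unit X (tgt T) \<in> pts X (tgt T)"
    using coalg_mor_conv_unit[OF X' B] by (simp add: pts_def)
  show ?thesis
    by (intro rrb_group.intro group_on_pts[OF X H] group_on_pts[OF X B] rrb_group_axioms.intro)
      (simp_all add: mod T_pts T_m mod(2)[OF unit_pt])
qed

text \<open>The Hopf algebra written \<open>H\<close> with an overline in the definition of \<open>G\<close>.\<close>

definition bar :: "('o, 'm) rrb \<Rightarrow> ('o, 'm) hopf" where
  "bar T = (src T)\<lparr>mult := rrb_mult T, antipode := rrb_antipode T\<rparr>"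

lemma bar_sel [simp]:
  "obj (bar T) = obj (src T)" "unit (bar T) = unit (src T)" "mult (bar T) = rrb_mult T"
  "counit (bar T) = counit (src T)" "comult (bar T) = comult (src T)"
  "antipode (bar T) = rrb_antipode T"
  by (simp_all add: bar_def)

text \<open>The abstract \<open>rb_mult\<close> and \<open>rb_inv\<close> are identified with
  composition with \<open>rrb_mult T\<close> and \<open>rrb_antipode T\<close> only on elements of
  \<open>pts X (src T)\<close>, so the group laws are transported inside that set.\<close>

lemma group_on_bar:
  assumes T: "is_rrb T" and X: "ccoalg X"
  shows "group_on (pts X (src T)) (\<lambda>f g. rrb_mult T \<bullet> pair X f g) (conv_unit X (src T))
    ((\<bullet>) (rrb_antipode T))"
proof -
  interpret P: rrb_group "pts X (src T)" "conv X (src T)" "conv_unit X (src T)"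
    "(\<bullet>) (antipode (src T))" "pts X (tgt T)" "conv X (tgt T)" "conv_unit X (tgt T)"
    "(\<bullet>) (antipode (tgt T))" "\<lambda>b h. act T \<bullet> pair X b h" "(\<bullet>) (opr T)"
    by (rule rrb_group_pts[OF T X])
  note X' = ccoalgD[OF X] and H' = hopf_coalg[OF rrbD(1)[OF T]]
  have m: "P.rb_mult f g = rrb_mult T \<bullet> pair X f g" if "f \<in> pts X (src T)" "g \<in> pts X (src T)" for f g
    using rrb_mult_pair[OF T X' that(1) pts_arr[OF X' H' that(2)]] by (simp add: P.rb_mult_def)
  have i: "P.rb_inv f = rrb_antipode T \<bullet> f" if "f \<in> pts X (src T)" for f
    using rrb_antipode_comp[OF T X' that] by (simp add: P.rb_inv_def)
  interpret Q: group_on "pts X (src T)" P.rb_mult "conv_unit X (src T)" P.rb_inv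
    by (rule P.group_on_rb_mult)
  have cl: "rrb_mult T \<bullet> pair X f g \<in> pts X (src T)" if "f \<in> pts X (src T)" "g \<in> pts X (src T)" for f g
    using Q.m_closed[OF that] m[OF that] by simp
  have ci: "rrb_antipode T \<bullet> f \<in> pts X (src T)" if "f \<in> pts X (src T)" for f
    using Q.i_closed[OF that] i[OF that] by simp
  show ?thesis
    using Q.m_assoc Q.m_e_left Q.m_e_right Q.m_i_left Q.m_i_right
    by unfold_locales (simp_all add: m i cl ci Q.e_closed)
qed

lemma is_hopf_bar:
  assumes T: "is_rrb T" and co: "cocommutative (src T)"
  shows "is_hopf (bar T)"
  by (rule is_hopfI[OF rrbD(1)[OF T] co])
    (simp_all add: arr_rrb_mult[OF T] arr_rrb_antipode[OF T] group_on_bar[OF T])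

lemma arr_Gam:
  assumes H: "is_hopf H" and m: "arr (mult K) (obj H \<boxtimes> obj H) (obj H)"
  shows "arr (Gam (H, K)) (obj H \<boxtimes> obj H) (obj H)"
  unfolding Gam_def prod.case
  by (rule arr_dup[OF hopf_coalg[OF H] algD(1)[OF hopf_alg[OF H]] arr_antipode[OF H] m
        algD(3)[OF hopf_alg[OF H]]])

lemma Gam_pair:
  assumes H: "is_hopf H" and m: "arr (mult K) (obj H \<boxtimes> obj H) (obj H)"
    and X: "is_coalgebra X" and f: "f \<in> pts X H" and g: "arr g (obj X) (obj H)"
  shows "Gam (H, K) \<bullet> pair X f g = conv X H (antipode H \<bullet> f) (mult K \<bullet> pair X f g)"
  unfolding Gam_def prod.case conv_def
  by (rule eval_dup[OF X hopf_coalg[OF H] f g arr_antipode[OF H] m algD(3)[OF hopf_alg[OF H]]])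

lemma Gam_bar_pair:
  assumes T: "is_rrb T" and X: "ccoalg X" and f: "f \<in> pts X (src T)" and g: "g \<in> pts X (src T)"
  shows "Gam (src T, bar T) \<bullet> pair X f g = act T \<bullet> pair X (opr T \<bullet> f) g"
proof -
  interpret P: rrb_group "pts X (src T)" "conv X (src T)" "conv_unit X (src T)"
    "(\<bullet>) (antipode (src T))" "pts X (tgt T)" "conv X (tgt T)" "conv_unit X (tgt T)"
    "(\<bullet>) (antipode (tgt T))" "\<lambda>b h. act T \<bullet> pair X b h" "(\<bullet>) (opr T)"
    by (rule rrb_group_pts[OF T X])
  note X' = ccoalgD[OF X] and H = rrbD(1)[OF T]
  note ag = pts_arr[OF X' hopf_coalg[OF H] g]
  show ?thesis
    using Gam_pair[OF H _ X' f ag, of "bar T"] arr_rrb_mult[OF T] rrb_mult_pair[OF T X' f ag]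
      P.i_rb_mult[OF f g] by (simp add: P.rb_mult_def)
qed

text \<open>The new product starts with the old one, whose first factor the antipode in
  \<open>Gam\<close> cancels; the action pulled back along the operator remains. The counit respects
  actions for this reason.\<close>

lemma Gam_bar:
  assumes T: "is_rrb T" and co: "cocommutative (src T)"
  shows "Gam (src T, bar T) = act T \<bullet> (opr T \<otimes> Idm C (obj (src T)))"
proof (rule ext2[OF rrbD(1)[OF T] co])
  note H = rrbD(1)[OF T]
  show "arr (Gam (src T, bar T)) (obj (src T) \<boxtimes> obj (src T)) (obj (src T))"
    by (rule arr_Gam[OF H]) (simp add: arr_rrb_mult[OF T])
  show "arr (act T \<bullet> (opr T \<otimes> Idm C (obj (src T)))) (obj (src T) \<boxtimes> obj (src T)) (obj (src T))"
    by (rule arr_act_opr[OF T])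
  fix X :: "('o, 'm) algcoalg" and f g
  assume X: "ccoalg X" and f: "f \<in> pts X (src T)" and g: "g \<in> pts X (src T)"
  note X' = ccoalgD[OF X] and H' = hopf_coalg[OF H]
  note af = pts_arr[OF X' H' f] and ag = pts_arr[OF X' H' g]
  show "Gam (src T, bar T) \<bullet> pair X f g
      = (act T \<bullet> (opr T \<otimes> Idm C (obj (src T)))) \<bullet> pair X f g"
    using Gam_bar_pair[OF T X f g] arr_id_left[OF ag]
      eval_tens[OF X' af ag rrbD(6)[OF T] arr_id[OF arrD(2)[OF ag]] rrbD(7)[OF T]] by simp
qed

text \<open>At a triple of elements, the brace axiom is \<open>brace_rb_mult\<close>, with
  \<open>Gam\<close> evaluated by \<open>Gam_bar_pair\<close>.\<close>

lemma is_brace_bar: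
  assumes T: "is_rrb T" and co: "cocommutative (src T)"
  shows "is_brace (src T, bar T)"
proof -
  note H = rrbD(1)[OF T]
  note H' = hopf_coalg[OF H] and dH = algD[OF hopf_alg[OF H]]
  note i = arr_id[OF dH(1)] and m = arr_rrb_mult[OF T]
  have \<Gamma>: "arr (Gam (src T, bar T)) (obj (src T) \<boxtimes> obj (src T)) (obj (src T))"
    by (rule arr_Gam[OF H]) (simp add: m)
  have "rrb_mult T \<bullet> (Idm C (obj (src T)) \<otimes> mult (src T))
      = mult (src T) \<bullet> (rrb_mult T \<otimes> Gam (src T, bar T))
        \<bullet> (Idm C (obj (src T)) \<otimes> \<c> (obj (src T)) (obj (src T)) \<otimes> Idm C (obj (src T)))
        \<bullet> (comult (src T) \<otimes> Idm C (obj (src T)) \<otimes> Idm C (obj (src T)))"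
  proof (rule ext3[OF H co arr_comp[OF arr_tens[OF i dH(3)] m] arr_module[OF H' dH(1,1) m \<Gamma> dH(3)]])
    fix X :: "('o, 'm) algcoalg" and f g h
    assume X: "ccoalg X" and f: "f \<in> pts X (src T)" and g: "g \<in> pts X (src T)"
      and h: "h \<in> pts X (src T)"
    interpret P: rrb_group "pts X (src T)" "conv X (src T)" "conv_unit X (src T)"
      "(\<bullet>) (antipode (src T))" "pts X (tgt T)" "conv X (tgt T)" "conv_unit X (tgt T)"
      "(\<bullet>) (antipode (tgt T))" "\<lambda>b h. act T \<bullet> pair X b h" "(\<bullet>) (opr T)"
      by (rule rrb_group_pts[OF T X])
    note X' = ccoalgD[OF X]
    note af = pts_arr[OF X' H' f] and ag = pts_arr[OF X' H' g] and ah = pts_arr[OF X' H' h]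
    have rb_mult: "rrb_mult T \<bullet> pair X f k = P.rb_mult f k" if "k \<in> pts X (src T)" for k
      using rrb_mult_pair[OF T X' f pts_arr[OF X' H' that]] by (simp add: P.rb_mult_def)
    have "(rrb_mult T \<bullet> (Idm C (obj (src T)) \<otimes> mult (src T))) \<bullet> pair X f (pair X g h)
        = P.rb_mult f (conv X (src T) g h)"
      using eval_tens[OF X' af arr_pair[OF X' ag ah] i dH(3) m] arr_id_left[OF af]
        rb_mult[OF P.H.m_closed[OF g h]] by (simp add: conv_def)
    also have "\<dots> = conv X (src T) (P.rb_mult f g) (act T \<bullet> pair X (opr T \<bullet> f) h)"
      using P.brace_rb_mult[OF f g h] P.i_rb_mult[OF f h] by simp
    finally show "(rrb_mult T \<bullet> (Idm C (obj (src T)) \<otimes> mult (src T))) \<bullet> pair X f (pair X g h)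
      = (mult (src T) \<bullet> (rrb_mult T \<otimes> Gam (src T, bar T))
        \<bullet> (Idm C (obj (src T)) \<otimes> \<c> (obj (src T)) (obj (src T)) \<otimes> Idm C (obj (src T)))
        \<bullet> (comult (src T) \<otimes> Idm C (obj (src T)) \<otimes> Idm C (obj (src T))))
        \<bullet> pair X f (pair X g h)"
      using eval_module[OF X H' f ag ah m \<Gamma> dH(3)] Gam_bar_pair[OF T X f h] rb_mult[OF g]
      by (simp add: conv_def)
  qed
  then show ?thesis
    unfolding is_brace_def prod.case using H is_hopf_bar[OF T co] by simp
qed

text \<open>Multiplicativity is the Rota-Baxter equation itself. Preservation of the unit is
  derived: on elements over \<open>H\<close> the operator preserves the neutral one, which is the
  unit after the counit, and precomposing with the unit of \<open>H\<close> cancels that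
  counit.\<close>

lemma hopf_mor_opr_bar:
  assumes T: "is_rrb T" and co: "cocommutative (src T)"
  shows "hopf_mor (bar T) (tgt T) (opr T)"
proof -
  note H = rrbD(1)[OF T] and B = rrbD(2)[OF T] and o = rrbD(6)[OF T]
  note H' = hopf_coalg[OF H] and B' = hopf_coalg[OF B]
  note dH = algD[OF hopf_alg[OF H]] and dB = algD[OF hopf_alg[OF B]]
  have "opr T \<bullet> unit (src T) = unit (tgt T)"
  proof -
    let ?H = "src T" and ?B = "tgt T"
    interpret P: rrb_group "pts ?H ?H" "conv ?H ?H" "conv_unit ?H ?H" "(\<bullet>) (antipode ?H)"
      "pts ?H ?B" "conv ?H ?B" "conv_unit ?H ?B" "(\<bullet>) (antipode ?B)"
      "\<lambda>b h. act T \<bullet> pair ?H b h" "(\<bullet>) (opr T)"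
      by (rule rrb_group_pts[OF T ccoalg_hopf[OF H co]])
    note n = coalgD(2)[OF H']
    have "(opr T \<bullet> unit ?H) \<bullet> counit ?H = unit ?B \<bullet> counit ?H"
      using P.T_e arr_assoc[OF n dH(2) o] by (simp add: conv_unit_def)
    then have "((opr T \<bullet> unit ?H) \<bullet> counit ?H) \<bullet> unit ?H = (unit ?B \<bullet> counit ?H) \<bullet> unit ?H"
      by simp
    then show ?thesis
      using arr_assoc[OF dH(2) n arr_comp[OF dH(2) o]] arr_assoc[OF dH(2) n dB(2)]
        hopf_unit(1)[OF H] arr_id_right[OF arr_comp[OF dH(2) o]] arr_id_right[OF dB(2)] by simp
  qed
  moreover have "coalg_mor (bar T) (tgt T) (opr T)"
    using rrbD(4)[OF T] by (simp add: coalg_mor_def)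
  ultimately show ?thesis
    using rrbD(5)[OF T] arrD(3)[OF o] by (simp add: hopf_mor_def alg_mor_def)
qed

section \<open>From Hopf braces to relative Rota-Baxter operators\<close>

lemma braceD:
  assumes "is_brace (H, K)"
  shows "is_hopf H" "is_hopf K" "obj K = obj H" "unit K = unit H" "counit K = counit H"
    "comult K = comult H" "arr (mult K) (obj H \<boxtimes> obj H) (obj H)"
    "mult K \<bullet> (Idm C (obj H) \<otimes> mult H) = mult H \<bullet> (mult K \<otimes> Gam (H, K))
      \<bullet> (Idm C (obj H) \<otimes> \<c> (obj H) (obj H) \<otimes> Idm C (obj H))
      \<bullet> (comult H \<otimes> Idm C (obj H) \<otimes> Idm C (obj H))"
proof -
  show *: "is_hopf H" "is_hopf K" "obj K = obj H" "unit K = unit H" "counit K = counit H"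
    "comult K = comult H"
    "mult K \<bullet> (Idm C (obj H) \<otimes> mult H) = mult H \<bullet> (mult K \<otimes> Gam (H, K))
      \<bullet> (Idm C (obj H) \<otimes> \<c> (obj H) (obj H) \<otimes> Idm C (obj H))
      \<bullet> (comult H \<otimes> Idm C (obj H) \<otimes> Idm C (obj H))"
    using assms unfolding is_brace_def prod.case by blast+
  show "arr (mult K) (obj H \<boxtimes> obj H) (obj H)"
    using algD(3)[OF hopf_alg[OF *(2)]] unfolding *(3) .
qed

text \<open>Elements see only the coalgebra, so the two Hopf algebras put two group structures on
  one and the same set. Unfolding with these equations moves all facts about \<open>K\<close> to the
  elements of \<open>H\<close>.\<close>

lemma pts_brace:
  assumes "is_brace (H, K)"
  shows "pts X K = pts X H" "conv_unit X K = conv_unit X H"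
    "is_coalgebra K = is_coalgebra H" "cocommutative K = cocommutative H"
  unfolding pts_def coalg_mor_def conv_unit_def is_coalgebra_def cocommutative_def
    braceD(3-6)[OF assms] by (rule refl)+

lemma skew_brace_pts:
  assumes HK: "is_brace (H, K)" and X: "ccoalg X"
  shows "skew_brace (pts X H) (conv X H) (conv_unit X H) ((\<bullet>) (antipode H))
    (conv X K) ((\<bullet>) (antipode K))"
proof -
  note D = braceD[OF HK] and X' = ccoalgD[OF X]
  note H' = hopf_coalg[OF D(1)] and dH = algD[OF hopf_alg[OF D(1)]]
  note gK = group_on_pts[OF X D(2), unfolded pts_brace[OF HK]]
  have "conv X K a (conv X H b c) = conv X H (conv X K a b) (conv X H (antipode H \<bullet> a) (conv X K a c))"
    if a: "a \<in> pts X H" and b: "b \<in> pts X H" and c: "c \<in> pts X H" for a b c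
  proof -
    note aa = pts_arr[OF X' H' a] and ab = pts_arr[OF X' H' b] and ac = pts_arr[OF X' H' c]
    have "conv X K a (conv X H b c)
        = (mult K \<bullet> (Idm C (obj H) \<otimes> mult H)) \<bullet> pair X a (pair X b c)"
      using eval_tens[OF X' aa arr_pair[OF X' ab ac] arr_id[OF dH(1)] dH(3) D(7)] arr_id_left[OF aa]
      by (simp add: conv_def)
    also have "\<dots> = mult H \<bullet> pair X (mult K \<bullet> pair X a b) (Gam (H, K) \<bullet> pair X a c)"
      unfolding D(8) by (rule eval_module[OF X H' a ab ac D(7) arr_Gam[OF D(1,7)] dH(3)])
    also have "\<dots> = conv X H (conv X K a b) (conv X H (antipode H \<bullet> a) (conv X K a c))"
      unfolding Gam_pair[OF D(1,7) X' a ac] by (simp add: conv_def)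
    finally show ?thesis .
  qed
  then show ?thesis
    by (intro skew_brace.intro group_on_pts[OF X D(1)] gK skew_brace_axioms.intro)
qed

text \<open>Each module axiom is a law of the lambda map \<open>gam\<close>, evaluated at universal
  elements: \<open>gam_e\<close>, \<open>gam_e_right\<close>, \<open>gam_gam\<close> and
  \<open>gam_m\<close>. That \<open>Gam\<close> is a coalgebra morphism is closure of elements under
  \<open>gam\<close> at the universal pair.\<close>

lemma is_rrb_brace:
  assumes HK: "is_brace (H, K)" and co: "cocommutative H"
  shows "is_rrb \<lparr>src = H, tgt = K, opr = Idm C (obj H), act = Gam (H, K)\<rparr>"
proof -
  let ?T = "\<lparr>src = H, tgt = K, opr = Idm C (obj H), act = Gam (H, K)\<rparr>"
  note D = braceD[OF HK] and H = braceD(1)[OF HK] and P = pts_brace[OF HK]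
  note H' = hopf_coalg[OF H] and A = hopf_alg[OF H]
  note dH = algD[OF A] and dC = coalgD[OF H']
  note i = arr_id[OF dH(1)] and m = D(7) and \<Gamma> = arr_Gam[OF D(1,7)]
  have gam: "Gam (H, K) \<bullet> pair X f g = skew_brace.gam (conv X H) ((\<bullet>) (antipode H)) (conv X K) f g"
    if X: "ccoalg X" and f: "f \<in> pts X H" and g: "g \<in> pts X H"
    for X :: "('o, 'm) algcoalg" and f g
    using Gam_pair[OF D(1,7) ccoalgD[OF X] f pts_arr[OF ccoalgD[OF X] H' g]]
    by (simp add: skew_brace.gam_def[OF skew_brace_pts[OF HK X]] conv_def)
  have id_pts: "Idm C (obj H) \<in> pts (core H) H"
    unfolding core_coalg by (simp add: pts_def coalg_mor_id[OF H'])
  have cH: "ccoalg (core H)"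
    using ccoalg_hopf[OF H co] by simp
  interpret U: skew_brace "pts (core H) H" "conv (core H) H" "conv_unit (core H) H"
    "(\<bullet>) (antipode H)" "conv (core H) K" "(\<bullet>) (antipode K)"
    by (rule skew_brace_pts[OF HK cH])
  have unit_act: "Gam (H, K) \<bullet> (unit H \<otimes> Idm C (obj H)) = Idm C (obj H)"
    using U.gam_e[OF id_pts] gam[OF cH U.P.e_closed id_pts] unit_pair(2)[OF H' A] by simp
  have act_unit: "Gam (H, K) \<bullet> (Idm C (obj H) \<otimes> unit H) = counit H \<otimes> unit H"
  proof -
    have "Gam (H, K) \<bullet> (Idm C (obj H) \<otimes> unit H) = unit H \<bullet> counit H"
      using U.gam_e_right[OF id_pts] gam[OF cH id_pts U.P.e_closed] unit_pair(1)[OF H' A]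
      by (simp add: conv_unit_def)
    also have "\<dots> = counit H \<otimes> unit H"
      using arr_interchange[OF dC(2) arr_id[OF unit_ob] arr_id[OF unit_ob] dH(2)]
        arr_id_left[OF dC(2)] arr_id_right[OF dH(2)] dH(1)
        tens_unit(1)[of \<K> "obj H" "unit H"] tens_unit(2)[of "obj H" \<K> "counit H"]
        arrD(3)[OF dH(2)] arrD(3)[OF dC(2)] by simp
    finally show ?thesis .
  qed
  have act_act: "Gam (H, K) \<bullet> (Idm C (obj H) \<otimes> Gam (H, K))
      = Gam (H, K) \<bullet> (mult K \<otimes> Idm C (obj H))"
  proof (rule ext3[OF H co arr_comp[OF arr_tens[OF i \<Gamma>] \<Gamma>]])
    show "arr (Gam (H, K) \<bullet> (mult K \<otimes> Idm C (obj H))) (obj H \<boxtimes> obj H \<boxtimes> obj H) (obj H)"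
      using arr_comp[OF arr_tens[OF m i] \<Gamma>] dH(1) by simp
    fix X :: "('o, 'm) algcoalg" and f g h
    assume X: "ccoalg X" and f: "f \<in> pts X H" and g: "g \<in> pts X H" and h: "h \<in> pts X H"
    note X' = ccoalgD[OF X]
    interpret S: skew_brace "pts X H" "conv X H" "conv_unit X H"
      "(\<bullet>) (antipode H)" "conv X K" "(\<bullet>) (antipode K)"
      by (rule skew_brace_pts[OF HK X])
    note af = pts_arr[OF X' H' f] and ag = pts_arr[OF X' H' g] and ah = pts_arr[OF X' H' h]
    have "(Gam (H, K) \<bullet> (Idm C (obj H) \<otimes> Gam (H, K))) \<bullet> pair X f (pair X g h)
        = S.gam f (S.gam g h)"
      using eval_tens[OF X' af arr_pair[OF X' ag ah] i \<Gamma> \<Gamma>] arr_id_left[OF af]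
        gam[OF X g h] gam[OF X f S.gam_closed[OF g h]] by simp
    moreover have "(Gam (H, K) \<bullet> (mult K \<otimes> Idm C (obj H))) \<bullet> pair X f (pair X g h)
        = S.gam (conv X K f g) h"
      using eval_tens[OF X' arr_pair[OF X' af ag] ah m i \<Gamma>] arr_id_left[OF ah]
        pair_assoc[OF X' af ag ah] gam[OF X S.O.m_closed[OF f g] h] by (simp add: conv_def)
    ultimately show "(Gam (H, K) \<bullet> (Idm C (obj H) \<otimes> Gam (H, K))) \<bullet> pair X f (pair X g h)
        = (Gam (H, K) \<bullet> (mult K \<otimes> Idm C (obj H))) \<bullet> pair X f (pair X g h)"
      using S.gam_gam[OF f g h] by simp
  qed
  have act_mult: "Gam (H, K) \<bullet> (Idm C (obj H) \<otimes> mult H) = mult H \<bullet> (Gam (H, K) \<otimes> Gam (H, K))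
      \<bullet> (Idm C (obj H) \<otimes> \<c> (obj H) (obj H) \<otimes> Idm C (obj H))
      \<bullet> (comult H \<otimes> Idm C (obj H) \<otimes> Idm C (obj H))"
  proof (rule ext3[OF H co arr_comp[OF arr_tens[OF i dH(3)] \<Gamma>] arr_module[OF H' dH(1,1) \<Gamma> \<Gamma> dH(3)]])
    fix X :: "('o, 'm) algcoalg" and f g h
    assume X: "ccoalg X" and f: "f \<in> pts X H" and g: "g \<in> pts X H" and h: "h \<in> pts X H"
    note X' = ccoalgD[OF X]
    interpret S: skew_brace "pts X H" "conv X H" "conv_unit X H"
      "(\<bullet>) (antipode H)" "conv X K" "(\<bullet>) (antipode K)"
      by (rule skew_brace_pts[OF HK X])
    note af = pts_arr[OF X' H' f] and ag = pts_arr[OF X' H' g] and ah = pts_arr[OF X' H' h]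
    have "(Gam (H, K) \<bullet> (Idm C (obj H) \<otimes> mult H)) \<bullet> pair X f (pair X g h)
        = S.gam f (conv X H g h)"
      using eval_tens[OF X' af arr_pair[OF X' ag ah] i dH(3) \<Gamma>] arr_id_left[OF af]
        gam[OF X f S.P.m_closed[OF g h]] by (simp add: conv_def)
    then show "(Gam (H, K) \<bullet> (Idm C (obj H) \<otimes> mult H)) \<bullet> pair X f (pair X g h)
      = (mult H \<bullet> (Gam (H, K) \<otimes> Gam (H, K))
        \<bullet> (Idm C (obj H) \<otimes> \<c> (obj H) (obj H) \<otimes> Idm C (obj H))
        \<bullet> (comult H \<otimes> Idm C (obj H) \<otimes> Idm C (obj H))) \<bullet> pair X f (pair X g h)"
      using eval_module[OF X H' f ag ah \<Gamma> \<Gamma> dH(3)] gam[OF X f g] gam[OF X f h] S.gam_m[OF f g h]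
      by (simp add: conv_def)
  qed
  have mor: "coalg_mor (tensor K H) H (Gam (H, K))"
  proof -
    let ?X = "tensor H H"
    note X = ccoalg_tensor2[OF H co]
    interpret S: skew_brace "pts ?X H" "conv ?X H" "conv_unit ?X H"
      "(\<bullet>) (antipode H)" "conv ?X K" "(\<bullet>) (antipode K)"
      by (rule skew_brace_pts[OF HK X])
    have p: "proj1 H H \<in> pts ?X H" "proj2 H H \<in> pts ?X H"
      using coalg_mor_proj1[OF H' H'] coalg_mor_proj2[OF H' H'] by (simp_all add: pts_def)
    have "coalg_mor ?X H (Gam (H, K))"
      using S.gam_closed[OF p] gam[OF X p] pair_proj[OF H' H'] arr_id_right[OF \<Gamma>]
      by (simp add: pts_def)
    then show ?thesis
      by (simp add: coalg_mor_def tensor_def D)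
  qed
  have module: "is_module_algcoalg K H (Gam (H, K))"
    unfolding is_module_algcoalg_def is_left_module_def D(3-6)
    using A H' dH(1) arrD(3)[OF \<Gamma>] unit_act act_unit act_act act_mult mor by blast
  have \<Gamma>i: "Gam (H, K) \<bullet> (Idm C (obj H) \<otimes> Idm C (obj H)) = Gam (H, K)"
    using arr_id_right[OF \<Gamma>] dH(1) by (simp add: tens_id)
  \<comment> \<open>With the identity as operator, the descendent product of \<open>a\<close> and
    \<open>b\<close> is \<open>a\<close> times \<open>gam a b\<close>, which is the circle product
    by \<open>m_gam\<close>. The Rota-Baxter equation thereby reduces to the multiplicativity of an
    identity.\<close>
  have rm: "rrb_mult ?T = mult K"
  proof (rule ext2[OF H co])
    show "arr (rrb_mult ?T) (obj H \<boxtimes> obj H) (obj H)"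
      unfolding rrb_mult_def rrb.simps \<Gamma>i by (rule arr_dup[OF H' dH(1) i \<Gamma> dH(3)])
    show "arr (mult K) (obj H \<boxtimes> obj H) (obj H)" by (rule m)
    fix X :: "('o, 'm) algcoalg" and f g
    assume X: "ccoalg X" and f: "f \<in> pts X H" and g: "g \<in> pts X H"
    note X' = ccoalgD[OF X]
    interpret S: skew_brace "pts X H" "conv X H" "conv_unit X H"
      "(\<bullet>) (antipode H)" "conv X K" "(\<bullet>) (antipode K)"
      by (rule skew_brace_pts[OF HK X])
    note af = pts_arr[OF X' H' f] and ag = pts_arr[OF X' H' g]
    show "rrb_mult ?T \<bullet> pair X f g = mult K \<bullet> pair X f g"
      unfolding rrb_mult_def rrb.simps \<Gamma>i
      using eval_dup[OF X' H' f ag i \<Gamma> dH(3)] arr_id_left[OF af] gam[OF X f g] S.m_gam[OF f g]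
      by (simp add: conv_def)
  qed
  have "coalg_mor H K (Idm C (obj H))"
    using coalg_mor_id[OF H'] by (simp add: coalg_mor_def D)
  moreover have "mult K \<bullet> (Idm C (obj H) \<otimes> Idm C (obj H)) = Idm C (obj H) \<bullet> mult K"
    using arr_id_right[OF m] arr_id_left[OF m] dH(1) by (simp add: tens_id)
  ultimately show ?thesis
    unfolding is_rrb_def rm rrb.simps using D(1,2) module by blast
qed

text \<open>For an identity operator the Rota-Baxter equation reads exactly so. Hence
  \<open>R\<close> after \<open>Q\<close> restores the second product of a brace.\<close>

lemma rrb_mult_brace:
  assumes HK: "is_brace (H, K)" and co: "cocommutative H"
  shows "rrb_mult \<lparr>src = H, tgt = K, opr = Idm C (obj H), act = Gam (H, K)\<rparr> = mult K"
  (is "rrb_mult ?T = _")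
proof -
  note T = is_rrb_brace[OF HK co] and D = braceD[OF HK]
  have "mult K \<bullet> (Idm C (obj H) \<otimes> Idm C (obj H)) = Idm C (obj H) \<bullet> rrb_mult ?T"
    using rrbD(5)[OF T] by simp
  then show ?thesis
    using arr_id_right[OF D(7)] arr_id_left[OF arr_rrb_mult[OF T]] algD(1)[OF hopf_alg[OF D(1)]]
    by (simp add: tens_id)
qed

section \<open>The adjunction\<close>

lemma alg_mor_comp:
  assumes X: "is_algebra X" and Y: "is_algebra Y" and Z: "is_algebra Z"
    and f: "alg_mor X Y f" and g: "alg_mor Y Z g"
  shows "alg_mor X Z (g \<bullet> f)"
proof -
  note dX = algD[OF X] and dY = algD[OF Y] and dZ = algD[OF Z]
  have af: "arr f (obj X) (obj Y)" and ag: "arr g (obj Y) (obj Z)"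
    using f g dX(1) dY(1) dZ(1) by (simp_all add: alg_mor_def arr_def)
  have "(g \<bullet> f) \<bullet> mult X = g \<bullet> mult Y \<bullet> (f \<otimes> f)"
    using arr_assoc[OF dX(3) af ag] f by (simp add: alg_mor_def)
  also have "\<dots> = mult Z \<bullet> (g \<otimes> g) \<bullet> (f \<otimes> f)"
    using arr_assoc[OF arr_tens[OF af af] dY(3) ag] g
      arr_assoc[OF arr_tens[OF af af] arr_tens[OF ag ag] dZ(3)] by (simp add: alg_mor_def)
  also have "\<dots> = mult Z \<bullet> ((g \<bullet> f) \<otimes> (g \<bullet> f))"
    using arr_interchange[OF af ag af ag] by simp
  finally show ?thesis
    using arr_assoc[OF dX(2) af ag] f g arrD(3)[OF arr_comp[OF af ag]] by (simp add: alg_mor_def)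
qed

lemma alg_mor_id: "is_algebra X \<Longrightarrow> alg_mor X X (Idm C (obj X))"
  using algD[of X] arr_id_left[of "unit X"] arr_id_left[of "mult X"] arr_id_right[of "mult X"]
  by (auto simp: alg_mor_def id_hom tens_id)

lemma hopf_mor_arr: "\<lbrakk>is_hopf X; is_hopf Y; hopf_mor X Y f\<rbrakk> \<Longrightarrow> arr f (obj X) (obj Y)"
  by (rule coalg_mor_arr) (simp_all add: hopf_mor_def hopf_coalg)

lemma hopf_mor_comp:
  "\<lbrakk>is_hopf X; is_hopf Y; is_hopf Z; hopf_mor X Y f; hopf_mor Y Z g\<rbrakk> \<Longrightarrow> hopf_mor X Z (g \<bullet> f)"
  by (simp add: hopf_mor_def alg_mor_comp[of X Y Z] coalg_mor_comp[of X Y Z] hopf_alg hopf_coalg)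

lemma hopf_mor_id: "is_hopf X \<Longrightarrow> hopf_mor X X (Idm C (obj X))"
  by (simp add: hopf_mor_def coalg_mor_id alg_mor_id hopf_coalg hopf_alg)

lemma hopf_mor_pts:
  assumes H: "is_hopf H" and D: "is_hopf D" and x: "hopf_mor H D x" and X: "ccoalg X"
  shows "f \<in> pts X H \<Longrightarrow> x \<bullet> f \<in> pts X D"
    and "f \<in> pts X H \<Longrightarrow> g \<in> pts X H \<Longrightarrow> x \<bullet> conv X H f g = conv X D (x \<bullet> f) (x \<bullet> g)"
    and "f \<in> pts X H \<Longrightarrow> x \<bullet> antipode H \<bullet> f = antipode D \<bullet> x \<bullet> f"
proof -
  note X' = ccoalgD[OF X] and H' = hopf_coalg[OF H] and D' = hopf_coalg[OF D]
  have xm: "coalg_mor H D x" "alg_mor H D x"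
    using x by (simp_all add: hopf_mor_def)
  show cl: "x \<bullet> f \<in> pts X D" if "f \<in> pts X H" for f
    using coalg_mor_comp[OF X' H' D' _ xm(1)] that by (simp add: pts_def)
  show hom: "x \<bullet> conv X H f g = conv X D (x \<bullet> f) (x \<bullet> g)" if "f \<in> pts X H" "g \<in> pts X H" for f g
    by (rule conv_comp_left(1)[OF X' hopf_alg[OF H] hopf_alg[OF D] xm(2)])
      (use that pts_arr[OF X' H'] in blast)+
  show "x \<bullet> antipode H \<bullet> f = antipode D \<bullet> x \<bullet> f" if "f \<in> pts X H"
    by (rule group_on_hom_i[where f = "(\<bullet>) x" and i = "(\<bullet>) (antipode H)" and i' = "(\<bullet>) (antipode D)",
          OF group_on_pts[OF X H] group_on_pts[OF X D] cl hom that])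
qed

lemma brace_mor_iff: "brace_mor (H, K) (D, E) x \<longleftrightarrow> hopf_mor H D x \<and> hopf_mor K E x"
  by (simp add: brace_mor_def)

text \<open>\<open>Gam\<close> is built from the two products and the first antipode. A brace
  morphism respects the products by definition, and the antipode as a homomorphism of groups of
  elements.\<close>

lemma rrb_mor_brace:
  assumes HK: "is_brace (H, K)" and co: "cocommutative H" and DE: "is_brace (D, E)"
    and x: "brace_mor (H, K) (D, E) x"
  shows "rrb_mor \<lparr>src = H, tgt = K, opr = Idm C (obj H), act = Gam (H, K)\<rparr>
    \<lparr>src = D, tgt = E, opr = Idm C (obj D), act = Gam (D, E)\<rparr> x x"
proof -
  note HD = braceD[OF HK] and DD = braceD[OF DE]
  have x1: "hopf_mor H D x" and x2: "hopf_mor K E x"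
    using x by (simp_all add: brace_mor_iff)
  note ax = hopf_mor_arr[OF HD(1) DD(1) x1] and H' = hopf_coalg[OF HD(1)] and D' = hopf_coalg[OF DD(1)]
  note \<Gamma> = arr_Gam[OF HD(1,7)] and \<Delta> = arr_Gam[OF DD(1,7)]
  have "x \<bullet> Gam (H, K) = Gam (D, E) \<bullet> (x \<otimes> x)"
  proof (rule ext2[OF HD(1) co arr_comp[OF \<Gamma> ax] arr_comp[OF arr_tens[OF ax ax] \<Delta>]])
    fix X :: "('o, 'm) algcoalg" and f g
    assume X: "ccoalg X" and f: "f \<in> pts X H" and g: "g \<in> pts X H"
    note X' = ccoalgD[OF X] and x1_pts = hopf_mor_pts[OF HD(1) DD(1) x1 X]
      and x2_pts = hopf_mor_pts[OF HD(2) DD(2) x2 X, unfolded pts_brace[OF HK] pts_brace[OF DE]]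
    note af = pts_arr[OF X' H' f] and ag = pts_arr[OF X' H' g]
    interpret P: group_on "pts X H" "conv X H" "conv_unit X H" "(\<bullet>) (antipode H)"
      by (rule group_on_pts[OF X HD(1)])
    interpret S: skew_brace "pts X H" "conv X H" "conv_unit X H"
      "(\<bullet>) (antipode H)" "conv X K" "(\<bullet>) (antipode K)"
      by (rule skew_brace_pts[OF HK X])
    have "(x \<bullet> Gam (H, K)) \<bullet> pair X f g = x \<bullet> conv X H (antipode H \<bullet> f) (conv X K f g)"
      using arr_assoc[OF arr_pair[OF X' af ag] \<Gamma> ax] Gam_pair[OF HD(1,7) X' f ag]
      by (simp add: conv_def)
    also have "\<dots> = conv X D (antipode D \<bullet> x \<bullet> f) (conv X E (x \<bullet> f) (x \<bullet> g))"
      using x1_pts(2)[OF P.i_closed[OF f] S.O.m_closed[OF f g]] x1_pts(3)[OF f] x2_pts(2)[OF f g]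
      by simp
    also have "\<dots> = Gam (D, E) \<bullet> pair X (x \<bullet> f) (x \<bullet> g)"
      using Gam_pair[OF DD(1,7) X' x1_pts(1)[OF f] pts_arr[OF X' D' x1_pts(1)[OF g]]]
      by (simp add: conv_def)
    also have "\<dots> = (Gam (D, E) \<bullet> (x \<otimes> x)) \<bullet> pair X f g"
      by (rule eval_tens[OF X' af ag ax ax \<Delta>, symmetric])
    finally show "(x \<bullet> Gam (H, K)) \<bullet> pair X f g = (Gam (D, E) \<bullet> (x \<otimes> x)) \<bullet> pair X f g" .
  qed
  then show ?thesis
    using x1 x2 arr_id_left[OF ax] arr_id_right[OF ax] by (simp add: rrb_mor_def)
qed

text \<open>Compatibility with the operators and with the actions combines to show that
  \<open>f\<close> carries the action of \<open>opr T \<bullet> u\<close> to that of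
  \<open>opr L \<bullet> f \<bullet> u\<close>; together with the old products this gives the new
  ones.\<close>

lemma brace_mor_bar:
  assumes T: "is_rrb T" and co: "cocommutative (src T)" and L: "is_rrb L"
    and f: "rrb_mor T L f h"
  shows "brace_mor (src T, bar T) (src L, bar L) f"
proof -
  note H = rrbD(1)[OF T] and A = rrbD(1)[OF L]
  note H' = hopf_coalg[OF H] and A' = hopf_coalg[OF A]
  have f1: "hopf_mor (src T) (src L) f" and h: "hopf_mor (tgt T) (tgt L) h"
    and opr: "opr L \<bullet> f = h \<bullet> opr T" and act: "f \<bullet> act T = act L \<bullet> (h \<otimes> f)"
    using f by (simp_all add: rrb_mor_def)
  note af = hopf_mor_arr[OF H A f1] and ah = hopf_mor_arr[OF rrbD(2)[OF T] rrbD(2)[OF L] h]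
  note m = arr_rrb_mult[OF T] and m' = arr_rrb_mult[OF L]
  have "f \<bullet> rrb_mult T = rrb_mult L \<bullet> (f \<otimes> f)"
  proof (rule ext2[OF H co arr_comp[OF m af] arr_comp[OF arr_tens[OF af af] m']])
    fix X :: "('o, 'm) algcoalg" and u v
    assume X: "ccoalg X" and u: "u \<in> pts X (src T)" and v: "v \<in> pts X (src T)"
    note X' = ccoalgD[OF X] and f_pts = hopf_mor_pts[OF H A f1 X]
    note au = pts_arr[OF X' H' u] and av = pts_arr[OF X' H' v]
    interpret P: rrb_group "pts X (src T)" "conv X (src T)" "conv_unit X (src T)"
      "(\<bullet>) (antipode (src T))" "pts X (tgt T)" "conv X (tgt T)" "conv_unit X (tgt T)"
      "(\<bullet>) (antipode (tgt T))" "\<lambda>b h. act T \<bullet> pair X b h" "(\<bullet>) (opr T)"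
      by (rule rrb_group_pts[OF T X])
    note Tu = P.T_closed[OF u] and aTu = arr_comp[OF au rrbD(6)[OF T]]
    have "f \<bullet> act T \<bullet> pair X (opr T \<bullet> u) v = (act L \<bullet> (h \<otimes> f)) \<bullet> pair X (opr T \<bullet> u) v"
      using arr_assoc[OF arr_pair[OF X' aTu av] rrbD(7)[OF T] af] act by simp
    also have "\<dots> = act L \<bullet> pair X (h \<bullet> opr T \<bullet> u) (f \<bullet> v)"
      by (rule eval_tens[OF X' aTu av ah af rrbD(7)[OF L]])
    also have "h \<bullet> opr T \<bullet> u = opr L \<bullet> f \<bullet> u"
      using arr_assoc[OF au rrbD(6)[OF T] ah] arr_assoc[OF au af rrbD(6)[OF L]] opr by simp
    finally have act_uv: "f \<bullet> act T \<bullet> pair X (opr T \<bullet> u) v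
      = act L \<bullet> pair X (opr L \<bullet> f \<bullet> u) (f \<bullet> v)" .
    have "(f \<bullet> rrb_mult T) \<bullet> pair X u v
        = f \<bullet> conv X (src T) u (act T \<bullet> pair X (opr T \<bullet> u) v)"
      using arr_assoc[OF arr_pair[OF X' au av] m af] rrb_mult_pair[OF T X' u av] by simp
    also have "\<dots> = conv X (src L) (f \<bullet> u) (act L \<bullet> pair X (opr L \<bullet> f \<bullet> u) (f \<bullet> v))"
      unfolding act_uv[symmetric] by (rule f_pts(2)[OF u P.act_closed[OF Tu v]])
    also have "\<dots> = rrb_mult L \<bullet> pair X (f \<bullet> u) (f \<bullet> v)"
      by (rule rrb_mult_pair[OF L X' f_pts(1)[OF u] pts_arr[OF X' A' f_pts(1)[OF v]], symmetric])
    also have "\<dots> = (rrb_mult L \<bullet> (f \<otimes> f)) \<bullet> pair X u v"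
      by (rule eval_tens[OF X' au av af af m', symmetric])
    finally show "(f \<bullet> rrb_mult T) \<bullet> pair X u v = (rrb_mult L \<bullet> (f \<otimes> f)) \<bullet> pair X u v" .
  qed
  then show ?thesis
    using f1 by (simp add: brace_mor_iff hopf_mor_def alg_mor_def coalg_mor_def)
qed

lemma rrb_mor_comp:
  assumes T: "is_rrb T" and L: "is_rrb L" and M: "is_rrb M"
    and f: "rrb_mor T L f h" and g: "rrb_mor L M f' h'"
  shows "rrb_mor T M (f' \<bullet> f) (h' \<bullet> h)"
proof -
  note DT = rrbD[OF T] and DL = rrbD[OF L] and DM = rrbD[OF M]
  have f: "hopf_mor (src T) (src L) f" "hopf_mor (tgt T) (tgt L) h" "opr L \<bullet> f = h \<bullet> opr T"
    "f \<bullet> act T = act L \<bullet> (h \<otimes> f)" using f by (simp_all add: rrb_mor_def)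
  have g: "hopf_mor (src L) (src M) f'" "hopf_mor (tgt L) (tgt M) h'" "opr M \<bullet> f' = h' \<bullet> opr L"
    "f' \<bullet> act L = act M \<bullet> (h' \<otimes> f')" using g by (simp_all add: rrb_mor_def)
  note af = hopf_mor_arr[OF DT(1) DL(1) f(1)] and ah = hopf_mor_arr[OF DT(2) DL(2) f(2)]
  note af' = hopf_mor_arr[OF DL(1) DM(1) g(1)] and ah' = hopf_mor_arr[OF DL(2) DM(2) g(2)]
  have "opr M \<bullet> f' \<bullet> f = (h' \<bullet> opr L) \<bullet> f"
    using arr_assoc[OF af af' DM(6)] g(3) by simp
  also have "\<dots> = (h' \<bullet> h) \<bullet> opr T"
    using arr_assoc[OF af DL(6) ah'] arr_assoc[OF DT(6) ah ah'] f(3) by simp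
  finally have opr: "opr M \<bullet> f' \<bullet> f = (h' \<bullet> h) \<bullet> opr T" .
  have "(f' \<bullet> f) \<bullet> act T = f' \<bullet> act L \<bullet> (h \<otimes> f)"
    using arr_assoc[OF DT(7) af af'] f(4) by simp
  also have "\<dots> = (act M \<bullet> (h' \<otimes> f')) \<bullet> (h \<otimes> f)"
    using arr_assoc[OF arr_tens[OF ah af] DL(7) af'] g(4) by simp
  also have "\<dots> = act M \<bullet> ((h' \<bullet> h) \<otimes> (f' \<bullet> f))"
    using arr_assoc[OF arr_tens[OF ah af] arr_tens[OF ah' af'] DM(7)]
      arr_interchange[OF ah ah' af af'] by simp
  finally show ?thesis
    using opr hopf_mor_comp[OF DT(1) DL(1) DM(1) f(1) g(1)]
      hopf_mor_comp[OF DT(2) DL(2) DM(2) f(2) g(2)] by (simp add: rrb_mor_def)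
qed

lemma rrb_mor_id:
  assumes T: "is_rrb T"
  shows "rrb_mor T T (Idm C (obj (src T))) (Idm C (obj (tgt T)))"
  using rrbD(1,2)[OF T] hopf_mor_id[of "src T"] hopf_mor_id[of "tgt T"]
    arr_id_left[OF rrbD(6)[OF T]] arr_id_right[OF rrbD(6)[OF T]]
    arr_id_left[OF rrbD(7)[OF T]] arr_id_right[OF rrbD(7)[OF T]]
    algD(1)[OF hopf_alg[of "src T"]] algD(1)[OF hopf_alg[of "tgt T"]]
  by (simp add: rrb_mor_def tens_id)

text \<open>Pasting of two commutative squares, the form of every condition that relates morphisms
  of projections to the maps of the projections.\<close>

lemma square_comp:
  assumes "arr x A B" "arr x' A' B'" "arr x'' A'' B''" "arr z A A'" "arr z' A' A''"
    "arr t B B'" "arr t' B' B''" and "x' \<bullet> z = t \<bullet> x" "x'' \<bullet> z' = t' \<bullet> x'"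
  shows "x'' \<bullet> z' \<bullet> z = (t' \<bullet> t) \<bullet> x"
  using arr_assoc[OF assms(4,5,3)] arr_assoc[OF assms(4,2,7)] arr_assoc[OF assms(1,6,7)] assms(8,9)
  by simp

section \<open>The categories of projections\<close>

lemma P_coc_HBr_Ob [simp]:
  "((H, K), (D, E), x, y) \<in> Ob P_coc_HBr \<longleftrightarrow> is_brace (H, K) \<and> cocommutative H
    \<and> is_brace (D, E) \<and> cocommutative D \<and> brace_mor (H, K) (D, E) x \<and> brace_mor (D, E) (H, K) y
    \<and> y \<bullet> x = Idm C (obj H)"
  by (auto simp: P_coc_HBr_def coc_HBr_def)

lemma P_coc_HBr_Hom [simp]:
  "(z, t) \<in> Hom P_coc_HBr (HH, DD, x, y) (HH', DD', x', y') \<longleftrightarrow> brace_mor HH HH' z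
    \<and> brace_mor DD DD' t \<and> x' \<bullet> z = t \<bullet> x \<and> y' \<bullet> t = z \<bullet> y"
  by (auto simp: P_coc_HBr_def coc_HBr_def)

lemma P_coc_HBr_cat [simp]:
  "Idm P_coc_HBr (HH, DD, x, y) = (Idm C (obj (fst HH)), Idm C (obj (fst DD)))"
  "(z', t') \<bullet>\<^bsub>P_coc_HBr\<^esub> (z, t) = (z' \<bullet> z, t' \<bullet> t)"
  by (simp_all add: P_coc_HBr_def coc_HBr_def)

lemma P_rRB_star_Ob [simp]:
  "(T, L, f, h, g, l) \<in> Ob P_rRB_star \<longleftrightarrow> is_rrb T \<and> cocommutative (src T)
    \<and> is_rrb L \<and> cocommutative (src L) \<and> hopf_proj (src T) (src L) f g
    \<and> hopf_proj (tgt T) (tgt L) h l \<and> rrb_mor T L f h \<and> rrb_mor L T g l"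
  by (auto simp: P_rRB_star_def rRB_star_def rRB_def)

lemma P_rRB_star_Hom [simp]:
  "(x, y, z, t) \<in> Hom P_rRB_star (T, L, f, h, g, l) (T', L', f', h', g', l') \<longleftrightarrow>
    y \<bullet> f = f' \<bullet> x \<and> x \<bullet> g = g' \<bullet> y \<and> t \<bullet> h = h' \<bullet> z \<and> z \<bullet> l = l' \<bullet> t
    \<and> rrb_mor T T' x z \<and> rrb_mor L L' y t"
  by (auto simp: P_rRB_star_def rRB_star_def rRB_def hopf_proj_mor_def rrb_mor_def)

lemma P_rRB_star_cat [simp]:
  "Idm P_rRB_star (T, L, f, h, g, l)
    = (Idm C (obj (src T)), Idm C (obj (src L)), Idm C (obj (tgt T)), Idm C (obj (tgt L)))"
  "(x', y', z', t') \<bullet>\<^bsub>P_rRB_star\<^esub> (x, y, z, t) = (x' \<bullet> x, y' \<bullet> y, z' \<bullet> z, t' \<bullet> t)"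
  by (simp_all add: P_rRB_star_def)

lemma brace_mor_arr:
  "\<lbrakk>is_brace (H, K); is_brace (D, E); brace_mor (H, K) (D, E) x\<rbrakk> \<Longrightarrow> arr x (obj H) (obj D)"
  unfolding brace_mor_iff by (rule hopf_mor_arr[OF braceD(1) braceD(1)]) auto

lemma brace_mor_comp:
  "\<lbrakk>is_brace (H, K); is_brace (D, E); is_brace (M, N); brace_mor (H, K) (D, E) x;
    brace_mor (D, E) (M, N) y\<rbrakk> \<Longrightarrow> brace_mor (H, K) (M, N) (y \<bullet> x)"
  using hopf_mor_comp[of H D M x y] hopf_mor_comp[of K E N x y]
  by (simp add: brace_mor_iff braceD(1,2))

lemma brace_mor_id: "is_brace (H, K) \<Longrightarrow> brace_mor (H, K) (H, K) (Idm C (obj H))"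
  unfolding brace_mor_iff using hopf_mor_id[of H] hopf_mor_id[of K] braceD(1-3)[of H K] by simp

lemma category_P_coc_HBr: "category P_coc_HBr"
proof
  fix A assume A: "A \<in> Ob P_coc_HBr"
  obtain H K D E x y where A_eq: "A = ((H, K), (D, E), x, y)" by (metis prod.exhaust)
  show "Idm P_coc_HBr A \<in> Hom P_coc_HBr A A"
    using A brace_mor_id[of H K] brace_mor_id[of D E] brace_mor_arr[of H K D E x]
      brace_mor_arr[of D E H K y] arr_id_left[of x] arr_id_right[of x] arr_id_left[of y]
      arr_id_right[of y] by (auto simp: A_eq)
next
  fix A B f assume A: "A \<in> Ob P_coc_HBr" and B: "B \<in> Ob P_coc_HBr" and f: "f \<in> Hom P_coc_HBr A B"
  obtain H K D E x y where A_eq: "A = ((H, K), (D, E), x, y)" by (metis prod.exhaust)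
  obtain H' K' D' E' x' y' where B_eq: "B = ((H', K'), (D', E'), x', y')" by (metis prod.exhaust)
  obtain z t where f_eq: "f = (z, t)" by (metis prod.exhaust)
  have "arr z (obj H) (obj H')" "arr t (obj D) (obj D')"
    using A B f brace_mor_arr[of H K H' K' z] brace_mor_arr[of D E D' E' t]
    by (auto simp: A_eq B_eq f_eq)
  then show "f \<bullet>\<^bsub>P_coc_HBr\<^esub> Idm P_coc_HBr A = f" "Idm P_coc_HBr B \<bullet>\<^bsub>P_coc_HBr\<^esub> f = f"
    by (simp_all add: A_eq B_eq f_eq arr_id_left arr_id_right)
next
  fix A B Z f g
  assume A: "A \<in> Ob P_coc_HBr" and B: "B \<in> Ob P_coc_HBr" and Z: "Z \<in> Ob P_coc_HBr"
    and f: "f \<in> Hom P_coc_HBr A B" and g: "g \<in> Hom P_coc_HBr B Z"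
  obtain H K D E x y where A_eq: "A = ((H, K), (D, E), x, y)" by (metis prod.exhaust)
  obtain H' K' D' E' x' y' where B_eq: "B = ((H', K'), (D', E'), x', y')" by (metis prod.exhaust)
  obtain H'' K'' D'' E'' x'' y'' where Z_eq: "Z = ((H'', K''), (D'', E''), x'', y'')"
    by (metis prod.exhaust)
  obtain z t where f_eq: "f = (z, t)" by (metis prod.exhaust)
  obtain z' t' where g_eq: "g = (z', t')" by (metis prod.exhaust)
  note A = A[unfolded A_eq P_coc_HBr_Ob] and B = B[unfolded B_eq P_coc_HBr_Ob]
    and Z = Z[unfolded Z_eq P_coc_HBr_Ob] and f = f[unfolded A_eq B_eq f_eq P_coc_HBr_Hom]
    and g = g[unfolded Z_eq B_eq g_eq P_coc_HBr_Hom]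
  have ar: "arr z (obj H) (obj H')" "arr t (obj D) (obj D')" "arr z' (obj H') (obj H'')"
    "arr t' (obj D') (obj D'')" "arr x (obj H) (obj D)" "arr y (obj D) (obj H)"
    "arr x' (obj H') (obj D')" "arr y' (obj D') (obj H')" "arr x'' (obj H'') (obj D'')"
    "arr y'' (obj D'') (obj H'')"
    using A B Z f g brace_mor_arr by blast+
  have "x'' \<bullet> z' \<bullet> z = (t' \<bullet> t) \<bullet> x"
    using square_comp[OF ar(5,7,9,1,3,2,4)] f g by simp
  moreover have "y'' \<bullet> t' \<bullet> t = (z' \<bullet> z) \<bullet> y"
    using square_comp[OF ar(6,8,10,2,4,1,3)] f g by simp
  moreover have "brace_mor (H, K) (H'', K'') (z' \<bullet> z)" "brace_mor (D, E) (D'', E'') (t' \<bullet> t)"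
    using A B Z f g brace_mor_comp by meson+
  ultimately show "g \<bullet>\<^bsub>P_coc_HBr\<^esub> f \<in> Hom P_coc_HBr A Z"
    by (simp add: A_eq Z_eq f_eq g_eq)
next
  fix A B Z W f g h
  assume A: "A \<in> Ob P_coc_HBr" and B: "B \<in> Ob P_coc_HBr" and Z: "Z \<in> Ob P_coc_HBr"
    and W: "W \<in> Ob P_coc_HBr"
    and f: "f \<in> Hom P_coc_HBr A B" and g: "g \<in> Hom P_coc_HBr B Z" and h: "h \<in> Hom P_coc_HBr Z W"
  obtain H1 K1 D1 E1 x1 y1 where 1: "A = ((H1, K1), (D1, E1), x1, y1)" by (metis prod.exhaust)
  obtain H2 K2 D2 E2 x2 y2 where 2: "B = ((H2, K2), (D2, E2), x2, y2)" by (metis prod.exhaust)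
  obtain H3 K3 D3 E3 x3 y3 where 3: "Z = ((H3, K3), (D3, E3), x3, y3)" by (metis prod.exhaust)
  obtain H4 K4 D4 E4 x4 y4 where 4: "W = ((H4, K4), (D4, E4), x4, y4)" by (metis prod.exhaust)
  obtain z t z' t' z'' t'' where m: "f = (z, t)" "g = (z', t')" "h = (z'', t'')"
    by (metis prod.exhaust)
  have "arr z (obj H1) (obj H2)" "arr t (obj D1) (obj D2)" "arr z' (obj H2) (obj H3)"
    "arr t' (obj D2) (obj D3)" "arr z'' (obj H3) (obj H4)" "arr t'' (obj D3) (obj D4)"
    using A B Z W f g h brace_mor_arr unfolding 1 2 3 4 m P_coc_HBr_Ob P_coc_HBr_Hom by blast+
  then show "(h \<bullet>\<^bsub>P_coc_HBr\<^esub> g) \<bullet>\<^bsub>P_coc_HBr\<^esub> f = h \<bullet>\<^bsub>P_coc_HBr\<^esub> (g \<bullet>\<^bsub>P_coc_HBr\<^esub> f)"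
    by (simp add: m arr_assoc)
qed

lemma rrb_mor_arr:
  assumes "is_rrb T" "is_rrb L" "rrb_mor T L f h"
  shows "arr f (obj (src T)) (obj (src L))" "arr h (obj (tgt T)) (obj (tgt L))"
  using assms hopf_mor_arr rrbD(1,2) unfolding rrb_mor_def by blast+

lemma category_P_rRB_star: "category P_rRB_star"
proof
  fix A assume A: "A \<in> Ob P_rRB_star"
  obtain T L f h g l where A_eq: "A = (T, L, f, h, g, l)" by (metis prod.exhaust)
  note A = A[unfolded A_eq P_rRB_star_Ob]
  have "arr f (obj (src T)) (obj (src L))" "arr h (obj (tgt T)) (obj (tgt L))"
    "arr g (obj (src L)) (obj (src T))" "arr l (obj (tgt L)) (obj (tgt T))"
    using A rrb_mor_arr by blast+
  then show "Idm P_rRB_star A \<in> Hom P_rRB_star A A"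
    using A rrb_mor_id[of T] rrb_mor_id[of L] by (simp add: A_eq arr_id_left arr_id_right)
next
  fix A B m assume A: "A \<in> Ob P_rRB_star" and B: "B \<in> Ob P_rRB_star" and m: "m \<in> Hom P_rRB_star A B"
  obtain T L f h g l where A_eq: "A = (T, L, f, h, g, l)" by (metis prod.exhaust)
  obtain T' L' f' h' g' l' where B_eq: "B = (T', L', f', h', g', l')" by (metis prod.exhaust)
  obtain x y z t where m_eq: "m = (x, y, z, t)" by (metis prod.exhaust)
  have "arr x (obj (src T)) (obj (src T'))" "arr z (obj (tgt T)) (obj (tgt T'))"
    "arr y (obj (src L)) (obj (src L'))" "arr t (obj (tgt L)) (obj (tgt L'))"
    using A B m rrb_mor_arr unfolding A_eq B_eq m_eq P_rRB_star_Ob P_rRB_star_Hom by blast+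
  then show "m \<bullet>\<^bsub>P_rRB_star\<^esub> Idm P_rRB_star A = m" "Idm P_rRB_star B \<bullet>\<^bsub>P_rRB_star\<^esub> m = m"
    by (simp_all add: A_eq B_eq m_eq arr_id_left arr_id_right)
next
  fix A B Z m n
  assume A: "A \<in> Ob P_rRB_star" and B: "B \<in> Ob P_rRB_star" and Z: "Z \<in> Ob P_rRB_star"
    and m: "m \<in> Hom P_rRB_star A B" and n: "n \<in> Hom P_rRB_star B Z"
  obtain T L f h g l where A_eq: "A = (T, L, f, h, g, l)" by (metis prod.exhaust)
  obtain T' L' f' h' g' l' where B_eq: "B = (T', L', f', h', g', l')" by (metis prod.exhaust)
  obtain T'' L'' f'' h'' g'' l'' where Z_eq: "Z = (T'', L'', f'', h'', g'', l'')"
    by (metis prod.exhaust)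
  obtain x y z t where m_eq: "m = (x, y, z, t)" by (metis prod.exhaust)
  obtain x' y' z' t' where n_eq: "n = (x', y', z', t')" by (metis prod.exhaust)
  note A = A[unfolded A_eq P_rRB_star_Ob] and B = B[unfolded B_eq P_rRB_star_Ob]
    and Z = Z[unfolded Z_eq P_rRB_star_Ob] and m = m[unfolded A_eq B_eq m_eq P_rRB_star_Hom]
    and n = n[unfolded Z_eq B_eq n_eq P_rRB_star_Hom]
  have xy: "arr x (obj (src T)) (obj (src T'))" "arr y (obj (src L)) (obj (src L'))"
    "arr x' (obj (src T')) (obj (src T''))" "arr y' (obj (src L')) (obj (src L''))"
    and zt: "arr z (obj (tgt T)) (obj (tgt T'))" "arr t (obj (tgt L)) (obj (tgt L'))"
    "arr z' (obj (tgt T')) (obj (tgt T''))" "arr t' (obj (tgt L')) (obj (tgt L''))"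
    using A B Z m n rrb_mor_arr by blast+
  have fg: "arr f (obj (src T)) (obj (src L))" "arr g (obj (src L)) (obj (src T))"
    "arr f' (obj (src T')) (obj (src L'))" "arr g' (obj (src L')) (obj (src T'))"
    "arr f'' (obj (src T'')) (obj (src L''))" "arr g'' (obj (src L'')) (obj (src T''))"
    and hl: "arr h (obj (tgt T)) (obj (tgt L))" "arr l (obj (tgt L)) (obj (tgt T))"
    "arr h' (obj (tgt T')) (obj (tgt L'))" "arr l' (obj (tgt L')) (obj (tgt T'))"
    "arr h'' (obj (tgt T'')) (obj (tgt L''))" "arr l'' (obj (tgt L'')) (obj (tgt T''))"
    using A B Z rrb_mor_arr by blast+
  have "f'' \<bullet> x' \<bullet> x = (y' \<bullet> y) \<bullet> f" "g'' \<bullet> y' \<bullet> y = (x' \<bullet> x) \<bullet> g"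
    "h'' \<bullet> z' \<bullet> z = (t' \<bullet> t) \<bullet> h" "l'' \<bullet> t' \<bullet> t = (z' \<bullet> z) \<bullet> l"
    using square_comp[OF fg(1,3,5) xy(1,3,2,4)] square_comp[OF fg(2,4,6) xy(2,4,1,3)]
      square_comp[OF hl(1,3,5) zt(1,3,2,4)] square_comp[OF hl(2,4,6) zt(2,4,1,3)] m n
    by simp_all
  moreover have "rrb_mor T T'' (x' \<bullet> x) (z' \<bullet> z)" "rrb_mor L L'' (y' \<bullet> y) (t' \<bullet> t)"
    using A B Z m n rrb_mor_comp by blast+
  ultimately show "n \<bullet>\<^bsub>P_rRB_star\<^esub> m \<in> Hom P_rRB_star A Z"
    by (simp add: A_eq Z_eq m_eq n_eq)
next
  fix A B Z W m n p
  assume A: "A \<in> Ob P_rRB_star" and B: "B \<in> Ob P_rRB_star" and Z: "Z \<in> Ob P_rRB_star"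
    and W: "W \<in> Ob P_rRB_star"
    and m: "m \<in> Hom P_rRB_star A B" and n: "n \<in> Hom P_rRB_star B Z" and p: "p \<in> Hom P_rRB_star Z W"
  obtain T1 L1 f1 h1 g1 l1 where 1: "A = (T1, L1, f1, h1, g1, l1)" by (metis prod.exhaust)
  obtain T2 L2 f2 h2 g2 l2 where 2: "B = (T2, L2, f2, h2, g2, l2)" by (metis prod.exhaust)
  obtain T3 L3 f3 h3 g3 l3 where 3: "Z = (T3, L3, f3, h3, g3, l3)" by (metis prod.exhaust)
  obtain T4 L4 f4 h4 g4 l4 where 4: "W = (T4, L4, f4, h4, g4, l4)" by (metis prod.exhaust)
  obtain x y z t where mm: "m = (x, y, z, t)" by (metis prod.exhaust)
  obtain x' y' z' t' where nn: "n = (x', y', z', t')" by (metis prod.exhaust)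
  obtain x'' y'' z'' t'' where pp: "p = (x'', y'', z'', t'')" by (metis prod.exhaust)
  have rr: "is_rrb T1" "is_rrb T2" "is_rrb T3" "is_rrb T4" "is_rrb L1" "is_rrb L2" "is_rrb L3"
    "is_rrb L4" "rrb_mor T1 T2 x z" "rrb_mor T2 T3 x' z'" "rrb_mor T3 T4 x'' z''"
    "rrb_mor L1 L2 y t" "rrb_mor L2 L3 y' t'" "rrb_mor L3 L4 y'' t''"
    using A B Z W m n p unfolding 1 2 3 4 mm nn pp P_rRB_star_Ob P_rRB_star_Hom by blast+
  note a1 = rrb_mor_arr[OF rr(1,2,9)] and a2 = rrb_mor_arr[OF rr(2,3,10)]
    and a3 = rrb_mor_arr[OF rr(3,4,11)] and b1 = rrb_mor_arr[OF rr(5,6,12)]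
    and b2 = rrb_mor_arr[OF rr(6,7,13)] and b3 = rrb_mor_arr[OF rr(7,8,14)]
  show "(p \<bullet>\<^bsub>P_rRB_star\<^esub> n) \<bullet>\<^bsub>P_rRB_star\<^esub> m = p \<bullet>\<^bsub>P_rRB_star\<^esub> (n \<bullet>\<^bsub>P_rRB_star\<^esub> m)"
    using arr_assoc[OF a1(1) a2(1) a3(1)] arr_assoc[OF a1(2) a2(2) a3(2)]
      arr_assoc[OF b1(1) b2(1) b3(1)] arr_assoc[OF b1(2) b2(2) b3(2)]
    by (simp add: mm nn pp)
qed

section \<open>Functoriality of \<open>Q\<close> and \<open>R\<close>\<close>

lemma Q_simps [simp]:
  "fobj Q ((H, K), (D, E), x, y) =
    (\<lparr>src = H, tgt = K, opr = Idm C (obj H), act = Gam (H, K)\<rparr>,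
     \<lparr>src = D, tgt = E, opr = Idm C (obj D), act = Gam (D, E)\<rparr>, x, x, y, y)"
  "fmor Q (z, t) = (z, t, z, t)"
  by (simp_all add: Q_def F_def)

lemma R_simps [simp]:
  "fobj R (T, L, f, h, g, l) = ((src T, bar T), (src L, bar L), f, g)"
  "fmor R (x, y, z, t) = (x, y)"
  by (simp_all add: R_def G_def bar_def)

lemma is_functor_Q: "is_functor P_coc_HBr P_rRB_star Q"
  unfolding is_functor_def
proof (intro conjI ballI category_P_coc_HBr category_P_rRB_star)
  fix A assume A: "A \<in> Ob P_coc_HBr"
  obtain H K D E x y where A_eq: "A = ((H, K), (D, E), x, y)" by (metis prod.exhaust)
  note A = A[unfolded A_eq P_coc_HBr_Ob]
  have "is_brace (H, K)" "is_brace (D, E)" using A by simp_all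
  note HK = braceD[OF this(1)] and DE = braceD[OF this(2)]
  show "fobj Q A \<in> Ob P_rRB_star"
    using A is_rrb_brace[of H K] is_rrb_brace[of D E] rrb_mor_brace[of H K D E x]
      rrb_mor_brace[of D E H K y] HK(1-3) DE(1-3)
    by (simp add: A_eq hopf_proj_def brace_mor_iff)
  show "fmor Q (Idm P_coc_HBr A) = Idm P_rRB_star (fobj Q A)"
    using HK(3) DE(3) by (simp add: A_eq)
next
  fix A B f assume A: "A \<in> Ob P_coc_HBr" and B: "B \<in> Ob P_coc_HBr" and f: "f \<in> Hom P_coc_HBr A B"
  obtain H K D E x y where A_eq: "A = ((H, K), (D, E), x, y)" by (metis prod.exhaust)
  obtain H' K' D' E' x' y' where B_eq: "B = ((H', K'), (D', E'), x', y')" by (metis prod.exhaust)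
  obtain z t where f_eq: "f = (z, t)" by (metis prod.exhaust)
  show "fmor Q f \<in> Hom P_rRB_star (fobj Q A) (fobj Q B)"
    using A B f rrb_mor_brace[of H K H' K' z] rrb_mor_brace[of D E D' E' t]
    by (simp add: A_eq B_eq f_eq)
next
  fix A B E f g
  assume "f \<in> Hom P_coc_HBr A B" "g \<in> Hom P_coc_HBr B E"
  obtain z t z' t' where "f = (z, t)" "g = (z', t')" by (metis prod.exhaust)
  then show "fmor Q (g \<bullet>\<^bsub>P_coc_HBr\<^esub> f) = fmor Q g \<bullet>\<^bsub>P_rRB_star\<^esub> fmor Q f"
    by simp
qed

lemma is_functor_R: "is_functor P_rRB_star P_coc_HBr R"
  unfolding is_functor_def
proof (intro conjI ballI category_P_coc_HBr category_P_rRB_star)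
  fix A assume A: "A \<in> Ob P_rRB_star"
  obtain T L f h g l where A_eq: "A = (T, L, f, h, g, l)" by (metis prod.exhaust)
  note A = A[unfolded A_eq P_rRB_star_Ob]
  show "fobj R A \<in> Ob P_coc_HBr"
    using A is_brace_bar[of T] is_brace_bar[of L] brace_mor_bar[of T L f h] brace_mor_bar[of L T g l]
    by (simp add: A_eq hopf_proj_def)
  show "fmor R (Idm P_rRB_star A) = Idm P_coc_HBr (fobj R A)"
    by (simp add: A_eq)
next
  fix A B m assume A: "A \<in> Ob P_rRB_star" and B: "B \<in> Ob P_rRB_star" and m: "m \<in> Hom P_rRB_star A B"
  obtain T L f h g l where A_eq: "A = (T, L, f, h, g, l)" by (metis prod.exhaust)
  obtain T' L' f' h' g' l' where B_eq: "B = (T', L', f', h', g', l')" by (metis prod.exhaust)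
  obtain x y z t where m_eq: "m = (x, y, z, t)" by (metis prod.exhaust)
  show "fmor R m \<in> Hom P_coc_HBr (fobj R A) (fobj R B)"
    using A B m brace_mor_bar[of T T' x z] brace_mor_bar[of L L' y t]
    by (simp add: A_eq B_eq m_eq)
next
  fix A B E m n
  assume "m \<in> Hom P_rRB_star A B" "n \<in> Hom P_rRB_star B E"
  obtain x y z t where m: "m = (x, y, z, t)" by (metis prod.exhaust)
  obtain x' y' z' t' where n: "n = (x', y', z', t')" by (metis prod.exhaust)
  show "fmor R (n \<bullet>\<^bsub>P_rRB_star\<^esub> m) = fmor R n \<bullet>\<^bsub>P_coc_HBr\<^esub> fmor R m"
    by (simp add: m n)
qed

lemma is_functor_id: "category D \<Longrightarrow> is_functor D D id_functor"
  by (simp add: is_functor_def id_functor_def)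

lemma is_functor_comp:
  assumes F: "is_functor A B F'" and G: "is_functor B D G'"
  shows "is_functor A D (comp_functor G' F')"
  using F G unfolding is_functor_def comp_functor_def by simp blast

section \<open>Unit, counit and triangle identities\<close>

text \<open>\<open>R\<close> after \<open>Q\<close> rebuilds the second Hopf algebra of a brace as a
  \<open>bar\<close>, whose antipode is given by the formula \<open>rrb_antipode\<close>. Morphisms
  compare algebra and coalgebra structures, so identities serve as components without identifying
  the two antipodes.\<close>

definition adj_unit :: "('o, 'm) brace_proj \<Rightarrow> 'm \<times> 'm" where
  "adj_unit = (\<lambda>(HH, DD, x, y). (Idm C (obj (fst HH)), Idm C (obj (fst DD))))"

definition adj_counit :: "('o, 'm) rrb_proj \<Rightarrow> 'm \<times> 'm \<times> 'm \<times> 'm" where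
  "adj_counit = (\<lambda>(T, L, f, h, g, l). (Idm C (obj (src T)), Idm C (obj (src L)), opr T, opr L))"

lemma brace_mor_unit:
  assumes HK: "is_brace (H, K)" and co: "cocommutative H"
  shows "brace_mor (H, K)
    (H, bar \<lparr>src = H, tgt = K, opr = Idm C (obj H), act = Gam (H, K)\<rparr>) (Idm C (obj H))"
  using brace_mor_id[OF HK] braceD(3-6)[OF HK]
  by (simp add: brace_mor_iff hopf_mor_def alg_mor_def coalg_mor_def rrb_mult_brace[OF HK co])

text \<open>Compatibility with the operators is trivial because the first operator is an identity.
  Compatibility with the actions is \<open>Gam_bar\<close>, and the operator is a Hopf algebra
  morphism by \<open>hopf_mor_opr_bar\<close>.\<close>

lemma rrb_mor_counit:
  assumes T: "is_rrb T" and co: "cocommutative (src T)"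
  shows "rrb_mor \<lparr>src = src T, tgt = bar T, opr = Idm C (obj (src T)), act = Gam (src T, bar T)\<rparr> T
    (Idm C (obj (src T))) (opr T)"
  using hopf_mor_id[OF rrbD(1)[OF T]] hopf_mor_opr_bar[OF T co]
    arr_id_left[OF arr_act_opr[OF T]] by (simp add: rrb_mor_def Gam_bar[OF T co])

lemma nat_trans_unit: "is_nat_trans P_coc_HBr P_coc_HBr id_functor (comp_functor R Q) adj_unit"
  unfolding is_nat_trans_def
proof (intro conjI ballI is_functor_id is_functor_comp[OF is_functor_Q is_functor_R] category_P_coc_HBr)
  fix A assume A: "A \<in> Ob P_coc_HBr"
  obtain H K D E x y where A_eq: "A = ((H, K), (D, E), x, y)" by (metis prod.exhaust)
  note A = A[unfolded A_eq P_coc_HBr_Ob]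
  have "arr x (obj H) (obj D)" "arr y (obj D) (obj H)"
    using A brace_mor_arr by blast+
  then show "adj_unit A \<in> Hom P_coc_HBr (fobj id_functor A) (fobj (comp_functor R Q) A)"
    using A brace_mor_unit[of H K] brace_mor_unit[of D E]
    by (simp add: A_eq adj_unit_def id_functor_def comp_functor_def arr_id_left arr_id_right)
next
  fix A B f assume A: "A \<in> Ob P_coc_HBr" and B: "B \<in> Ob P_coc_HBr" and f: "f \<in> Hom P_coc_HBr A B"
  obtain H K D E x y where A_eq: "A = ((H, K), (D, E), x, y)" by (metis prod.exhaust)
  obtain H' K' D' E' x' y' where B_eq: "B = ((H', K'), (D', E'), x', y')" by (metis prod.exhaust)
  obtain z t where f_eq: "f = (z, t)" by (metis prod.exhaust)
  have "arr z (obj H) (obj H')" "arr t (obj D) (obj D')"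
    using A B f brace_mor_arr unfolding A_eq B_eq f_eq P_coc_HBr_Ob P_coc_HBr_Hom by blast+
  then show "fmor (comp_functor R Q) f \<bullet>\<^bsub>P_coc_HBr\<^esub> adj_unit A
      = adj_unit B \<bullet>\<^bsub>P_coc_HBr\<^esub> fmor id_functor f"
    by (simp add: A_eq B_eq f_eq adj_unit_def id_functor_def comp_functor_def arr_id_left arr_id_right)
qed

text \<open>The equation between operators and morphisms in \<open>rrb_mor\<close> is used twice:
  for \<open>(f, h)\<close> and \<open>(g, l)\<close> it makes the component a morphism of
  projections, and for \<open>(x, z)\<close> and \<open>(y, t)\<close> it is naturality.\<close>

lemma nat_trans_counit: "is_nat_trans P_rRB_star P_rRB_star (comp_functor Q R) id_functor adj_counit"
  unfolding is_nat_trans_def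
proof (intro conjI ballI is_functor_id is_functor_comp[OF is_functor_R is_functor_Q] category_P_rRB_star)
  fix A assume A: "A \<in> Ob P_rRB_star"
  obtain T L f h g l where A_eq: "A = (T, L, f, h, g, l)" by (metis prod.exhaust)
  note A = A[unfolded A_eq P_rRB_star_Ob]
  have "arr f (obj (src T)) (obj (src L))" "arr g (obj (src L)) (obj (src T))"
    using A rrb_mor_arr by blast+
  moreover have "opr L \<bullet> f = h \<bullet> opr T" "opr T \<bullet> g = l \<bullet> opr L"
    using A by (simp_all add: rrb_mor_def)
  ultimately show "adj_counit A \<in> Hom P_rRB_star (fobj (comp_functor Q R) A) (fobj id_functor A)"
    using A rrb_mor_counit[of T] rrb_mor_counit[of L]
    by (simp add: A_eq adj_counit_def id_functor_def comp_functor_def arr_id_left arr_id_right)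
next
  fix A B m assume A: "A \<in> Ob P_rRB_star" and B: "B \<in> Ob P_rRB_star" and m: "m \<in> Hom P_rRB_star A B"
  obtain T L f h g l where A_eq: "A = (T, L, f, h, g, l)" by (metis prod.exhaust)
  obtain T' L' f' h' g' l' where B_eq: "B = (T', L', f', h', g', l')" by (metis prod.exhaust)
  obtain x y z t where m_eq: "m = (x, y, z, t)" by (metis prod.exhaust)
  have "arr x (obj (src T)) (obj (src T'))" "arr y (obj (src L)) (obj (src L'))"
    "opr T' \<bullet> x = z \<bullet> opr T" "opr L' \<bullet> y = t \<bullet> opr L"
    using A B m rrb_mor_arr unfolding A_eq B_eq m_eq P_rRB_star_Ob P_rRB_star_Hom
    by (blast, blast, simp_all add: rrb_mor_def)
  then show "fmor id_functor m \<bullet>\<^bsub>P_rRB_star\<^esub> adj_counit A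
      = adj_counit B \<bullet>\<^bsub>P_rRB_star\<^esub> fmor (comp_functor Q R) m"
    by (simp add: A_eq B_eq m_eq adj_counit_def id_functor_def comp_functor_def arr_id_left
        arr_id_right)
qed

text \<open>Both triangles consist of identities: the operators in an object \<open>fobj Q A\<close>
  are identities, and \<open>R\<close> keeps just the first two components of the counit, in which
  no operator occurs.\<close>

lemma left_adjoint_Q_R: "left_adjoint P_coc_HBr P_rRB_star Q R"
  unfolding left_adjoint_def
proof (intro conjI is_functor_Q is_functor_R exI[of _ adj_unit] exI[of _ adj_counit] ballI
    nat_trans_unit nat_trans_counit)
  fix A assume A: "A \<in> Ob P_coc_HBr"
  obtain H K D E x y where A_eq: "A = ((H, K), (D, E), x, y)" by (metis prod.exhaust)
  note A = A[unfolded A_eq P_coc_HBr_Ob]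
  have HK: "is_brace (H, K)" and DE: "is_brace (D, E)" using A by simp_all
  have "obj H \<in> Ob C" "obj D \<in> Ob C"
    using algD(1)[OF hopf_alg] braceD(1)[OF HK] braceD(1)[OF DE] by blast+
  then show "adj_counit (fobj Q A) \<bullet>\<^bsub>P_rRB_star\<^esub> fmor Q (adj_unit A) = Idm P_rRB_star (fobj Q A)"
    using braceD(3)[OF HK] braceD(3)[OF DE]
    by (simp add: A_eq adj_unit_def adj_counit_def arr_id_left[OF arr_id])
next
  fix B assume B: "B \<in> Ob P_rRB_star"
  obtain T L f h g l where B_eq: "B = (T, L, f, h, g, l)" by (metis prod.exhaust)
  have "is_rrb T" "is_rrb L" using B by (simp_all add: B_eq)
  then have "obj (src T) \<in> Ob C" "obj (src L) \<in> Ob C"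
    using algD(1)[OF hopf_alg] rrbD(1) by blast+
  then show "fmor R (adj_counit B) \<bullet>\<^bsub>P_coc_HBr\<^esub> adj_unit (fobj R B) = Idm P_coc_HBr (fobj R B)"
    by (simp add: B_eq adj_unit_def adj_counit_def arr_id_left[OF arr_id])
qed

end

theorem theorem3p13:
  fixes C :: "('o, 'm) braided_cat"
  assumes "strict_braided_category C"
  shows "left_adjoint (braided_data.P_coc_HBr C) (braided_data.P_rRB_star C)
    (braided_data.Q C) (braided_data.R C)"
proof -
  interpret strict_braided_category C by (fact assms)
  interpret braided_cat_data C by unfold_locales
  show ?thesis by (rule left_adjoint_Q_R)
qed

end
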